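(* There is a uniformly discrete set $\Lambda\subset\mathbb{R}$ with uniform density $D(\Lambda)=1$ such that, for every $0<\delta<1$, $\Lambda$ is a uniqueness set for $X_S$ with $S=[0,1-\delta]+\mathbb{Z}$.
   Context: $X$ denotes the space of continuous functions on $\mathbb{R}$ of at most polynomial growth; each $f\in X$ is a tempered (Schwartz) distribution. The spectrum of $f\in X$ is the minimal closed set $S$ such that $\int_{\mathbb{R}} f(t)\varphi(t)\,dt=0$ for every test function $\varphi$ whose Fourier transform $\hat\varphi$ vanishes in a neighbourhood of $S$ (Fourier transform $\hat\varphi(t)=\int e^{-2\pi i t x}\varphi(x)\,dx$). For a closed set $S$, $X_S$ is the subspace of $X$ of functions with spectrum in $S$. A set $\Lambda$ is uniformly discrete if $\inf\{|\lambda-\lambda'|:\lambda\neq\lambda'\in\Lambda\}>0$; it has uniform density $D(\Lambda)$ if $\mathrm{Card}(\Lambda\cap(x,x+r))=rD(\Lambda)+o(r)$ uniformly in $x$ as $r\to\infty$. $\Lambda$ is a uniqueness set for $X_S$ if $f\in X_S$, $f|_\Lambda=0$ imply $f=0$. *)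

theory Defs
  imports "HOL-Analysis.Analysis"
begin

definition poly_growth_space :: "(real \<Rightarrow> complex) set" where
  "poly_growth_space = {f. continuous_on UNIV f \<and>
     (\<exists>C (N::nat). \<forall>x. norm (f x) \<le> C * (1 + \<bar>x\<bar>) ^ N)}"

definition schwartz :: "(real \<Rightarrow> complex) \<Rightarrow> bool" where
  "schwartz phi \<longleftrightarrow> (\<exists>D :: nat \<Rightarrow> real \<Rightarrow> complex. D 0 = phi \<and>
     (\<forall>n x. (D n has_vector_derivative D (Suc n) x) (at x)) \<and>
     (\<forall>n (k::nat). \<exists>C. \<forall>x. \<bar>x\<bar> ^ k * norm (D n x) \<le> C))"

definition fourier :: "(real \<Rightarrow> complex) \<Rightarrow> real \<Rightarrow> complex" where
  "fourier phi t = integral UNIV (\<lambda>x. exp (- 2 * pi * \<i> * complex_of_real (t * x)) * phi x)"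

definition annihilates :: "real set \<Rightarrow> (real \<Rightarrow> complex) \<Rightarrow> bool" where
  "annihilates S f \<longleftrightarrow> (\<forall>phi. schwartz phi \<and>
      (\<exists>U. open U \<and> S \<subseteq> U \<and> (\<forall>t\<in>U. fourier phi t = 0))
      \<longrightarrow> integral UNIV (\<lambda>x. f x * phi x) = 0)"

definition spectrum_of :: "(real \<Rightarrow> complex) \<Rightarrow> real set" where
  "spectrum_of f = \<Inter> {S. closed S \<and> annihilates S f}"

definition X_S :: "real set \<Rightarrow> (real \<Rightarrow> complex) set" where
  "X_S S = {f \<in> poly_growth_space. spectrum_of f \<subseteq> S}"

definition uniformly_discrete :: "real set \<Rightarrow> bool" where
  "uniformly_discrete L \<longleftrightarrow> (\<exists>d>0. \<forall>a\<in>L. \<forall>b\<in>L. a \<noteq> b \<longrightarrow> d \<le> \<bar>a - b\<bar>)"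

definition has_uniform_density :: "real set \<Rightarrow> real \<Rightarrow> bool" where
  "has_uniform_density L D \<longleftrightarrow> (\<forall>e>0. \<exists>R. \<forall>r\<ge>R. \<forall>x.
      finite (L \<inter> {x<..<x+r}) \<and> \<bar>real (card (L \<inter> {x<..<x+r})) - r * D\<bar> \<le> e * r)"

definition uniqueness_set :: "real set \<Rightarrow> (real \<Rightarrow> complex) set \<Rightarrow> bool" where
  "uniqueness_set L Y \<longleftrightarrow> (\<forall>f\<in>Y. (\<forall>l\<in>L. f l = 0) \<longrightarrow> f = (\<lambda>_. 0))"

end

theory Submission
  imports Defs "HOL-Complex_Analysis.Complex_Analysis" "HOL-Probability.Sinc_Integral"
    "HOL-Real_Asymp.Real_Asymp"
begin

text \<open>
  If the spectrum of \<open>f\<close> lies in \<open>[0,1-\<delta>] + \<int>\<close>, then on every translate \<open>s + \<int>\<close> the values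
  of \<open>f\<close> are interpolated by a function of spectrum in a slightly enlarged interval of length less
  than \<open>1\<close>: the discrete convolution of \<open>f\<close> with the samples \<open>K n\<close> reproduces \<open>f\<close> as soon as the
  \<open>1\<close>-periodic multiplier \<open>\<Sum>n. K n e\<^bsup>2\<pi>int\<^esup>\<close> equals \<open>1\<close> near the spectrum, and
  \<open>F z = \<Sum>n. f (n + s) K (z - n)\<close> is then entire of exponential type less than \<open>\<pi>\<close> (after centring)
  with polynomial growth on the line. Such an \<open>F\<close> vanishes identically if it vanishes at all integers
  of infinitely many double blocks \<open>a \<le> \<bar>n\<bar> < a\<^sup>2\<close>; no zeros are needed elsewhere. So the integers
  can be cut into blocks \<open>2\<^bsup>2^k\<^esup> \<le> \<bar>n\<bar> < 2\<^bsup>2^(k+1)\<^esup>\<close>, each shifted by its own number, in such a way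
  that every rational shift in \<open>[0,1)\<close> occurs in infinitely many blocks. Then \<open>f\<close> vanishes on
  all of \<open>\<rat>\<close>, hence everywhere.
\<close>

section \<open>Entire functions vanishing on long blocks of integers\<close>

text \<open>Multiplying \<open>f\<close> by a function such as sin(pi (x - s))^2 keeps the spectrum
  in [0,1-\<delta>] + \<int> and creates zeros on all of s + \<int>. So no single translate of
  \<int> determines \<open>f\<close>; a set of density 1 has to serve a dense family of translates,
  and each of them can own only scattered stretches of integers. What decides the length of a
  stretch is a comparison of two costs. In a disc of radius R, the 2a - 1 missing integers near the
  centre cost a factor (2R)^(2a-1), while an indicator deficit c below pi gains exp(cR/2). Any R
  large against a log a would do; R near a^2 makes the end of each stretch the square of its
  beginning. A second obstacle is that \<open>spectrum_of\<close> is an intersection of annihilating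
  sets, so the annihilation of test functions by \<open>f\<close> has to be localized before it can
  be used. It is localized only for test functions with boundedly supported transform, and pointwise
  identities are then recovered with a band-limited approximate identity. Every kernel is built from
  transforms of bumps, whose vanishing properties come from dividing the bump by a function without
  zeros on its support.\<close>

lemma norm_sin_pi_lower_bound:
  fixes z :: complex and b :: nat
  assumes "norm z = real b + 1/2" "b \<ge> 1"
  shows "exp (pi * \<bar>Im z\<bar>) / 3 \<le> norm (sin (of_real pi * z))"
proof -
  define x y E where "x = Re z" and "y = Im z" and "E = exp (2 * pi * \<bar>y\<bar>)"
  have nrm: "(norm (sin (of_real pi * z)))\<^sup>2 =
      (exp (2 * (pi * y)) + inverse (exp (2 * (pi * y))) - 2 * cos (2 * (pi * x))) / 4"
    unfolding norm_sin_squared x_def y_def by simp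
  have "exp (2 * (pi * y)) + inverse (exp (2 * (pi * y))) \<ge> E"
    unfolding E_def by (cases "y \<ge> 0") (simp_all add: exp_minus[symmetric] mult.assoc)
  hence ge: "(norm (sin (of_real pi * z)))\<^sup>2 \<ge> (E - 2 * cos (2 * (pi * x))) / 4"
    unfolding nrm by (simp add: divide_right_mono)
  have "E > 0" by (simp add: E_def)
  have "E / 9 \<le> (norm (sin (of_real pi * z)))\<^sup>2"
  \<comment> \<open>Away from the axis \<open>E\<close> is at least exp pi > 4, so E/9 <= (E - 2)/4
    whatever the cosine is. Near the axis the half-integral radius forces |x| to within 1/4 of b +
    1/2, where the cosine is not positive.\<close>
  proof (cases "\<bar>y\<bar> \<ge> 1/2")
    case True
    have "pi \<le> 2 * pi * \<bar>y\<bar>" using True pi_gt_zero by (simp add: field_simps)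
    hence "E \<ge> 4"
      using exp_ge_add_one_self[of "2 * pi * \<bar>y\<bar>"] pi_gt3 unfolding E_def by linarith
    moreover have "cos (2 * (pi * x)) \<le> 1" by simp
    ultimately have "E / 9 \<le> (E - 2 * cos (2 * (pi * x))) / 4" by argo
    thus ?thesis using ge by (rule order_trans)
  next
    case False
    define R where "R = real b + 1/2"
    have R: "R \<ge> 3/2" using assms(2) by (simp add: R_def)
    have xy: "\<bar>x\<bar>\<^sup>2 + \<bar>y\<bar>\<^sup>2 = R\<^sup>2"
      using assms(1) cmod_power2[of z] by (simp add: R_def x_def y_def)
    have xR: "\<bar>x\<bar> \<le> R" using assms(1) abs_Re_le_cmod[of z] by (simp add: R_def x_def)
    have y2: "\<bar>y\<bar>\<^sup>2 \<le> 1/4"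
      using power_mono[of "\<bar>y\<bar>" "1/2" 2] False by (simp add: power2_eq_square)
    have "(R - \<bar>x\<bar>) * (R + \<bar>x\<bar>) \<le> 1/4"
      using xy y2 by (simp add: algebra_simps power2_eq_square)
    moreover have "(R - \<bar>x\<bar>) * 1 \<le> (R - \<bar>x\<bar>) * (R + \<bar>x\<bar>)"
      using R xR by (intro mult_left_mono) auto
    ultimately have d: "R - \<bar>x\<bar> \<le> 1/4" unfolding mult_1_right by (rule order_trans[rotated])
    define th where "th = 2 * pi * (R - \<bar>x\<bar>)"
    have th: "0 \<le> th" "th \<le> pi/2"
      using xR mult_left_mono[OF d, of "2 * pi"] unfolding th_def by auto
    have "cos (2 * (pi * x)) = cos (2 * pi * \<bar>x\<bar>)" by (cases "x \<ge> 0") (auto simp: mult.assoc)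
    also have "2 * pi * \<bar>x\<bar> = 2 * pi * real b + (pi - th)"
      by (simp add: th_def R_def algebra_simps)
    also have "cos \<dots> = - cos th"
      using cos_2npi[of b] sin_2npi[of b] by (simp add: cos_add mult_ac)
    also have "\<dots> \<le> 0" using th cos_ge_zero by simp
    finally have "E / 9 \<le> (E - 2 * cos (2 * (pi * x))) / 4" using \<open>E > 0\<close> by argo
    thus ?thesis using ge by (rule order_trans)
  qed
  moreover have "(exp (pi * \<bar>Im z\<bar>) / 3)\<^sup>2 = E / 9"
    by (simp add: E_def y_def power2_eq_square exp_add[symmetric])
  ultimately show ?thesis
    by (metis norm_ge_zero power2_le_imp_le)
qed

text \<open>The zeros of the sine are simple and sit at the integers, where \<open>J\<close>
  vanishes inside the disc. The l'Hopital values complete the quotient continuously, and a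
  continuous function that is holomorphic off finitely many points is holomorphic.\<close>

lemma divide_sin_pi_extension:
  fixes J :: "complex \<Rightarrow> complex"
  assumes J: "J holomorphic_on UNIV" and zero: "\<And>n::int. \<bar>real_of_int n\<bar> < r \<Longrightarrow> J (of_int n) = 0"
  obtains H where "H holomorphic_on ball 0 r"
    "\<And>z. z \<in> ball 0 r \<Longrightarrow> J z = H z * sin (of_real pi * z)"
proof -
  define H where "H = (\<lambda>z. if z \<in> \<int> then deriv J z / (of_real pi * cos (of_real pi * z))
                           else J z / sin (of_real pi * z))"
  have sin0: "sin (of_real pi * z) = 0 \<longleftrightarrow> z \<in> \<int>" for z :: complex
  proof -
    have "sin (of_real pi * z) = 0 \<longleftrightarrow> (\<exists>n::int. z = of_int n)"
      by (auto simp: sin_eq_0)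
    thus ?thesis by (auto simp: Ints_def)
  qed
  have cos0: "cos (of_real pi * z) \<noteq> 0" if "z \<in> \<int>" for z :: complex
    using sin0[of z] that sin_cos_squared_add[of "of_real pi * z"] by auto
  have op: "open (- (\<int> :: complex set))"
    using closed_Ints by auto
  have hol: "H holomorphic_on (- \<int>)"
  proof -
    have "(\<lambda>z. J z / sin (of_real pi * z)) holomorphic_on (- \<int>)"
      using sin0 by (intro holomorphic_intros holomorphic_on_subset[OF J]) auto
    thus ?thesis by (rule holomorphic_transform) (auto simp: H_def)
  qed
  have lim: "H \<midarrow>z\<rightarrow> H z" if z: "z \<in> \<int>" "z \<in> ball 0 r" for z
  proof -
    obtain n :: int where n: "z = of_int n" using z by (auto elim: Ints_cases)
    have J0: "J z = 0" using zero[of n] z n by auto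
    have s0: "sin (of_real pi * z) = 0" using sin0 z by blast
    have "(J has_field_derivative deriv J z) (at z)"
      using J by (meson UNIV_I holomorphic_derivI open_UNIV)
    moreover have "((\<lambda>w. sin (of_real pi * w)) has_field_derivative (of_real pi * cos (of_real pi * z))) (at z)"
      by (auto intro!: derivative_eq_intros)
    ultimately have "((\<lambda>w. J w / sin (of_real pi * w)) \<longlongrightarrow> deriv J z / (of_real pi * cos (of_real pi * z))) (at z)"
      using cos0[OF z(1)] J0 s0 by (intro lhopital_complex_simple[OF _ _ _ _ _ refl]) auto
    moreover have "\<forall>\<^sub>F w in at z. J w / sin (of_real pi * w) = H w"
    proof -
      have "\<forall>\<^sub>F w in at z. w \<in> ball z 1 - {z}"
        by (intro eventually_at_in_open) auto
      thus ?thesis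
      proof eventually_elim
        case (elim w)
        have "w \<notin> \<int>"
        proof
          assume "w \<in> \<int>"
          then obtain m :: int where m: "w = of_int m" by (auto elim: Ints_cases)
          have "norm (of_int (n - m) :: complex) < 1" using elim m n by (simp add: dist_norm)
          hence "n = m" unfolding norm_of_int by linarith
          thus False using elim m n by simp
        qed
        thus ?case by (simp add: H_def)
      qed
    qed
    ultimately show ?thesis using z by (simp add: H_def filterlim_cong)
  qed
  have cont: "continuous_on (ball 0 r) H"
  proof (rule continuous_at_imp_continuous_on, rule ballI)
    fix z :: complex assume z: "z \<in> ball 0 r"
    show "isCont H z"
    proof (cases "z \<in> \<int>")
      case True thus ?thesis using lim z by (simp add: isCont_def)
    next
      case False
      thus ?thesis using hol op holomorphic_on_imp_continuous_on[OF hol]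
        by (simp add: continuous_on_eq_continuous_at)
    qed
  qed
  have "finite (\<int> \<inter> ball 0 r :: complex set)"
  proof -
    have "\<int> \<inter> ball 0 r \<subseteq> (of_int ` {- \<lceil>r\<rceil>..\<lceil>r\<rceil>} :: complex set)"
    proof
      fix z :: complex assume "z \<in> \<int> \<inter> ball 0 r"
      then obtain m :: int where m: "z = of_int m" "\<bar>real_of_int m\<bar> < r" by (auto elim: Ints_cases)
      hence "m \<in> {- \<lceil>r\<rceil>..\<lceil>r\<rceil>}" by (simp, linarith)
      thus "z \<in> of_int ` {- \<lceil>r\<rceil>..\<lceil>r\<rceil>}" using m by blast
    qed
    thus ?thesis by (rule finite_subset) auto
  qed
  moreover have "H holomorphic_on (ball 0 r - (\<int> \<inter> ball 0 r))"
    by (rule holomorphic_on_subset[OF hol]) auto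
  ultimately have "H holomorphic_on ball 0 r"
    using no_isolated_singularity[OF cont] by auto
  moreover have "J z = H z * sin (of_real pi * z)" if "z \<in> ball 0 r" for z
  proof (cases "z \<in> \<int>")
    case True
    then obtain m :: int where m: "z = of_int m" by (auto elim: Ints_cases)
    thus ?thesis using zero[of m] that sin0[of z] True by simp
  next
    case False thus ?thesis using sin0[of z] by (simp add: H_def)
  qed
  ultimately show thesis using that by blast
qed

text \<open>With R = a^2 - 1/2, each of the 2a - 1 integers below the block costs a factor 2R, in
  all exp(O(a log a)), and the growth of degree N costs only a power of a. Both lose against exp(-c
  R).\<close>

lemma gap_growth_limit:
  assumes "c > 0"
  shows "(\<lambda>a. (1 + ((real a)\<^sup>2 - 1/2)) ^ N * (2 * ((real a)\<^sup>2 - 1/2)) ^ (2 * a - 1)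
      * exp (- c * ((real a)\<^sup>2 - 1/2))) \<longlonglongrightarrow> 0"
proof -
  have lim: "filterlim (\<lambda>a. real (N + 2 * a) * ln (2 * (real a)\<^sup>2) - c * ((real a)\<^sup>2 - 1/2)) at_bot sequentially"
    using assms unfolding of_nat_add of_nat_mult by real_asymp
  have "(\<lambda>a. exp (real (N + 2 * a) * ln (2 * (real a)\<^sup>2) - c * ((real a)\<^sup>2 - 1/2))) \<longlonglongrightarrow> 0"
    by (rule filterlim_compose[OF exp_at_bot lim])
  thus ?thesis
  proof (rule tendsto_sandwich[OF _ _ tendsto_const, rotated -1])
    show "\<forall>\<^sub>F a in sequentially. 0 \<le> (1 + ((real a)\<^sup>2 - 1/2)) ^ N * (2 * ((real a)\<^sup>2 - 1/2)) ^ (2 * a - 1)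
      * exp (- c * ((real a)\<^sup>2 - 1/2))"
      using eventually_ge_at_top[of 1]
    proof eventually_elim
      case (elim a)
      have "(real a)\<^sup>2 \<ge> 1" using elim by (simp add: power_le_one_iff one_le_power)
      thus ?case by (intro mult_nonneg_nonneg zero_le_power) auto
    qed
    show "\<forall>\<^sub>F a in sequentially. (1 + ((real a)\<^sup>2 - 1/2)) ^ N * (2 * ((real a)\<^sup>2 - 1/2)) ^ (2 * a - 1)
      * exp (- c * ((real a)\<^sup>2 - 1/2)) \<le> exp (real (N + 2 * a) * ln (2 * (real a)\<^sup>2) - c * ((real a)\<^sup>2 - 1/2))"
      using eventually_ge_at_top[of 1]
    proof eventually_elim
      case (elim a)
      have a2: "(real a)\<^sup>2 \<ge> 1" using elim by (simp add: one_le_power)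
      have "(1 + ((real a)\<^sup>2 - 1/2)) ^ N * (2 * ((real a)\<^sup>2 - 1/2)) ^ (2 * a - 1)
          \<le> (2 * (real a)\<^sup>2) ^ N * (2 * (real a)\<^sup>2) ^ (2 * a - 1)"
        using a2 by (intro mult_mono power_mono) auto
      also have "\<dots> = (2 * (real a)\<^sup>2) ^ (N + (2 * a - 1))" by (simp add: power_add)
      also have "\<dots> \<le> (2 * (real a)\<^sup>2) ^ (N + 2 * a)" using a2 by (intro power_increasing) auto
      also have "\<dots> = exp (real (N + 2 * a) * ln (2 * (real a)\<^sup>2))"
        using elim a2 by (simp only: exp_of_nat_mult) (subst exp_ln, auto)
      finally show ?case
        using mult_right_mono[OF _ exp_ge_zero] exp_add diff_conv_add_uminus mult_minus_left
        by metis
    qed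
  qed
qed

text \<open>
  The quotient of \<open>G z * (\<Prod>\<bar>n\<bar> < a. z - n)\<close> by \<open>sin (\<pi> z)\<close> is holomorphic in the disc of radius
  \<open>R = a\<^sup>2 - 1/2\<close> and decays like \<open>exp (- c \<bar>Im z\<bar>)\<close> on its boundary. The factor
  \<open>exp (c R / 2 - c z\<^sup>2 / (2 R))\<close> has modulus \<open>exp (c (Im z)\<^sup>2 / R) \<le> exp (c \<bar>Im z\<bar>)\<close> there but is of size
  \<open>exp (c R / 2)\<close> near the centre, so the maximum principle beats the polynomial factor \<open>(2 R)\<^bsup>2 a\<^esup>\<close>.
\<close>

lemma entire_zero_of_zeros_on_long_blocks:
  fixes G :: "complex \<Rightarrow> complex" and c C :: real and N :: nat
  assumes hol: "G holomorphic_on UNIV" and c: "c > 0"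
    and bd: "\<And>z. norm (G z) \<le> C * (1 + norm z) ^ N * exp ((pi - c) * \<bar>Im z\<bar>)"
    and zeros: "\<exists>\<^sub>\<infinity>a::nat. \<forall>n::int. int a \<le> \<bar>n\<bar> \<and> \<bar>n\<bar> < int (a\<^sup>2) \<longrightarrow> G (of_int n) = 0"
  shows "G = (\<lambda>_. 0)"
proof -
  have C0: "C \<ge> 0" using bd[of 0] norm_ge_zero[of "G 0"] by (simp del: norm_ge_zero)
  \<comment> \<open>The point \<open>w\<close> stays fixed while \<open>a\<close> grows. On Im w >=
    1 every factor w - n of the auxiliary product has modulus at least 1, so that |G w| <= |J
    w|.\<close>
  have key: "norm (G w) \<le> 3 * C * exp (c * (norm w)\<^sup>2) * norm (sin (of_real pi * w)) *
      ((1 + ((real a)\<^sup>2 - 1/2)) ^ N * (2 * ((real a)\<^sup>2 - 1/2)) ^ (2 * a - 1)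
      * exp (- (c/2) * ((real a)\<^sup>2 - 1/2)))"
    if w: "Im w \<ge> 1" and a: "a \<ge> 2" "real a > norm w"
      and z: "\<forall>n::int. int a \<le> \<bar>n\<bar> \<and> \<bar>n\<bar> < int (a\<^sup>2) \<longrightarrow> G (of_int n) = 0" for w a
  proof -
    define R where "R = (real a)\<^sup>2 - 1/2"
    define I where "I = {- (int a - 1)..int a - 1}"
    define J where "J = (\<lambda>z. G z * (\<Prod>n\<in>I. z - of_int n))"
    have a4: "real a * 2 \<le> (real a)\<^sup>2" using a by (simp add: power2_eq_square)
    have R1: "R \<ge> 1" "real a < R" "norm w < R" using a a4 unfolding R_def by auto
    have cardI: "card I = 2 * a - 1" unfolding I_def using a by simp
    have J: "J holomorphic_on UNIV" unfolding J_def by (intro holomorphic_intros hol)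
    have Jz: "J (of_int n) = 0" if "\<bar>real_of_int n\<bar> < (real a)\<^sup>2" for n :: int
    proof (cases "n \<in> I")
      case True
      hence "(\<Prod>m\<in>I. (of_int n - of_int m :: complex)) = 0" by (intro prod_zero) (auto simp: I_def)
      thus ?thesis by (simp add: J_def)
    next
      case False
      have "\<bar>n\<bar> < int (a\<^sup>2)"
      proof -
        have "real_of_int \<bar>n\<bar> < real_of_int (int (a\<^sup>2))" using that by simp
        thus ?thesis by linarith
      qed
      moreover have "int a \<le> \<bar>n\<bar>" using False unfolding I_def by auto
      ultimately show ?thesis using z by (simp add: J_def)
    qed
    obtain H where H: "H holomorphic_on ball 0 ((real a)\<^sup>2)"
      and JH: "\<And>z. z \<in> ball 0 ((real a)\<^sup>2) \<Longrightarrow> J z = H z * sin (of_real pi * z)"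
      using divide_sin_pi_extension[OF J Jz] by metis
    define T where "T = (\<lambda>z. H z * exp (of_real (c * R / 2) - of_real (c / (2 * R)) * z\<^sup>2))"
    have T: "T holomorphic_on ball 0 ((real a)\<^sup>2)"
      unfolding T_def by (intro holomorphic_intros H)
    have sub: "cball 0 R \<subseteq> ball (0::complex) ((real a)\<^sup>2)" by (auto simp: R_def)
    have bdT: "norm (T z) \<le> 3 * C * (1 + R) ^ N * (2 * R) ^ (2 * a - 1)" if zR: "norm z = R" for z
    proof -
      define s where "s = norm (sin (of_real pi * z))"
      have "2 * 2 \<le> a * a" using a by (intro mult_mono) auto
      hence a21: "a\<^sup>2 \<ge> 1" "a\<^sup>2 - 1 \<ge> 1" unfolding power2_eq_square by linarith+
      \<comment> \<open>Since R = (a^2 - 1) + 1/2, the circle crosses the real axis midway between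
        two integers.\<close>
      have slow: "exp (pi * \<bar>Im z\<bar>) / 3 \<le> s"
        unfolding s_def
        by (rule norm_sin_pi_lower_bound[of z "a\<^sup>2 - 1"])
           (use zR a21 in \<open>simp_all add: R_def of_nat_diff\<close>)
      have spos: "s > 0" using slow exp_gt_zero[of "pi * \<bar>Im z\<bar>"] by linarith
      have "norm (J z) = norm (H z) * s"
        using JH[of z] sub zR by (auto simp: s_def norm_mult)
      hence Hz: "norm (H z) = norm (J z) / s" using spos by simp
      have "norm (\<Prod>n\<in>I. z - of_int n) \<le> (\<Prod>n\<in>I. 2 * R)"
      proof -
        have "norm (z - of_int n) \<le> 2 * R" if "n \<in> I" for n
        proof -
          have "norm (z - of_int n) \<le> norm z + norm (of_int n :: complex)" by (rule norm_triangle_ineq4)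
          also have "norm (of_int n :: complex) \<le> real a" 
            using that unfolding norm_of_int I_def by auto
          finally show ?thesis using R1 zR by linarith
        qed
        thus ?thesis unfolding prod_norm[symmetric] by (intro prod_mono) auto
      qed
      hence P: "norm (\<Prod>n\<in>I. z - of_int n) \<le> (2 * R) ^ (2 * a - 1)" by (simp add: cardI)
      have "norm (J z) \<le> (C * (1 + R) ^ N * exp ((pi - c) * \<bar>Im z\<bar>)) * (2 * R) ^ (2 * a - 1)"
        unfolding J_def norm_mult using bd[of z] zR P C0 R1 by (intro mult_mono) auto
      also have "\<dots> = C * (1 + R) ^ N * (2 * R) ^ (2 * a - 1) * exp (- c * \<bar>Im z\<bar>) * exp (pi * \<bar>Im z\<bar>)"
        by (simp add: exp_add[symmetric] algebra_simps)
      also have "\<dots> \<le> C * (1 + R) ^ N * (2 * R) ^ (2 * a - 1) * exp (- c * \<bar>Im z\<bar>) * (3 * s)"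
        using slow C0 R1 by (intro mult_left_mono mult_nonneg_nonneg) auto
      finally have H1: "norm (H z) \<le> 3 * C * (1 + R) ^ N * (2 * R) ^ (2 * a - 1) * exp (- c * \<bar>Im z\<bar>)"
        unfolding Hz using spos by (simp add: field_simps)
      have "Re (of_real (c * R / 2) - of_real (c / (2 * R)) * z\<^sup>2) = c / R * (Im z)\<^sup>2"
      proof -
        have "(Re z)\<^sup>2 = R\<^sup>2 - (Im z)\<^sup>2" using cmod_power2[of z] zR by simp
        hence "Re (z\<^sup>2) = R\<^sup>2 - 2 * (Im z)\<^sup>2" by (simp add: Re_power2)
        hence "Re (of_real (c * R / 2) - of_real (c / (2 * R)) * z\<^sup>2)
            = c * R / 2 - c / (2 * R) * (R\<^sup>2 - 2 * (Im z)\<^sup>2)" by simp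
        also have "\<dots> = c / R * (Im z)\<^sup>2" using R1 by (simp add: field_simps power2_eq_square)
        finally show ?thesis .
      qed
      also have "\<dots> \<le> c * \<bar>Im z\<bar>"
      proof -
        have "(Im z)\<^sup>2 = \<bar>Im z\<bar> * \<bar>Im z\<bar>" by (simp add: power2_eq_square)
        also have "\<dots> \<le> R * \<bar>Im z\<bar>" using abs_Im_le_cmod[of z] zR by (intro mult_right_mono) auto
        finally show ?thesis using c R1 by (simp add: field_simps)
      qed
      finally have "norm (exp (of_real (c * R / 2) - of_real (c / (2 * R)) * z\<^sup>2)) \<le> exp (c * \<bar>Im z\<bar>)"
        unfolding norm_exp_eq_Re by simp
      hence "norm (T z) \<le> (3 * C * (1 + R) ^ N * (2 * R) ^ (2 * a - 1) * exp (- c * \<bar>Im z\<bar>)) * exp (c * \<bar>Im z\<bar>)"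
        unfolding T_def norm_mult using H1 C0 R1 by (intro mult_mono) auto
      also have "\<dots> = 3 * C * (1 + R) ^ N * (2 * R) ^ (2 * a - 1) * (exp (- c * \<bar>Im z\<bar>) * exp (c * \<bar>Im z\<bar>))"
        by (simp only: mult.assoc)
      also have "exp (- c * \<bar>Im z\<bar>) * exp (c * \<bar>Im z\<bar>) = 1" by (simp add: exp_add[symmetric])
      finally show ?thesis by simp
    qed
    have Tw: "norm (T w) \<le> 3 * C * (1 + R) ^ N * (2 * R) ^ (2 * a - 1)"
    proof (rule maximum_modulus_frontier[of T "cball 0 R"])
      show "T holomorphic_on interior (cball 0 R)"
        by (rule holomorphic_on_subset[OF T]) (use sub interior_subset in blast)
      show "continuous_on (closure (cball 0 R)) T"
        using holomorphic_on_imp_continuous_on[OF T] sub continuous_on_subset by auto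
    qed (use R1 bdT in auto)
    \<comment> \<open>As R >= 1, the coefficient c/(2R) is at most c: the loss exp(-c |w|^2) does
      not depend on R, and the gain exp(cR/2) survives in full.\<close>
    have Ew: "norm (exp (of_real (c * R / 2) - of_real (c / (2 * R)) * w\<^sup>2)) \<ge> exp (c * R / 2 - c * (norm w)\<^sup>2)"
    proof -
      have "Re (of_real (c / (2 * R)) * w\<^sup>2) \<le> norm (of_real (c / (2 * R)) * w\<^sup>2)" by (rule complex_Re_le_cmod)
      also have "\<dots> = (c / (2 * R)) * (norm w)\<^sup>2" using c R1 by (simp add: norm_mult norm_power norm_divide)
      also have "\<dots> \<le> c * (norm w)\<^sup>2" using c R1 by (intro mult_right_mono) (auto simp: field_simps)
      finally show ?thesis unfolding norm_exp_eq_Re by simp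
    qed
    have "norm (H w) * exp (c * R / 2 - c * (norm w)\<^sup>2) \<le> norm (T w)"
      unfolding T_def norm_mult using Ew by (intro mult_left_mono) auto
    also note Tw
    finally have "(norm (H w) * exp (c * R / 2 - c * (norm w)\<^sup>2)) * exp (c * (norm w)\<^sup>2 - c * R / 2)
        \<le> 3 * C * (1 + R) ^ N * (2 * R) ^ (2 * a - 1) * exp (c * (norm w)\<^sup>2 - c * R / 2)"
      by (rule mult_right_mono) simp
    hence Hw: "norm (H w) \<le> 3 * C * (1 + R) ^ N * (2 * R) ^ (2 * a - 1) * exp (c * (norm w)\<^sup>2 - c * R / 2)"
      by (simp add: mult.assoc exp_add[symmetric])
    have "1 \<le> norm (\<Prod>n\<in>I. w - of_int n)"
      unfolding prod_norm[symmetric]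
    proof (intro prod_ge_1)
      fix n assume "n \<in> I"
      have "1 \<le> \<bar>Im (w - of_int n)\<bar>" using w by simp
      also have "\<dots> \<le> norm (w - of_int n)" by (rule abs_Im_le_cmod)
      finally show "1 \<le> norm (w - of_int n)" .
    qed
    hence "norm (G w) \<le> norm (J w)" unfolding J_def norm_mult by (simp add: mult_le_cancel_left1)
    also have "\<dots> = norm (H w) * norm (sin (of_real pi * w))"
      using JH[of w] sub R1 by (simp add: norm_mult subset_eq)
    also have "\<dots> \<le> (3 * C * (1 + R) ^ N * (2 * R) ^ (2 * a - 1) * exp (c * (norm w)\<^sup>2 - c * R / 2)) * norm (sin (of_real pi * w))"
      by (intro mult_right_mono Hw) auto
    also have "\<dots> = 3 * C * exp (c * (norm w)\<^sup>2) * norm (sin (of_real pi * w)) *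
      ((1 + R) ^ N * (2 * R) ^ (2 * a - 1) * exp (- (c/2) * R))"
    proof -
      have "exp (c * (norm w)\<^sup>2 - c * R / 2) = exp (c * (norm w)\<^sup>2) * exp (- (c/2) * R)"
        by (simp add: exp_add[symmetric])
      thus ?thesis by (simp only: mult_ac)
    qed
    finally show ?thesis unfolding R_def .
  qed
  have G0: "G w = 0" if w: "Im w \<ge> 1" for w
  proof -
    define q where "q = (\<lambda>a. 3 * C * exp (c * (norm w)\<^sup>2) * norm (sin (of_real pi * w)) *
      ((1 + ((real a)\<^sup>2 - 1/2)) ^ N * (2 * ((real a)\<^sup>2 - 1/2)) ^ (2 * a - 1)
      * exp (- (c/2) * ((real a)\<^sup>2 - 1/2))))"
    have "q \<longlonglongrightarrow> 0"
      unfolding q_def by (rule tendsto_mult_right_zero, rule gap_growth_limit) (use c in auto)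
    \<comment> \<open>The zeros are available only for infinitely many \<open>a\<close>, whereas
      \<open>q a\<close> is small for all large \<open>a\<close>; some \<open>a\<close> therefore
      satisfies both.\<close>
    have "norm (G w) \<le> e" if "e > 0" for e
    proof -
      have "\<forall>\<^sub>F a in sequentially. q a < e"
        using \<open>q \<longlonglongrightarrow> 0\<close> that order_tendstoD by blast
      moreover have "\<forall>\<^sub>F a in sequentially. a \<ge> 2 \<and> real a > norm w"
        by (intro eventually_conj eventually_ge_at_top) real_asymp
      ultimately have "\<forall>\<^sub>F a in sequentially. q a < e \<and> a \<ge> 2 \<and> real a > norm w"
        by eventually_elim auto
      hence "\<exists>\<^sub>\<infinity>a. (\<forall>n::int. int a \<le> \<bar>n\<bar> \<and> \<bar>n\<bar> < int (a\<^sup>2) \<longrightarrow> G (of_int n) = 0) \<and> (q a < e \<and> a \<ge> 2 \<and> real a > norm w)"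
        using zeros by (simp add: cofinite_eq_sequentially frequently_eventually_frequently)
      from frequently_ex[OF this] obtain a where "\<forall>n::int. int a \<le> \<bar>n\<bar> \<and> \<bar>n\<bar> < int (a\<^sup>2) \<longrightarrow> G (of_int n) = 0"
        "q a < e" "a \<ge> 2" "real a > norm w" by blast
      moreover have "norm (G w) \<le> q a"
        unfolding q_def by (rule key[OF w]) fact+
      ultimately show ?thesis by linarith
    qed
    hence "norm (G w) \<le> 0" by (rule field_le_epsilon[of _ 0, simplified])
    thus ?thesis by simp
  qed
  \<comment> \<open>The disc of radius 1 about 2i lies in Im z > 1, and the identity theorem carries
    the zeros from there to the whole plane.\<close>
  have "G w = 0" for w
  proof (rule analytic_continuation[OF hol, of "ball (2 * \<i>) 1" "2 * \<i>"])
    show "2 * \<i> islimpt ball (2 * \<i>) 1" by (intro open_imp_islimpt) auto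
    fix z :: complex assume "z \<in> ball (2 * \<i>) 1"
    hence "\<bar>Im (2 * \<i> - z)\<bar> < 1" using abs_Im_le_cmod[of "2 * \<i> - z"] by (simp add: dist_norm)
    thus "G z = 0" by (intro G0) auto
  qed auto
  thus ?thesis by auto
qed

section \<open>Schwartz functions and bump functions\<close>

text \<open>The weight 1 + |x| replaces |x| because it is submultiplicative under translation, 1 +
  |x| <= (1 + |x + r|)(1 + |r|), and because its powers increase with the exponent.\<close>

definition rapidly_decreasing :: "(real \<Rightarrow> complex) \<Rightarrow> bool" where
  "rapidly_decreasing f \<longleftrightarrow> (\<forall>k::nat. \<exists>C. \<forall>x. norm (f x) * (1 + \<bar>x\<bar>) ^ k \<le> C)"

lemma rapidly_decreasing_add:
  assumes "rapidly_decreasing f" "rapidly_decreasing g"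
  shows "rapidly_decreasing (\<lambda>x. f x + g x)"
  unfolding rapidly_decreasing_def
proof
  fix k :: nat
  obtain C D where C: "\<And>x. norm (f x) * (1 + \<bar>x\<bar>) ^ k \<le> C" and D: "\<And>x. norm (g x) * (1 + \<bar>x\<bar>) ^ k \<le> D"
    using assms unfolding rapidly_decreasing_def by metis
  have "norm (f x + g x) * (1 + \<bar>x\<bar>) ^ k \<le> C + D" for x
  proof -
    have "norm (f x + g x) * (1 + \<bar>x\<bar>) ^ k \<le> (norm (f x) + norm (g x)) * (1 + \<bar>x\<bar>) ^ k"
      by (intro mult_right_mono norm_triangle_ineq) auto
    thus ?thesis using C[of x] D[of x] by (simp add: distrib_right)
  qed
  thus "\<exists>C. \<forall>x. norm (f x + g x) * (1 + \<bar>x\<bar>) ^ k \<le> C" by blast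
qed

lemma rapidly_decreasing_mult:
  assumes "rapidly_decreasing f" "rapidly_decreasing g"
  shows "rapidly_decreasing (\<lambda>x. f x * g x)"
  unfolding rapidly_decreasing_def
proof
  fix k :: nat
  obtain C where C: "\<And>x. norm (f x) * (1 + \<bar>x\<bar>) ^ k \<le> C"
    using assms(1) unfolding rapidly_decreasing_def by metis
  obtain D where D: "\<And>x. norm (g x) * (1 + \<bar>x\<bar>) ^ 0 \<le> D"
    using assms(2) unfolding rapidly_decreasing_def by metis
  have "norm (f x * g x) * (1 + \<bar>x\<bar>) ^ k \<le> C * D" for x
  proof -
    have "norm (f x * g x) * (1 + \<bar>x\<bar>) ^ k = (norm (f x) * (1 + \<bar>x\<bar>) ^ k) * norm (g x)"
      by (simp add: norm_mult)
    also have "\<dots> \<le> C * D"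
      using C[of x] D[of x] by (intro mult_mono order_trans[OF _ C[of x]]) auto
    finally show ?thesis .
  qed
  thus "\<exists>C. \<forall>x. norm (f x * g x) * (1 + \<bar>x\<bar>) ^ k \<le> C" by blast
qed

lemma rapidly_decreasing_affine:
  assumes "rapidly_decreasing f" "a \<noteq> 0"
  shows "rapidly_decreasing (\<lambda>x. c * f (a * x + b))"
  unfolding rapidly_decreasing_def
proof
  fix k :: nat
  obtain C where C: "\<And>x. norm (f x) * (1 + \<bar>x\<bar>) ^ k \<le> C"
    using assms(1) unfolding rapidly_decreasing_def by metis
  define M where "M = (1 + \<bar>b\<bar>) * (1 + 1 / \<bar>a\<bar>)"
  have "norm (c * f (a * x + b)) * (1 + \<bar>x\<bar>) ^ k \<le> norm c * (C * M ^ k)" for x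
  proof -
    have "\<bar>x\<bar> = \<bar>(a * x + b) - b\<bar> / \<bar>a\<bar>" using assms(2) by (simp add: abs_mult)
    also have "\<dots> \<le> (\<bar>a * x + b\<bar> + \<bar>b\<bar>) / \<bar>a\<bar>"
      by (intro divide_right_mono abs_triangle_ineq4) auto
    finally have "1 + \<bar>x\<bar> \<le> 1 + (\<bar>a * x + b\<bar> + \<bar>b\<bar>) / \<bar>a\<bar>" by simp
    also have "\<dots> \<le> M * (1 + \<bar>a * x + b\<bar>)"
      using assms(2) by (simp add: M_def field_simps)
    finally have *: "1 + \<bar>x\<bar> \<le> M * (1 + \<bar>a * x + b\<bar>)" .
    have M0: "M \<ge> 0" by (simp add: M_def)
    have "(1 + \<bar>x\<bar>) ^ k \<le> (1 + \<bar>a * x + b\<bar>) ^ k * M ^ k"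
      using power_mono[OF *, of k] by (simp add: power_mult_distrib mult.commute)
    hence "norm (f (a * x + b)) * (1 + \<bar>x\<bar>) ^ k \<le> norm (f (a * x + b)) * ((1 + \<bar>a * x + b\<bar>) ^ k * M ^ k)"
      by (rule mult_left_mono) simp
    also have "\<dots> = (norm (f (a * x + b)) * (1 + \<bar>a * x + b\<bar>) ^ k) * M ^ k" by simp
    also have "\<dots> \<le> C * M ^ k" using C M0 by (intro mult_right_mono) auto
    finally show ?thesis by (simp add: norm_mult mult.assoc mult_left_mono)
  qed
  thus "\<exists>C. \<forall>x. norm (c * f (a * x + b)) * (1 + \<bar>x\<bar>) ^ k \<le> C" by blast
qed

lemma schwartz_iff_rapidly_decreasing:
  "schwartz phi \<longleftrightarrow> (\<exists>D :: nat \<Rightarrow> real \<Rightarrow> complex. D 0 = phi \<and>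
     (\<forall>n x. (D n has_vector_derivative D (Suc n) x) (at x)) \<and> (\<forall>n. rapidly_decreasing (D n)))"
proof -
  have "(\<forall>k::nat. \<exists>C. \<forall>x. \<bar>x\<bar> ^ k * norm (f x) \<le> C) \<longleftrightarrow> rapidly_decreasing f" for f :: "real \<Rightarrow> complex"
  proof
    assume *: "\<forall>k::nat. \<exists>C. \<forall>x. \<bar>x\<bar> ^ k * norm (f x) \<le> C"
    show "rapidly_decreasing f"
      unfolding rapidly_decreasing_def
    proof
      fix k :: nat
      obtain C0 where C0: "\<And>x. \<bar>x\<bar> ^ 0 * norm (f x) \<le> C0" using *[rule_format, of 0] by blast
      obtain C1 where C1: "\<And>x. \<bar>x\<bar> ^ k * norm (f x) \<le> C1" using *[rule_format, of k] by blast
      have "norm (f x) * (1 + \<bar>x\<bar>) ^ k \<le> 2 ^ k * (C0 + C1)" for x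
      proof -
        have "(1 + \<bar>x\<bar>) ^ k \<le> (2 * max 1 \<bar>x\<bar>) ^ k" by (intro power_mono) auto
        also have "\<dots> \<le> 2 ^ k * (1 + \<bar>x\<bar> ^ k)"
          by (simp add: power_mult_distrib max_def)
        finally have "norm (f x) * (1 + \<bar>x\<bar>) ^ k \<le> norm (f x) * (2 ^ k * (1 + \<bar>x\<bar> ^ k))"
          by (rule mult_left_mono) simp
        also have "\<dots> = 2 ^ k * (\<bar>x\<bar> ^ 0 * norm (f x) + \<bar>x\<bar> ^ k * norm (f x))"
          by (simp add: algebra_simps)
        also have "\<dots> \<le> 2 ^ k * (C0 + C1)" using C0[of x] C1[of x] by (intro mult_left_mono add_mono) auto
        finally show ?thesis .
      qed
      thus "\<exists>C. \<forall>x. norm (f x) * (1 + \<bar>x\<bar>) ^ k \<le> C" by blast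
    qed
  next
    assume *: "rapidly_decreasing f"
    show "\<forall>k::nat. \<exists>C. \<forall>x. \<bar>x\<bar> ^ k * norm (f x) \<le> C"
    proof
      fix k :: nat
      obtain C where C: "\<And>x. norm (f x) * (1 + \<bar>x\<bar>) ^ k \<le> C"
        using * unfolding rapidly_decreasing_def by metis
      have "\<bar>x\<bar> ^ k * norm (f x) \<le> C" for x
      proof -
        have "\<bar>x\<bar> ^ k \<le> (1 + \<bar>x\<bar>) ^ k" by (intro power_mono) auto
        hence "\<bar>x\<bar> ^ k * norm (f x) \<le> norm (f x) * (1 + \<bar>x\<bar>) ^ k" by (simp add: mult_ac mult_left_mono)
        thus ?thesis using C[of x] by linarith
      qed
      thus "\<exists>C. \<forall>x. \<bar>x\<bar> ^ k * norm (f x) \<le> C" by blast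
    qed
  qed
  thus ?thesis unfolding schwartz_def by metis
qed

lemma derivative_closed_sequence:
  fixes A :: "(real \<Rightarrow> complex) set"
  assumes "f \<in> A" "\<And>g. g \<in> A \<Longrightarrow> \<exists>g'\<in>A. \<forall>x. (g has_vector_derivative g' x) (at x)"
  obtains D where "D 0 = f" "\<And>n. D n \<in> A" "\<And>n x. (D n has_vector_derivative D (Suc n) x) (at x)"
proof -
  have "\<exists>D. \<forall>n. (D n \<in> A \<and> (n = 0 \<longrightarrow> D n = f)) \<and> (\<forall>x. (D n has_vector_derivative D (Suc n) x) (at x))"
    using assms by (intro dependent_nat_choice) auto
  thus thesis using that by metis
qed

text \<open>Dependent choice turns a class of rapidly decreasing functions that is closed under
  differentiation into the sequence of derivatives required by \<open>schwartz\<close>. Later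
  closure proofs thus only have to exhibit such a class, with no formula for the n-th
  derivative.\<close>

lemma schwartz_coinduct:
  assumes "f \<in> A" "\<And>g. g \<in> A \<Longrightarrow> rapidly_decreasing g"
    "\<And>g. g \<in> A \<Longrightarrow> \<exists>g'\<in>A. \<forall>x. (g has_vector_derivative g' x) (at x)"
  shows "schwartz f"
  using derivative_closed_sequence[OF assms(1,3)] assms(2)
  unfolding schwartz_iff_rapidly_decreasing by metis

lemma schwartz_imp_rapidly_decreasing: "schwartz f \<Longrightarrow> rapidly_decreasing f"
  unfolding schwartz_iff_rapidly_decreasing by blast

lemma schwartz_derivative:
  assumes "schwartz f"
  obtains f' where "schwartz f'" "\<And>x. (f has_vector_derivative f' x) (at x)"
proof -
  obtain D where D: "D 0 = f" "\<forall>n x. (D n has_vector_derivative D (Suc n) x) (at x)" "\<forall>n. rapidly_decreasing (D n)"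
    using assms unfolding schwartz_iff_rapidly_decreasing by blast
  have "schwartz (D 1)"
    unfolding schwartz_iff_rapidly_decreasing by (rule exI[of _ "\<lambda>n. D (Suc n)"]) (use D in auto)
  thus thesis using that D by (metis One_nat_def)
qed

lemma schwartz_imp_continuous: "schwartz f \<Longrightarrow> continuous_on UNIV f"
  by (metis schwartz_derivative has_vector_derivative_continuous continuous_at_imp_continuous_on)

inductive_set schwartz_products :: "(real \<Rightarrow> complex) set" where
  prod: "schwartz f \<Longrightarrow> schwartz g \<Longrightarrow> (\<lambda>x. f x * g x) \<in> schwartz_products"
| sum: "f \<in> schwartz_products \<Longrightarrow> g \<in> schwartz_products \<Longrightarrow> (\<lambda>x. f x + g x) \<in> schwartz_products"

lemma schwartz_mult:
  assumes "schwartz f" "schwartz g"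
  shows "schwartz (\<lambda>x. f x * g x)"
proof (rule schwartz_coinduct[of _ schwartz_products])
  show "(\<lambda>x. f x * g x) \<in> schwartz_products" using assms by (rule schwartz_products.prod)
next
  fix h assume "h \<in> schwartz_products"
  thus "rapidly_decreasing h"
    by induction (auto intro: rapidly_decreasing_add rapidly_decreasing_mult schwartz_imp_rapidly_decreasing)
next
  fix h assume "h \<in> schwartz_products"
  thus "\<exists>h'\<in>schwartz_products. \<forall>x. (h has_vector_derivative h' x) (at x)"
  proof induction
    case (prod f g)
    obtain f' where f': "schwartz f'" "\<And>x. (f has_vector_derivative f' x) (at x)"
      using schwartz_derivative[OF prod(1)] by blast
    obtain g' where g': "schwartz g'" "\<And>x. (g has_vector_derivative g' x) (at x)"
      using schwartz_derivative[OF prod(2)] by blast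
    show ?case
      by (rule bexI[of _ "\<lambda>x. f x * g' x + f' x * g x"])
         (use f' g' prod in \<open>auto intro!: has_vector_derivative_mult schwartz_products.intros\<close>)
  next
    case (sum f g)
    then obtain f' g' where "f' \<in> schwartz_products" "g' \<in> schwartz_products"
      "\<And>x. (f has_vector_derivative f' x) (at x)" "\<And>x. (g has_vector_derivative g' x) (at x)" by blast
    thus ?case
      by (intro bexI[of _ "\<lambda>x. f' x + g' x"]) (auto intro!: derivative_intros schwartz_products.intros)
  qed
qed

lemma schwartz_affine:
  assumes "schwartz f" "a \<noteq> 0"
  shows "schwartz (\<lambda>x. f (a * x + b))"
\<comment> \<open>The free scalar \<open>c\<close> absorbs the factor \<open>a\<close> that each use
  of the chain rule produces.\<close>
proof (rule schwartz_coinduct[of _ "{(\<lambda>x. c * f (a * x + b)) | f c. schwartz f}"])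
  show "(\<lambda>x. f (a * x + b)) \<in> {(\<lambda>x. c * f (a * x + b)) | f c. schwartz f}"
    using assms by (auto intro!: exI[of _ f] exI[of _ 1])
next
  fix h assume "h \<in> {(\<lambda>x. c * f (a * x + b)) | f c. schwartz f}"
  thus "rapidly_decreasing h"
    using assms(2) by (auto intro: rapidly_decreasing_affine schwartz_imp_rapidly_decreasing)
next
  fix h assume "h \<in> {(\<lambda>x. c * f (a * x + b)) | f c. schwartz f}"
  then obtain g c where h: "h = (\<lambda>x. c * g (a * x + b))" "schwartz g" by blast
  obtain g' where g': "schwartz g'" "\<And>x. (g has_vector_derivative g' x) (at x)"
    using schwartz_derivative[OF h(2)] by blast
  have "(h has_vector_derivative (c * of_real a) * g' (a * x + b)) (at x)" for x
  proof -
    have "((\<lambda>x. a * x + b) has_vector_derivative a) (at x)"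
      by (auto intro!: derivative_eq_intros simp: has_real_derivative_iff_has_vector_derivative[symmetric])
    from vector_diff_chain_at[OF this g'(2)] have "((\<lambda>x. g (a * x + b)) has_vector_derivative a *\<^sub>R g' (a * x + b)) (at x)"
      by (simp add: o_def)
    from has_vector_derivative_mult_right[OF this, of c] show ?thesis
      unfolding h by (simp add: scaleR_conv_of_real mult.assoc)
  qed
  thus "\<exists>h'\<in>{(\<lambda>x. c * f (a * x + b)) | f c. schwartz f}. \<forall>x. (h has_vector_derivative h' x) (at x)"
    using g'(1) by (intro bexI[of _ "\<lambda>x. (c * of_real a) * g' (a * x + b)"]) auto
qed

section \<open>Smooth functions of compact support\<close>

text \<open>All derivatives vanish at the endpoints -e and e as well, so integration by parts over
  [-e, e] leaves no boundary terms. As for \<open>schwartz\<close>, smoothness is carried by a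
  sequence of derivatives.\<close>

definition bump :: "real \<Rightarrow> (real \<Rightarrow> complex) \<Rightarrow> bool" where
  "bump e b \<longleftrightarrow> (\<exists>D :: nat \<Rightarrow> real \<Rightarrow> complex. D 0 = b \<and>
     (\<forall>n x. (D n has_vector_derivative D (Suc n) x) (at x)) \<and> (\<forall>n x. \<bar>x\<bar> \<ge> e \<longrightarrow> D n x = 0))"

lemma bump_coinduct:
  assumes "f \<in> A" "\<And>g x. g \<in> A \<Longrightarrow> \<bar>x\<bar> \<ge> e \<Longrightarrow> g x = 0"
    "\<And>g. g \<in> A \<Longrightarrow> \<exists>g'\<in>A. \<forall>x. (g has_vector_derivative g' x) (at x)"
  shows "bump e f"
  using derivative_closed_sequence[OF assms(1,3)] assms(2)
  unfolding bump_def by metis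

lemma bump_derivative:
  assumes "bump e f"
  obtains f' where "bump e f'" "\<And>x. (f has_vector_derivative f' x) (at x)"
proof -
  obtain D where D: "D 0 = f" "\<forall>n x. (D n has_vector_derivative D (Suc n) x) (at x)" "\<forall>n x. \<bar>x\<bar> \<ge> e \<longrightarrow> D n x = 0"
    using assms unfolding bump_def by blast
  have "bump e (D 1)"
    unfolding bump_def by (rule exI[of _ "\<lambda>n. D (Suc n)"]) (use D in auto)
  thus thesis using that D by (metis One_nat_def)
qed

lemma bump_zero: "bump e f \<Longrightarrow> \<bar>x\<bar> \<ge> e \<Longrightarrow> f x = 0"
  unfolding bump_def by blast

lemma bump_continuous: "bump e f \<Longrightarrow> continuous_on S f"
  by (metis bump_derivative has_vector_derivative_continuous continuous_at_imp_continuous_on)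

lemma bump_add:
  assumes "bump e f" "bump e g"
  shows "bump e (\<lambda>x. f x + g x)"
proof (rule bump_coinduct[of _ "{(\<lambda>x. f x + g x) | f g. bump e f \<and> bump e g}"])
  fix h assume "h \<in> {(\<lambda>x. f x + g x) | f g. bump e f \<and> bump e g}"
  then obtain f g where h: "h = (\<lambda>x. f x + g x)" "bump e f" "bump e g" by blast
  obtain f' where f': "bump e f'" "\<And>x. (f has_vector_derivative f' x) (at x)"
    using bump_derivative[OF h(2)] by blast
  obtain g' where g': "bump e g'" "\<And>x. (g has_vector_derivative g' x) (at x)"
    using bump_derivative[OF h(3)] by blast
  show "\<exists>h'\<in>{(\<lambda>x. f x + g x) | f g. bump e f \<and> bump e g}. \<forall>x. (h has_vector_derivative h' x) (at x)"
    using f' g' unfolding h by (intro bexI[of _ "\<lambda>x. f' x + g' x"]) (auto intro!: derivative_intros)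
qed (use assms in \<open>auto simp: bump_zero\<close>)

lemma bump_cmult:
  assumes "bump e f"
  shows "bump e (\<lambda>x. c * f x)"
proof (rule bump_coinduct[of _ "{(\<lambda>x. c * f x) | f. bump e f}"])
  fix h assume "h \<in> {(\<lambda>x. c * f x) | f. bump e f}"
  then obtain f where h: "h = (\<lambda>x. c * f x)" "bump e f" by blast
  obtain f' where f': "bump e f'" "\<And>x. (f has_vector_derivative f' x) (at x)"
    using bump_derivative[OF h(2)] by blast
  show "\<exists>h'\<in>{(\<lambda>x. c * f x) | f. bump e f}. \<forall>x. (h has_vector_derivative h' x) (at x)"
    using f' unfolding h by (intro bexI[of _ "\<lambda>x. c * f' x"]) (auto intro!: derivative_intros)
qed (use assms in \<open>auto simp: bump_zero\<close>)

text \<open>Multiplication by \<open>u\<close> is what differentiation of the transform produces.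
  Since (u f)' = u f' + f, the class of all u f + g is closed under differentiation.\<close>

lemma bump_times_id:
  assumes "bump e f"
  shows "bump e (\<lambda>x. of_real x * f x)"
proof (rule bump_coinduct[of _ "{(\<lambda>x. of_real x * f x + g x) | f g. bump e f \<and> bump e g}"])
  show "(\<lambda>x. of_real x * f x) \<in> {(\<lambda>x. of_real x * f x + g x) | f g. bump e f \<and> bump e g}"
    using assms bump_cmult[OF assms, of 0] by (intro CollectI exI[of _ f] exI[of _ "\<lambda>_. 0"]) simp
next
  fix h assume "h \<in> {(\<lambda>x. of_real x * f x + g x) | f g. bump e f \<and> bump e g}"
  then obtain f g where h: "h = (\<lambda>x. of_real x * f x + g x)" "bump e f" "bump e g" by blast
  obtain f' where f': "bump e f'" "\<And>x. (f has_vector_derivative f' x) (at x)"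
    using bump_derivative[OF h(2)] by blast
  obtain g' where g': "bump e g'" "\<And>x. (g has_vector_derivative g' x) (at x)"
    using bump_derivative[OF h(3)] by blast
  have "(h has_vector_derivative of_real x * f' x + (f x + g' x)) (at x)" for x
  proof -
    have "((\<lambda>x. of_real x :: complex) has_vector_derivative 1) (at x)"
      by (rule has_vector_derivative_real_field[THEN has_vector_derivative_eq_rhs])
         (auto intro!: derivative_eq_intros)
    from has_vector_derivative_add[OF has_vector_derivative_mult[OF this f'(2)[of x]] g'(2)[of x]]
    show ?thesis unfolding h by (simp add: add.assoc)
  qed
  thus "\<exists>h'\<in>{(\<lambda>x. of_real x * f x + g x) | f g. bump e f \<and> bump e g}. \<forall>x. (h has_vector_derivative h' x) (at x)"
    using f'(1) g'(1) bump_add[OF h(2) g'(1)]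
    by (intro bexI[of _ "\<lambda>x. of_real x * f' x + (f x + g' x)"]) auto
next
  fix h x assume "h \<in> {(\<lambda>x. of_real x * f x + g x) | f g. bump e f \<and> bump e g}" "e \<le> \<bar>x\<bar>"
  thus "h x = 0" by (auto simp: bump_zero)
qed

text \<open>For k = 0 this is the classical smooth function that is flat at the origin. The negative
  powers of \<open>x\<close> make the span of the family closed under differentiation.\<close>

definition flat :: "nat \<Rightarrow> real \<Rightarrow> real" where
  "flat k x = (if x > 0 then exp (- 1 / x) / x ^ k else 0)"

lemma flat_has_derivative:
  "(flat k has_real_derivative flat (k + 2) x - real k * flat (k + 1) x) (at x)"
proof -
  consider "x > 0" | "x < 0" | "x = 0" by linarith
  thus ?thesis
  proof cases
    case 1
    have "((\<lambda>x. exp (- 1 / x) * inverse (x ^ k)) has_real_derivative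
        (exp (- 1 / x) * (1 / x\<^sup>2)) * inverse (x ^ k) + exp (-1/x) * (- (real k * x ^ (k - 1)) * inverse (x ^ k * x ^ k))) (at x)"
      using 1 by (auto intro!: derivative_eq_intros simp: power2_eq_square)
    also have "(exp (- 1 / x) * (1 / x\<^sup>2)) * inverse (x ^ k) + exp (-1/x) * (- (real k * x ^ (k - 1)) * inverse (x ^ k * x ^ k))
        = flat (k + 2) x - real k * flat (k + 1) x"
      using 1 by (cases k) (auto simp: flat_def field_simps power2_eq_square)
    finally have d: "((\<lambda>x. exp (- 1 / x) * inverse (x ^ k)) has_real_derivative
        flat (k + 2) x - real k * flat (k + 1) x) (at x)" .
    have "\<forall>\<^sub>F y in nhds x. exp (- 1 / y) * inverse (y ^ k) = flat k y"
      using 1 eventually_nhds_in_open[of "{0<..}" x]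
      by (auto simp: flat_def divide_inverse elim!: eventually_mono)
    from DERIV_cong_ev[OF refl this refl] show ?thesis using d by simp
  next
    case 2
    have "((\<lambda>_. 0) has_real_derivative 0) (at x)" by simp
    moreover have "\<forall>\<^sub>F y in nhds x. 0 = flat k y"
      using 2 eventually_nhds_in_open[of "{..<0}" x] by (auto simp: flat_def elim!: eventually_mono)
    ultimately have "(flat k has_real_derivative 0) (at x)"
      using DERIV_cong_ev[OF refl _ refl, of "\<lambda>_. 0" "flat k" x 0] by simp
    thus ?thesis using 2 by (simp add: flat_def)
  next
    case 3
    have r: "((\<lambda>h::real. exp (- 1 / h) / h ^ (k + 1)) \<longlongrightarrow> 0) (at_right 0)"
      by real_asymp
    have "((\<lambda>h. flat k h / h) \<longlongrightarrow> 0) (at_right 0)"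
      by (rule Lim_transform_eventually[OF r])
         (rule eventually_mono[OF eventually_at_right_less], simp add: flat_def)
    moreover have "((\<lambda>h. flat k h / h) \<longlongrightarrow> 0) (at_left 0)"
      by (rule Lim_transform_eventually[OF tendsto_const])
         (auto simp: flat_def eventually_at_filter intro!: always_eventually)
    ultimately have "((\<lambda>h. flat k h / h) \<longlongrightarrow> 0) (at 0)" by (rule filterlim_split_at[rotated])
    hence "(flat k has_real_derivative 0) (at 0)"
      by (simp add: has_field_derivative_iff flat_def)
    thus ?thesis using 3 by (simp add: flat_def)
  qed
qed


text \<open>The first flat factor vanishes for x <= -e, the second for x >= e, which gives the
  support. Differentiating such a product yields a sum of four products of the same shape, with new
  real coefficients.\<close>

inductive_set flat_products :: "real \<Rightarrow> (real \<Rightarrow> complex) set" for e :: real where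
  prod: "(\<lambda>x. of_real (c * (flat i (e + x) * flat j (e - x)))) \<in> flat_products e"
| sum: "f \<in> flat_products e \<Longrightarrow> g \<in> flat_products e \<Longrightarrow> (\<lambda>x. f x + g x) \<in> flat_products e"

lemma bump_flat: "bump e (\<lambda>x. of_real (flat 0 (e + x) * flat 0 (e - x)))"
proof (rule bump_coinduct[of _ "flat_products e"])
  show "(\<lambda>x. of_real (flat 0 (e + x) * flat 0 (e - x))) \<in> flat_products e"
    using flat_products.prod[of 1] by simp
next
  fix h x assume "h \<in> flat_products e" "e \<le> \<bar>x\<bar>"
  thus "h x = 0" by induction (auto simp: flat_def)
next
  fix h assume "h \<in> flat_products e"
  thus "\<exists>h'\<in>flat_products e. \<forall>x. (h has_vector_derivative h' x) (at x)"
  proof induction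
    case (prod c i j)
    define p where "p = (\<lambda>c i j x. complex_of_real (c * (flat i (e + x) * flat j (e - x))))"
    have pin: "p c i j \<in> flat_products e" for c i j
      unfolding p_def by (rule flat_products.prod)
    define h' where "h' = (\<lambda>x. (p c (i + 2) j x + p (- c * real i) (i + 1) j x)
      + (p (- c) i (j + 2) x + p (c * real j) i (j + 1) x))"
    have "((\<lambda>x. complex_of_real (c * (flat i (e + x) * flat j (e - x)))) has_vector_derivative h' x) (at x)" for x
    proof -
      have "((\<lambda>x. c * (flat i (e + x) * flat j (e - x))) has_real_derivative
        c * ((flat (i + 2) (e + x) - real i * flat (i + 1) (e + x)) * flat j (e - x)
          + flat i (e + x) * - (flat (j + 2) (e - x) - real j * flat (j + 1) (e - x)))) (at x)"
        by (auto intro!: derivative_eq_intros DERIV_chain2[OF flat_has_derivative])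
      from has_vector_derivative_of_real[OF this] show ?thesis
        by (rule has_vector_derivative_eq_rhs) (simp add: h'_def p_def algebra_simps)
    qed
    moreover have "h' \<in> flat_products e"
      unfolding h'_def by (intro flat_products.sum pin)
    ultimately show ?case by blast
  next
    case (sum f g)
    then obtain f' g' where "f' \<in> flat_products e" "g' \<in> flat_products e"
      "\<And>x. (f has_vector_derivative f' x) (at x)" "\<And>x. (g has_vector_derivative g' x) (at x)" by blast
    thus ?case
      by (intro bexI[of _ "\<lambda>x. f' x + g' x"]) (auto intro!: derivative_intros flat_products.sum)
  qed
qed

section \<open>Fourier-Laplace transforms of bumps\<close>

text \<open>The Fourier-Laplace transform of \<open>b\<close>. The frequency is complex because the
  same function serves twice: on the line as a Schwartz function, and in the plane as an entire
  factor of the interpolation kernel.\<close>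

definition bump_ft :: "real \<Rightarrow> (real \<Rightarrow> complex) \<Rightarrow> complex \<Rightarrow> complex" where
  "bump_ft e b z = integral {-e..e} (\<lambda>u. b u * exp (- (2 * of_real pi * \<i> * z) * of_real u))"

lemma bump_ft_derivative:
  assumes b: "bump e b" and b': "\<And>x. (b has_vector_derivative b' x) (at x)" "bump e b'" and e: "e > 0"
  shows "bump_ft e b' z = (2 * of_real pi * \<i> * z) * bump_ft e b z"
proof -
  define w where "w = 2 * of_real pi * \<i> * z"
  have "((\<lambda>u. b u * (- w * exp (- w * of_real u)) + b' u * exp (- w * of_real u)) has_integral
      b e * exp (- w * of_real e) - b (- e) * exp (- w * of_real (- e))) {-e..e}"
  proof (rule fundamental_theorem_of_calculus)
    fix x assume "x \<in> {-e..e}"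
    have "((\<lambda>u. exp (- w * of_real u)) has_vector_derivative (- w * exp (- w * of_real x))) (at x)"
      by (rule has_vector_derivative_real_field) (auto intro!: derivative_eq_intros)
    from has_vector_derivative_mult[OF b'(1)[of x] this]
    show "((\<lambda>u. b u * exp (- w * of_real u)) has_vector_derivative
          b x * (- w * exp (- w * of_real x)) + b' x * exp (- w * of_real x)) (at x within {-e..e})"
      by (rule has_vector_derivative_at_within)
  qed (use e in auto)
  also have "b e * exp (- w * of_real e) - b (- e) * exp (- w * of_real (- e)) = 0"
    using bump_zero[OF b, of e] bump_zero[OF b, of "-e"] e by simp
  finally have 0: "((\<lambda>u. b u * (- w * exp (- w * of_real u)) + b' u * exp (- w * of_real u)) has_integral 0) {-e..e}" .
  have 1: "((\<lambda>u. w * (b u * exp (- w * of_real u))) has_integral w * bump_ft e b z) {-e..e}"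
    unfolding bump_ft_def w_def
    by (intro has_integral_mult_right integrable_integral integrable_continuous_interval continuous_intros bump_continuous[OF b])
  have "((\<lambda>u. b' u * exp (- w * of_real u)) has_integral 0 + w * bump_ft e b z) {-e..e}"
    using has_integral_add[OF 0 1] by (rule has_integral_eq[rotated]) (simp add: algebra_simps)
  thus ?thesis unfolding bump_ft_def[of e b'] w_def by (simp add: integral_unique)
qed

text \<open>The easy half of the Paley-Wiener theorem: the support gives the exponential factor, and
  each derivative of the bump buys one power of |z|. The induction varies \<open>b\<close>, since
  its step applies the hypothesis to \<open>b\<close> and to its derivative.\<close>

lemma bump_ft_decay:
  assumes b: "bump e b" and e: "e > 0"
  shows "\<exists>C\<ge>0. \<forall>z. norm (bump_ft e b z) * (1 + norm z) ^ k \<le> C * exp (2 * pi * e * \<bar>Im z\<bar>)"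
  using b
proof (induction k arbitrary: b)
  case 0
  have "compact (b ` {-e..e})"
    by (rule compact_continuous_image[OF bump_continuous[OF 0]]) simp
  then obtain M where M: "\<And>x. x \<in> {-e..e} \<Longrightarrow> norm (b x) \<le> M"
    by (metis compact_imp_bounded bounded_iff imageI)
  have M0: "M \<ge> 0" using M[of 0] e norm_ge_zero[of "b 0"] by (simp del: norm_ge_zero)
  have "norm (bump_ft e b z) \<le> (M * exp (2 * pi * e * \<bar>Im z\<bar>)) * (e - - e)" for z
    unfolding bump_ft_def
  proof (rule integral_bound)
    fix u assume u: "u \<in> {-e..e}"
    have "Re (- (2 * of_real pi * \<i> * z) * of_real u) = 2 * pi * (Im z * u)" by simp
    also have "Im z * u \<le> \<bar>Im z\<bar> * \<bar>u\<bar>" by (metis abs_ge_self abs_mult)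
    also have "\<bar>Im z\<bar> * \<bar>u\<bar> \<le> \<bar>Im z\<bar> * e" using u by (intro mult_left_mono) auto
    finally have "norm (exp (- (2 * of_real pi * \<i> * z) * of_real u)) \<le> exp (2 * pi * e * \<bar>Im z\<bar>)"
      unfolding norm_exp_eq_Re by (simp add: mult_ac)
    thus "norm (b u * exp (- (2 * of_real pi * \<i> * z) * of_real u)) \<le> M * exp (2 * pi * e * \<bar>Im z\<bar>)"
      unfolding norm_mult using M[OF u] M0 by (intro mult_mono) auto
  qed (use e in \<open>auto intro!: continuous_intros bump_continuous[OF 0]\<close>)
  thus ?case using M0 e by (intro exI[of _ "M * (e - - e)"]) (auto simp: mult_ac)
next
  case (Suc k)
  obtain b' where b': "bump e b'" "\<And>x. (b has_vector_derivative b' x) (at x)"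
    using bump_derivative[OF Suc.prems] by blast
  obtain C where C: "C \<ge> 0" "\<And>z. norm (bump_ft e b z) * (1 + norm z) ^ k \<le> C * exp (2 * pi * e * \<bar>Im z\<bar>)"
    using Suc.IH[OF Suc.prems] by blast
  obtain D where D: "D \<ge> 0" "\<And>z. norm (bump_ft e b' z) * (1 + norm z) ^ k \<le> D * exp (2 * pi * e * \<bar>Im z\<bar>)"
    using Suc.IH[OF b'(1)] by blast
  have "norm (bump_ft e b z) * (1 + norm z) ^ Suc k \<le> (C + D) * exp (2 * pi * e * \<bar>Im z\<bar>)" for z
  proof -
    have "norm (bump_ft e b' z) = 2 * pi * (norm z * norm (bump_ft e b z))"
      unfolding bump_ft_derivative[OF Suc.prems b'(2,1) e] by (simp add: norm_mult)
    moreover have "1 * (norm z * norm (bump_ft e b z)) \<le> 2 * pi * (norm z * norm (bump_ft e b z))"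
      using pi_gt3 by (intro mult_right_mono) auto
    ultimately have "norm z * norm (bump_ft e b z) \<le> norm (bump_ft e b' z)" by simp
    hence "(norm z * norm (bump_ft e b z)) * (1 + norm z) ^ k \<le> norm (bump_ft e b' z) * (1 + norm z) ^ k"
      by (rule mult_right_mono) simp
    moreover have "norm (bump_ft e b z) * (1 + norm z) ^ Suc k
        = norm (bump_ft e b z) * (1 + norm z) ^ k + (norm z * norm (bump_ft e b z)) * (1 + norm z) ^ k"
      by (simp add: algebra_simps)
    ultimately show ?thesis using C(2)[of z] D(2)[of z] by (simp add: distrib_right)
  qed
  thus ?case using C(1) D(1) by (intro exI[of _ "C + D"]) auto
qed

lemma bump_ft_has_field_derivative:
  assumes b: "bump e b"
  shows "(bump_ft e b has_field_derivative bump_ft e (\<lambda>u. - (2 * of_real pi * \<i>) * (of_real u * b u)) z) (at z)"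
proof -
  have "((\<lambda>z. integral (cbox (-e) e) (\<lambda>u. b u * exp (- (2 * of_real pi * \<i> * z) * of_real u))) has_field_derivative
    integral (cbox (-e) e) (\<lambda>u. (- (2 * of_real pi * \<i>) * (of_real u * b u)) * exp (- (2 * of_real pi * \<i> * z) * of_real u)))
    (at z within UNIV)"
  proof (rule leibniz_rule_field_derivative)
    show "continuous_on (UNIV \<times> cbox (- e) e) (\<lambda>(z, u). - (2 * of_real pi * \<i>) * (of_real u * b u) * exp (- (2 * of_real pi * \<i> * z) * of_real u))"
      unfolding split_beta
      by (intro continuous_intros continuous_on_compose2[OF bump_continuous[OF b, of UNIV]]) auto
  qed (auto intro!: derivative_eq_intros integrable_continuous_real continuous_intros bump_continuous[OF b])
  thus ?thesis unfolding bump_ft_def[abs_def] by simp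
qed

lemma bump_ft_holomorphic: "bump e b \<Longrightarrow> bump_ft e b holomorphic_on S"
  by (metis bump_ft_has_field_derivative field_differentiable_at_within field_differentiable_def holomorphic_on_def)

lemma schwartz_bump_ft:
  assumes b: "bump e b" and e: "e > 0"
  shows "schwartz (\<lambda>x. bump_ft e b (of_real x))"
proof (rule schwartz_coinduct[of _ "{(\<lambda>x. bump_ft e b (of_real x)) | b. bump e b}"])
  show "(\<lambda>x. bump_ft e b (of_real x)) \<in> {(\<lambda>x. bump_ft e b (of_real x)) | b. bump e b}" using b by blast
next
  fix h assume "h \<in> {(\<lambda>x. bump_ft e b (of_real x)) | b. bump e b}"
  then obtain b where h: "h = (\<lambda>x. bump_ft e b (of_real x))" "bump e b" by blast
  show "rapidly_decreasing h"
    unfolding rapidly_decreasing_def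
  proof
    fix k :: nat
    obtain C where C: "\<And>z. norm (bump_ft e b z) * (1 + norm z) ^ k \<le> C * exp (2 * pi * e * \<bar>Im z\<bar>)"
      using bump_ft_decay[OF h(2) e] by blast
    show "\<exists>C. \<forall>x. norm (h x) * (1 + \<bar>x\<bar>) ^ k \<le> C"
      using C[of "of_real _"] unfolding h by auto
  qed
  have "(h has_vector_derivative bump_ft e (\<lambda>u. - (2 * of_real pi * \<i>) * (of_real u * b u)) (of_real x)) (at x)" for x
    unfolding h by (rule has_vector_derivative_real_field[OF bump_ft_has_field_derivative[OF h(2)]])
  thus "\<exists>h'\<in>{(\<lambda>x. bump_ft e b (of_real x)) | b. bump e b}. \<forall>x. (h has_vector_derivative h' x) (at x)"
    using bump_cmult[OF bump_times_id[OF h(2)], of "- (2 * of_real pi * \<i>)"]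
    by (intro bexI[of _ "\<lambda>x. bump_ft e (\<lambda>u. - (2 * of_real pi * \<i>) * (of_real u * b u)) (of_real x)"]) blast+
qed

text \<open>One integration by parts, with boundary terms killed by the bump. In the applications
  \<open>h\<close> is the reciprocal of a function without zeros on the support, and decay of order
  1/|x| is enough for the primitive or the telescoping sequence to vanish at infinity.\<close>

lemma bump_oscillation_bound:
  assumes b: "bump e b" and e: "e > 0" and A: "open A" "h holomorphic_on A" "of_real ` {-e..e} \<subseteq> A"
  obtains C where "\<And>x::real. x \<noteq> 0 \<Longrightarrow>
    norm (integral {-e..e} (\<lambda>u. b u * h (of_real u) * exp (- (2 * of_real pi * \<i> * of_real x) * of_real u))) \<le> C / \<bar>x\<bar>"
proof -
  obtain b' where b': "bump e b'" "\<And>x. (b has_vector_derivative b' x) (at x)"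
    using bump_derivative[OF b] by blast
  have hd: "((\<lambda>u. h (of_real u)) has_vector_derivative deriv h (of_real u)) (at u)" if "u \<in> {-e..e}" for u
    using A that by (intro has_vector_derivative_real_field holomorphic_derivI[of h A]) auto
  define g where "g = (\<lambda>u. b u * h (of_real u))"
  define g' where "g' = (\<lambda>u. b u * deriv h (of_real u) + b' u * h (of_real u))"
  have gd: "(g has_vector_derivative g' u) (at u)" if "u \<in> {-e..e}" for u
    unfolding g_def g'_def by (rule has_vector_derivative_mult[OF b'(2) hd[OF that]])
  have hc: "continuous_on {-e..e} (\<lambda>u. h (of_real u))" "continuous_on {-e..e} (\<lambda>u. deriv h (of_real u))"
    using A(3) continuous_on_compose2[OF holomorphic_on_imp_continuous_on continuous_on_of_real_id]
      A(2) holomorphic_deriv[OF A(2,1)] by blast+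
  have gc: "continuous_on {-e..e} g" "continuous_on {-e..e} g'"
    unfolding g_def g'_def by (intro continuous_intros bump_continuous[OF b] bump_continuous[OF b'(1)] hc)+
  have "compact (g' ` {-e..e})" by (rule compact_continuous_image[OF gc(2)]) simp
  then obtain M where M: "\<And>x. x \<in> {-e..e} \<Longrightarrow> norm (g' x) \<le> M"
    by (metis compact_imp_bounded bounded_iff imageI)
  have "norm (integral {-e..e} (\<lambda>u. g u * exp (- (2 * of_real pi * \<i> * of_real x) * of_real u))) \<le> (M * (e - - e)) / \<bar>x\<bar>"
    if x: "x \<noteq> 0" for x :: real
  proof -
    define w where "w = 2 * of_real pi * \<i> * complex_of_real x"
    have nw: "norm w = 2 * pi * \<bar>x\<bar>" by (simp add: w_def norm_mult)
    have ne: "norm (exp (- w * of_real u)) = 1" for u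
      unfolding norm_exp_eq_Re by (simp add: w_def)
    have "((\<lambda>u. g u * (- w * exp (- w * of_real u)) + g' u * exp (- w * of_real u)) has_integral
        g e * exp (- w * of_real e) - g (- e) * exp (- w * of_real (- e))) {-e..e}"
    proof (rule fundamental_theorem_of_calculus)
      fix x assume x: "x \<in> {-e..e}"
      have "((\<lambda>u. exp (- w * of_real u)) has_vector_derivative (- w * exp (- w * of_real x))) (at x)"
        by (rule has_vector_derivative_real_field) (auto intro!: derivative_eq_intros)
      from has_vector_derivative_mult[OF gd[OF x] this]
      show "((\<lambda>u. g u * exp (- w * of_real u)) has_vector_derivative
            g x * (- w * exp (- w * of_real x)) + g' x * exp (- w * of_real x)) (at x within {-e..e})"
        by (rule has_vector_derivative_at_within)
    qed (use e in auto)
    also have "g e * exp (- w * of_real e) - g (- e) * exp (- w * of_real (- e)) = 0"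
      using bump_zero[OF b, of e] bump_zero[OF b, of "-e"] e by (simp add: g_def)
    finally have 0: "((\<lambda>u. g u * (- w * exp (- w * of_real u)) + g' u * exp (- w * of_real u)) has_integral 0) {-e..e}" .
    define I where "I = integral {-e..e} (\<lambda>u. g u * exp (- w * of_real u))"
    have 1: "((\<lambda>u. w * (g u * exp (- w * of_real u))) has_integral w * I) {-e..e}"
      unfolding I_def
      by (intro has_integral_mult_right integrable_integral integrable_continuous_interval continuous_intros gc)
    have "((\<lambda>u. g' u * exp (- w * of_real u)) has_integral 0 + w * I) {-e..e}"
      using has_integral_add[OF 0 1] by (rule has_integral_eq[rotated]) (simp add: algebra_simps)
    hence "w * I = integral {-e..e} (\<lambda>u. g' u * exp (- w * of_real u))" by (simp add: integral_unique)
    also have "norm \<dots> \<le> M * (e - - e)"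
    proof (rule integral_bound)
      fix u assume "u \<in> {-e..e}"
      thus "norm (g' u * exp (- w * of_real u)) \<le> M" unfolding norm_mult ne using M by simp
    qed (use e in \<open>auto intro!: continuous_intros gc\<close>)
    finally have "2 * pi * \<bar>x\<bar> * norm I \<le> M * (e - - e)" by (simp add: norm_mult nw)
    moreover have "1 * (\<bar>x\<bar> * norm I) \<le> 2 * pi * (\<bar>x\<bar> * norm I)"
      using pi_gt3 by (intro mult_right_mono) auto
    ultimately have "\<bar>x\<bar> * norm I \<le> M * (e - - e)" by (simp add: mult.assoc)
    thus ?thesis using x unfolding I_def w_def by (simp add: field_simps)
  qed
  thus thesis using that[of "M * (e - - e)"] unfolding g_def by blast
qed

section \<open>Pairings of functions of polynomial growth with Schwartz functions\<close>

lemma integrable_lborel_inverse_square_bound: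
  fixes g :: "real \<Rightarrow> complex"
  assumes "continuous_on UNIV g" "\<And>x. norm (g x) \<le> C / (1 + \<bar>x\<bar>)\<^sup>2"
  shows "integrable lborel g"
proof (rule Bochner_Integration.integrable_bound)
  show "integrable lborel (\<lambda>x::real. C * inverse (1 + x\<^sup>2))"
    using integrable_inverse_1_plus_square by (simp add: set_integrable_def)
  show "g \<in> borel_measurable lborel" using borel_measurable_continuous_onI[OF assms(1)] by simp
  have C0: "C \<ge> 0" using assms(2)[of 0] norm_ge_zero[of "g 0"] by (simp del: norm_ge_zero)
  show "AE x in lborel. norm (g x) \<le> norm (C * inverse (1 + x\<^sup>2))"
  proof (rule AE_I2)
    fix x :: real
    have "1 + x\<^sup>2 \<le> (1 + \<bar>x\<bar>)\<^sup>2" by (simp add: power2_eq_square algebra_simps)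
    hence "C / (1 + \<bar>x\<bar>)\<^sup>2 \<le> C / (1 + x\<^sup>2)" using C0 by (intro divide_left_mono mult_pos_pos) (auto intro: add_pos_nonneg)
    thus "norm (g x) \<le> norm (C * inverse (1 + x\<^sup>2))"
      using assms(2)[of x] C0 by (simp add: divide_inverse abs_mult)
  qed
qed

text \<open>The bound is integrable in \<open>x\<close> and only polynomial in the translation
  \<open>r\<close>. This lets translates be summed under the integral against rapidly decreasing
  coefficients.\<close>

lemma poly_growth_shift_bound:
  assumes f: "f \<in> poly_growth_space" and "rapidly_decreasing phi"
  obtains C m where "C \<ge> 0" "\<And>x r. norm (f x * phi (x + r)) \<le> C * (1 + \<bar>r\<bar>) ^ m / (1 + \<bar>x\<bar>)\<^sup>2"
proof -
  obtain A N where A: "\<And>x. norm (f x) \<le> A * (1 + \<bar>x\<bar>) ^ N"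
    using f unfolding poly_growth_space_def by blast
  have A0: "A \<ge> 0" using A[of 0] norm_ge_zero[of "f 0"] by (simp del: norm_ge_zero)
  obtain D where D: "\<And>x. norm (phi x) * (1 + \<bar>x\<bar>) ^ (N + 2) \<le> D"
    using assms(2) unfolding rapidly_decreasing_def by metis
  have D0: "D \<ge> 0" using D[of 0] norm_ge_zero[of "phi 0"] by (simp del: norm_ge_zero)
  have "norm (f x * phi (x + r)) \<le> (A * D) * (1 + \<bar>r\<bar>) ^ (N + 2) / (1 + \<bar>x\<bar>)\<^sup>2" for x r
  proof -
    have "1 + \<bar>x\<bar> \<le> 1 + (\<bar>x + r\<bar> + \<bar>r\<bar>)" by linarith
    also have "\<dots> \<le> (1 + \<bar>x + r\<bar>) * (1 + \<bar>r\<bar>)" by (simp add: algebra_simps)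
    finally have "(1 + \<bar>x\<bar>) ^ (N + 2) \<le> ((1 + \<bar>x + r\<bar>) * (1 + \<bar>r\<bar>)) ^ (N + 2)"
      by (rule power_mono) simp
    hence "(1 + \<bar>x\<bar>) ^ (N + 2) \<le> (1 + \<bar>x + r\<bar>) ^ (N + 2) * (1 + \<bar>r\<bar>) ^ (N + 2)"
      unfolding power_mult_distrib .
    hence "norm (phi (x + r)) * (1 + \<bar>x\<bar>) ^ (N + 2) \<le> (norm (phi (x + r)) * (1 + \<bar>x + r\<bar>) ^ (N + 2)) * (1 + \<bar>r\<bar>) ^ (N + 2)"
      unfolding mult.assoc by (rule mult_left_mono) simp
    also have "\<dots> \<le> D * (1 + \<bar>r\<bar>) ^ (N + 2)" by (rule mult_right_mono[OF D]) simp
    finally have 1: "norm (phi (x + r)) * (1 + \<bar>x\<bar>) ^ (N + 2) \<le> D * (1 + \<bar>r\<bar>) ^ (N + 2)" .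
    have "norm (f x * phi (x + r)) * (1 + \<bar>x\<bar>)\<^sup>2 \<le> (A * (1 + \<bar>x\<bar>) ^ N * norm (phi (x + r))) * (1 + \<bar>x\<bar>)\<^sup>2"
      unfolding norm_mult by (intro mult_right_mono A) auto
    also have "\<dots> = A * (norm (phi (x + r)) * (1 + \<bar>x\<bar>) ^ (N + 2))"
      by (simp only: power_add mult_ac)
    also have "\<dots> \<le> A * (D * (1 + \<bar>r\<bar>) ^ (N + 2))" by (rule mult_left_mono[OF 1 A0])
    finally show ?thesis by (simp add: pos_le_divide_eq mult.assoc)
  qed
  thus thesis using that[of "A * D" "N + 2"] A0 D0 by simp
qed

lemma integrable_poly_growth_schwartz:
  assumes f: "f \<in> poly_growth_space" and phi: "schwartz phi"
  shows "integrable lborel (\<lambda>x. f x * phi (x + r))"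
proof -
  obtain C m where C: "\<And>x r. norm (f x * phi (x + r)) \<le> C * (1 + \<bar>r\<bar>) ^ m / (1 + \<bar>x\<bar>)\<^sup>2"
    using poly_growth_shift_bound[OF f schwartz_imp_rapidly_decreasing[OF phi]] by metis
  have "continuous_on UNIV f" using f by (simp add: poly_growth_space_def)
  thus ?thesis
    by (intro integrable_lborel_inverse_square_bound[OF _ C] continuous_intros
        continuous_on_compose2[OF schwartz_imp_continuous[OF phi]]) auto
qed

lemma integral_poly_growth_schwartz:
  assumes "f \<in> poly_growth_space" "schwartz phi"
  shows "integral UNIV (\<lambda>x. f x * phi x) = (LINT x|lborel. f x * phi x)"
  using integral_lborel[OF integrable_poly_growth_schwartz[OF assms, of 0]] by simp

text \<open>With characters in the space, a Fourier transform is itself a pairing with a function of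
  polynomial growth, so every statement about pairings also applies to transforms.\<close>

lemma character_poly_growth: "(\<lambda>x. exp (- 2 * of_real pi * \<i> * complex_of_real (t * x))) \<in> poly_growth_space"
  unfolding poly_growth_space_def
  by (intro CollectI conjI continuous_intros exI[of _ 1] exI[of _ 0]) (simp add: norm_exp_eq_Re)

lemma fourier_eq_lborel:
  assumes "schwartz phi"
  shows "fourier phi t = (LINT x|lborel. exp (- 2 * of_real pi * \<i> * complex_of_real (t * x)) * phi x)"
  unfolding fourier_def using integral_poly_growth_schwartz[OF character_poly_growth assms, of t] by simp

text \<open>
  Dividing the bump by \<open>u + t\<close>, which has no zero on its support, exhibits the integrand as the derivative
  of a function that tends to \<open>0\<close> at both ends; no Fourier inversion is needed.
\<close>

lemma fourier_bump_ft_eq_0: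
  assumes b: "bump e b" and e: "e > 0" and t: "\<bar>t\<bar> > e"
  shows "fourier (\<lambda>x. bump_ft e b (of_real x)) t = 0"
proof -
  define h where "h = (\<lambda>w. inverse (w + complex_of_real t))"
  define A where "A = - {- complex_of_real t}"
  define P where "P = (\<lambda>x::real. integral {-e..e} (\<lambda>u. b u * h (of_real u) * exp (- (2 * of_real pi * \<i> * of_real x) * of_real u)))"
  define E where "E = (\<lambda>x::real. exp (- (2 * of_real pi * \<i> * complex_of_real t) * of_real x))"
  define G where "G = (\<lambda>x. E x * P x)"
  have A: "open A" "h holomorphic_on A" "of_real ` {-e..e} \<subseteq> A"
  proof -
    show "h holomorphic_on A" unfolding h_def A_def
      by (intro holomorphic_intros) (auto simp: eq_neg_iff_add_eq_0)
    show "of_real ` {-e..e} \<subseteq> A"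
    proof
      fix w assume "w \<in> complex_of_real ` {-e..e}"
      then obtain u where u: "w = of_real u" "u \<in> {-e..e}" by blast
      hence "u \<noteq> - t" using t by auto
      thus "w \<in> A" unfolding A_def u by (metis Compl_iff of_real_eq_iff of_real_minus singletonD)
    qed
  qed (auto simp: A_def)
  have hu: "(of_real u + of_real t) * h (of_real u) = 1" if "u \<in> {-e..e}" for u
  proof -
    have "u + t \<noteq> 0" using that t by auto
    hence "of_real u + complex_of_real t \<noteq> 0" by (metis of_real_add of_real_eq_0_iff)
    thus ?thesis by (simp add: h_def)
  qed
  obtain C where C: "\<And>x. x \<noteq> 0 \<Longrightarrow> norm (P x) \<le> C / \<bar>x\<bar>"
    using bump_oscillation_bound[OF b e A] unfolding P_def by metis
  have nE: "norm (E x) = 1" for x unfolding E_def norm_exp_eq_Re by simp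
  have G: "norm (G x) \<le> C / \<bar>x\<bar>" if "x \<noteq> 0" for x
    using C[OF that] nE by (simp add: G_def norm_mult)
  have Gtop: "(G \<longlongrightarrow> 0) at_top"
  proof (rule Lim_null_comparison)
    show "\<forall>\<^sub>F x in at_top. norm (G x) \<le> C / \<bar>x\<bar>" 
      by (rule eventually_mono[OF eventually_gt_at_top[of 0]]) (rule G, simp)
    show "((\<lambda>x. C / \<bar>x\<bar>) \<longlongrightarrow> 0) at_top" by real_asymp
  qed
  have Gbot: "(G \<longlongrightarrow> 0) at_bot"
  proof (rule Lim_null_comparison)
    show "\<forall>\<^sub>F x in at_bot. norm (G x) \<le> C / \<bar>x\<bar>" 
      by (rule eventually_mono[OF eventually_gt_at_bot[of 0]]) (rule G, simp)
    show "((\<lambda>x. C / \<bar>x\<bar>) \<longlongrightarrow> 0) at_bot" by real_asymp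
  qed
  define F where "F = (\<lambda>x. E x * bump_ft e b (of_real x))"
  have hc: "continuous_on {-e..e} (\<lambda>u. h (of_real u))"
    using continuous_on_compose2[OF holomorphic_on_imp_continuous_on continuous_on_of_real_id] A(2,3) by blast
  \<comment> \<open>Differentiating \<open>E\<close> and \<open>P\<close> brings down multiples of t
    and of u; together they give the factor u + t, which cancels \<open>h\<close> and leaves the
    transform of \<open>b\<close> itself.\<close>
  have dG: "(G has_vector_derivative (- (2 * of_real pi * \<i>)) * F x) (at x)" for x
  proof -
    have "((\<lambda>z. integral (cbox (-e) e) (\<lambda>u. b u * h (of_real u) * exp (- (2 * of_real pi * \<i> * z) * of_real u))) has_field_derivative
      integral (cbox (-e) e) (\<lambda>u. (- (2 * of_real pi * \<i>) * of_real u) * (b u * h (of_real u) * exp (- (2 * of_real pi * \<i> * of_real x) * of_real u))))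
      (at (of_real x) within UNIV)"
    proof (rule leibniz_rule_field_derivative)
      show "continuous_on (UNIV \<times> cbox (- e) e) (\<lambda>(z, u). (- (2 * of_real pi * \<i>) * of_real u) * (b u * h (of_real u) * exp (- (2 * of_real pi * \<i> * z) * of_real u)))"
        unfolding split_beta
        by (intro continuous_intros continuous_on_compose2[OF bump_continuous[OF b, of UNIV]] continuous_on_compose2[OF hc]) auto
    qed (auto intro!: derivative_eq_intros integrable_continuous_real continuous_intros bump_continuous[OF b] hc)
    hence 1: "(P has_vector_derivative integral {-e..e} (\<lambda>u. (- (2 * of_real pi * \<i>) * of_real u) * (b u * h (of_real u) * exp (- (2 * of_real pi * \<i> * of_real x) * of_real u)))) (at x)"
      unfolding P_def by (intro has_vector_derivative_real_field) simp
    have 2: "(E has_vector_derivative - (2 * of_real pi * \<i> * of_real t) * E x) (at x)"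
      unfolding E_def by (rule has_vector_derivative_real_field) (auto intro!: derivative_eq_intros)
    have "integral {-e..e} (\<lambda>u. (- (2 * of_real pi * \<i>) * of_real u) * (b u * h (of_real u) * exp (- (2 * of_real pi * \<i> * of_real x) * of_real u)))
        + - (2 * of_real pi * \<i> * of_real t) * P x
        = integral {-e..e} (\<lambda>u. (- (2 * of_real pi * \<i>) * of_real u) * (b u * h (of_real u) * exp (- (2 * of_real pi * \<i> * of_real x) * of_real u))
           + - (2 * of_real pi * \<i> * of_real t) * (b u * h (of_real u) * exp (- (2 * of_real pi * \<i> * of_real x) * of_real u)))"
      unfolding P_def integral_mult_right[symmetric]
      by (rule Henstock_Kurzweil_Integration.integral_add[symmetric]; intro integrable_continuous_interval continuous_intros bump_continuous[OF b] hc)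
    also have "\<dots> = integral {-e..e} (\<lambda>u. - (2 * of_real pi * \<i>) * (b u * exp (- (2 * of_real pi * \<i> * of_real x) * of_real u)))"
    proof (rule Henstock_Kurzweil_Integration.integral_cong)
      fix u assume u: "u \<in> {-e..e}"
      define X where "X = exp (- (2 * of_real pi * \<i> * of_real x) * complex_of_real u)"
      have "(- (2 * of_real pi * \<i>) * of_real u) * (b u * h (of_real u) * X) + - (2 * of_real pi * \<i> * of_real t) * (b u * h (of_real u) * X)
          = - (2 * of_real pi * \<i>) * (b u * X) * ((of_real u + of_real t) * h (of_real u))"
        by (simp add: algebra_simps)
      thus "(- (2 * of_real pi * \<i>) * of_real u) * (b u * h (of_real u) * exp (- (2 * of_real pi * \<i> * of_real x) * complex_of_real u)) + - (2 * of_real pi * \<i> * of_real t) * (b u * h (of_real u) * exp (- (2 * of_real pi * \<i> * of_real x) * complex_of_real u))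
          = - (2 * of_real pi * \<i>) * (b u * exp (- (2 * of_real pi * \<i> * of_real x) * complex_of_real u))"
        unfolding hu[OF u] X_def by simp
    qed
    also have "\<dots> = - (2 * of_real pi * \<i>) * bump_ft e b (of_real x)"
      unfolding bump_ft_def integral_mult_right ..
    finally have 3: "integral {-e..e} (\<lambda>u. (- (2 * of_real pi * \<i>) * of_real u) * (b u * h (of_real u) * exp (- (2 * of_real pi * \<i> * of_real x) * of_real u)))
        = - (2 * of_real pi * \<i>) * bump_ft e b (of_real x) + (2 * of_real pi * \<i> * of_real t) * P x"
      by (simp add: algebra_simps)
    show ?thesis unfolding G_def
      using has_vector_derivative_mult[OF 2 1[unfolded 3]]
      by (rule has_vector_derivative_eq_rhs) (simp add: F_def algebra_simps)
  qed
  have sch: "schwartz (\<lambda>x. bump_ft e b (of_real x))" by (rule schwartz_bump_ft[OF b e])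
  have FE: "F = (\<lambda>x. exp (- 2 * of_real pi * \<i> * complex_of_real (t * x)) * bump_ft e b (of_real x))"
    by (simp add: F_def E_def fun_eq_iff mult_ac)
  have intF: "integrable lborel F"
    unfolding FE using integrable_poly_growth_schwartz[OF character_poly_growth sch, of t 0] by simp
  have contF: "continuous_on UNIV F"
    unfolding F_def E_def by (intro continuous_intros schwartz_imp_continuous sch)
  have "(LBINT x=-\<infinity>..\<infinity>. - (2 * of_real pi * \<i>) * F x) = 0 - 0"
  proof (rule interval_integral_FTC_integrable[where F = G])
    show "isCont (\<lambda>x. - (2 * of_real pi * \<i>) * F x) x" for x
      using contF by (intro continuous_intros) (auto simp: continuous_on_eq_continuous_at)
    show "set_integrable lborel (einterval (- \<infinity>) \<infinity>) (\<lambda>x. - (2 * of_real pi * \<i>) * F x)"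
      using intF by (simp add: set_integrable_def)
    show "(G has_vector_derivative - (2 * of_real pi * \<i>) * F x) (at x)" for x by (rule dG)
  qed (auto simp: ereal_tendsto_simps Gtop Gbot)
  hence "(LINT x|lborel. - (2 * of_real pi * \<i>) * F x) = 0"
    by (simp add: interval_lebesgue_integral_def set_lebesgue_integral_def)
  hence "(LINT x|lborel. F x) = 0" by simp
  thus ?thesis unfolding fourier_eq_lborel[OF sch] FE .
qed

text \<open>
  Sums over \<open>\<int>\<close> are written as series over \<open>nat\<close> along the enumeration \<open>int_decode\<close>, which runs through
  \<open>0, -1, 1, -2, \<dots>\<close>.
\<close>

lemma sum_int_decode_telescope:
  fixes b :: "int \<Rightarrow> 'a :: ab_group_add"
  shows "(\<Sum>j<2 * N. b (int_decode j + 1) - b (int_decode j)) = b (int N) - b (- int N)"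
proof (induction N)
  case (Suc N)
  \<comment> \<open>The first 2N values of the enumeration are exactly -N, ..., N - 1, so the next
    two are N and -N - 1: one step at either end of the telescope.\<close>
  have dec: "int_decode (2 * N) = int N" "int_decode (Suc (2 * N)) = - int N - 1"
    by (simp_all add: int_decode_def sum_decode_def)
  have e: "2 * Suc N = Suc (Suc (2 * N))" "int (Suc N) = int N + 1" "- (int N + 1) = - int N - 1"
    "- int N - 1 + 1 = - int N" by auto
  show ?case unfolding e(1,2) sum.lessThan_Suc Suc.IH dec e(3,4) by simp
qed simp

lemma summable_int_decode_inverse_square:
  "summable (\<lambda>j. 1 / (1 + \<bar>real_of_int (int_decode j)\<bar>)\<^sup>2)"
proof (rule summable_comparison_test)
  show "summable (\<lambda>j. 4 * inverse ((real (Suc j))\<^sup>2))"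
    using inverse_power_summable[of 2, where 'a = real] by (intro summable_mult) (subst summable_Suc_iff, simp)
  have "1 / (1 + \<bar>real_of_int (int_decode j)\<bar>)\<^sup>2 \<le> 4 * inverse ((real (Suc j))\<^sup>2)" for j
  proof -
    have "real (Suc j) \<le> 2 * (1 + \<bar>real_of_int (int_decode j)\<bar>)"
      by (cases "even j") (auto simp: int_decode_def sum_decode_def elim!: evenE oddE)
    hence "(real (Suc j))\<^sup>2 \<le> (2 * (1 + \<bar>real_of_int (int_decode j)\<bar>))\<^sup>2" by (rule power_mono) simp
    hence "(real (Suc j))\<^sup>2 \<le> 4 * (1 + \<bar>real_of_int (int_decode j)\<bar>)\<^sup>2" by (simp only: power_mult_distrib) simp
    thus ?thesis by (simp add: field_simps del: of_nat_Suc)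
  qed
  thus "\<exists>N. \<forall>n\<ge>N. norm (1 / (1 + \<bar>real_of_int (int_decode n)\<bar>)\<^sup>2) \<le> 4 * inverse ((real (Suc n))\<^sup>2)"
    by auto
qed

text \<open>Absolute convergence frees the sum over \<int> from its enumeration, after which n can
  be replaced by m - n. This supplies the commutativity of discrete convolution.\<close>

lemma sums_int_decode_reflect:
  fixes a :: "int \<Rightarrow> complex"
  assumes "summable (\<lambda>j. norm (a (int_decode j)))"
  shows "(\<lambda>j. a (m - int_decode j)) sums (\<Sum>j. a (int_decode j))"
proof -
  have bij: "bij_betw int_decode UNIV UNIV" by (rule bij_int_decode)
  have "((\<lambda>j. a (int_decode j)) has_sum (\<Sum>j. a (int_decode j))) UNIV"
    using assms summable_norm_cancel[OF assms] by (intro norm_summable_imp_has_sum) (auto simp: summable_sums)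
  hence "(a has_sum (\<Sum>j. a (int_decode j))) UNIV"
    by (subst (asm) has_sum_reindex_bij_betw[OF bij])
  moreover have "bij_betw (\<lambda>n. m - n) UNIV (UNIV :: int set)"
    by (rule bij_betw_byWitness[of _ "\<lambda>n. m - n"]) auto
  ultimately have "((\<lambda>n. a (m - n)) has_sum (\<Sum>j. a (int_decode j))) UNIV"
    by (subst has_sum_reindex_bij_betw)
  hence "((\<lambda>j. a (m - int_decode j)) has_sum (\<Sum>j. a (int_decode j))) UNIV"
    by (subst has_sum_reindex_bij_betw[OF bij, of "\<lambda>n. a (m - n)"])
  thus ?thesis by (rule has_sum_imp_sums)
qed

lemma summable_rapid_coefficients:
  fixes c :: "int \<Rightarrow> complex"
  assumes l: "l > 0" and C: "\<And>n. norm (c n) * (1 + l * \<bar>real_of_int n\<bar>) ^ (k + 2) \<le> C"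
  shows "summable (\<lambda>j. norm (c (int_decode j)) * (1 + l * \<bar>real_of_int (int_decode j)\<bar>) ^ k)"
proof (rule summable_comparison_test)
  define M where "M = 1 + 1 / l"
  have M: "M > 0" using l by (simp add: M_def add_pos_pos)
  show "summable (\<lambda>j. (C * M\<^sup>2) * (1 / (1 + \<bar>real_of_int (int_decode j)\<bar>)\<^sup>2))"
    by (intro summable_mult summable_int_decode_inverse_square)
  have "norm (c n) * (1 + l * \<bar>real_of_int n\<bar>) ^ k \<le> (C * M\<^sup>2) * (1 / (1 + \<bar>real_of_int n\<bar>)\<^sup>2)" for n
  proof -
    have "1 + \<bar>real_of_int n\<bar> \<le> (1 + l * \<bar>real_of_int n\<bar>) * M"
      using l by (simp add: M_def field_simps)
    hence "(1 + \<bar>real_of_int n\<bar>)\<^sup>2 \<le> (1 + l * \<bar>real_of_int n\<bar>)\<^sup>2 * M\<^sup>2"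
      using power_mono[of "1 + \<bar>real_of_int n\<bar>" _ 2] by (simp add: power_mult_distrib[symmetric])
    hence "(norm (c n) * (1 + l * \<bar>real_of_int n\<bar>) ^ k) * (1 + \<bar>real_of_int n\<bar>)\<^sup>2
        \<le> (norm (c n) * (1 + l * \<bar>real_of_int n\<bar>) ^ k) * ((1 + l * \<bar>real_of_int n\<bar>)\<^sup>2 * M\<^sup>2)"
      using l by (intro mult_left_mono) auto
    also have "\<dots> = (norm (c n) * (1 + l * \<bar>real_of_int n\<bar>) ^ (k + 2)) * M\<^sup>2"
      by (simp only: power_add mult_ac)
    also have "\<dots> \<le> C * M\<^sup>2" by (intro mult_right_mono C) auto
    finally show ?thesis by (simp add: pos_le_divide_eq)
  qed
  thus "\<exists>N. \<forall>n\<ge>N. norm (norm (c (int_decode n)) * (1 + l * \<bar>real_of_int (int_decode n)\<bar>) ^ k)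
    \<le> (C * M\<^sup>2) * (1 / (1 + \<bar>real_of_int (int_decode n)\<bar>)\<^sup>2)"
    using l by simp
qed

lemma summable_bump_ft_samples:
  assumes b: "bump e b" and e: "e > 0" and l: "l > 0"
  shows "summable (\<lambda>j. norm (bump_ft e b (of_real (l * of_int (int_decode j)))) * (1 + l * \<bar>real_of_int (int_decode j)\<bar>) ^ k)"
proof -
  obtain C where C: "\<And>z. norm (bump_ft e b z) * (1 + norm z) ^ (k + 2) \<le> C * exp (2 * pi * e * \<bar>Im z\<bar>)"
    using bump_ft_decay[OF b e] by blast
  show ?thesis
  proof (rule summable_rapid_coefficients[OF l])
    fix n :: int
    show "norm (bump_ft e b (of_real (l * of_int n))) * (1 + l * \<bar>real_of_int n\<bar>) ^ (k + 2) \<le> C"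
      using C[of "of_real (l * of_int n)"] l by (simp add: norm_mult abs_mult)
  qed
qed

text \<open>
  The vanishing half of Poisson summation: dividing the bump by \<open>exp (- 2 \<pi> i l (u - t)) - 1\<close> makes the series telescope.
\<close>

lemma poisson_vanishing:
  assumes b: "bump e b" and e: "e > 0" and l: "l > 0"
    and t: "\<And>k::int. \<bar>t - of_int k / l\<bar> > e"
  shows "(\<lambda>j. bump_ft e b (of_real (l * of_int (int_decode j))) *
      exp (2 * of_real pi * \<i> * of_real (l * of_int (int_decode j)) * of_real t)) sums 0"
proof -
  define q where "q = (\<lambda>w. exp (- (2 * of_real pi * \<i> * of_real l) * (w - complex_of_real t)) - 1)"
  define A where "A = {w. q w \<noteq> 0}"
  define h where "h = (\<lambda>w. inverse (q w))"
  have A: "open A" "h holomorphic_on A" "of_real ` {-e..e} \<subseteq> A"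
  proof -
    have "continuous_on UNIV q" unfolding q_def by (intro continuous_intros)
    hence "open (q -` (- {0}))" by (intro open_vimage) auto
    moreover have "q -` (- {0}) = A" by (auto simp: A_def)
    ultimately show "open A" by simp
    show "h holomorphic_on A" unfolding h_def q_def
      by (intro holomorphic_intros) (auto simp: A_def q_def)
    show "of_real ` {-e..e} \<subseteq> A"
    proof
      fix w assume "w \<in> complex_of_real ` {-e..e}"
      then obtain u where u: "w = of_real u" "u \<in> {-e..e}" by blast
      \<comment> \<open>The real zeros of \<open>q\<close> are the points t - k/l, and the
        hypothesis on \<open>t\<close> keeps all of them off the support.\<close>
      show "w \<in> A"
      proof (rule ccontr)
        assume "w \<notin> A"
        hence "exp (- (2 * of_real pi * \<i> * of_real l) * (w - complex_of_real t)) = 1" by (simp add: A_def q_def)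
        then obtain k :: int where "Im (- (2 * of_real pi * \<i> * of_real l) * (w - complex_of_real t)) = of_int (2 * k) * pi"
          by (auto simp: exp_eq_1)
        hence "- (2 * pi * l * (u - t)) = 2 * of_int k * pi" by (simp add: u)
        hence "pi * (l * (t - u)) = pi * of_int k" by (simp add: algebra_simps)
        hence "l * (t - u) = of_int k" using pi_neq_zero mult_left_cancel by blast
        hence "t - of_int k / l = u" using l by (simp add: field_simps)
        thus False using t[of k] u by auto
      qed
    qed
  qed
  obtain C where C: "\<And>x. x \<noteq> 0 \<Longrightarrow> norm (integral {-e..e} (\<lambda>u. b u * h (of_real u) * exp (- (2 * of_real pi * \<i> * of_real x) * of_real u))) \<le> C / \<bar>x\<bar>"
    using bump_oscillation_bound[OF b e A] by metis
  define P where "P = (\<lambda>x::real. integral {-e..e} (\<lambda>u. b u * h (of_real u) * exp (- (2 * of_real pi * \<i> * of_real x) * of_real u)))"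
  define E where "E = (\<lambda>n::int. exp (2 * of_real pi * \<i> * of_real (l * of_int n) * complex_of_real t))"
  define B where "B = (\<lambda>n::int. E n * P (l * of_int n))"
  have hc: "continuous_on {-e..e} (\<lambda>u. h (of_real u))"
    using continuous_on_compose2[OF holomorphic_on_imp_continuous_on continuous_on_of_real_id] A(2,3) by blast
  have nE: "norm (E n) = 1" for n unfolding E_def norm_exp_eq_Re by simp
  have Bint: "B n = integral {-e..e} (\<lambda>u. b u * h (of_real u) * exp (- (2 * of_real pi * \<i> * of_real (l * of_int n)) * (of_real u - of_real t)))" for n
    unfolding B_def P_def integral_mult_right[symmetric]
  proof (rule Henstock_Kurzweil_Integration.integral_cong)
    fix u assume "u \<in> {-e..e}"
    have "E n * exp (- (2 * of_real pi * \<i> * of_real (l * of_int n)) * of_real u) = exp (- (2 * of_real pi * \<i> * of_real (l * of_int n)) * (of_real u - of_real t))"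
      unfolding E_def exp_add[symmetric] by (simp add: algebra_simps)
    thus "E n * (b u * h (of_real u) * exp (- (2 * of_real pi * \<i> * of_real (l * of_int n)) * of_real u)) = b u * h (of_real u) * exp (- (2 * of_real pi * \<i> * of_real (l * of_int n)) * (of_real u - of_real t))"
      by (metis mult.assoc mult.commute)
  qed
  \<comment> \<open>Passing from n to n + 1 multiplies the exponential by q u + 1, so the difference
    restores precisely the factor that \<open>h\<close> divided out.\<close>
  have step: "B (n + 1) - B n = bump_ft e b (of_real (l * of_int n)) * E n" for n
  proof -
    have "B (n + 1) - B n = integral {-e..e} (\<lambda>u. b u * h (of_real u) * exp (- (2 * of_real pi * \<i> * of_real (l * of_int (n + 1))) * (of_real u - of_real t))
       - b u * h (of_real u) * exp (- (2 * of_real pi * \<i> * of_real (l * of_int n)) * (of_real u - of_real t)))"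
      unfolding Bint
      by (rule Henstock_Kurzweil_Integration.integral_diff[symmetric]; intro integrable_continuous_interval continuous_intros bump_continuous[OF b] hc)
    also have "\<dots> = integral {-e..e} (\<lambda>u. (b u * exp (- (2 * of_real pi * \<i> * of_real (l * of_int n)) * of_real u)) * E n)"
    proof (rule Henstock_Kurzweil_Integration.integral_cong)
      fix u assume u: "u \<in> {-e..e}"
      define X where "X = exp (- (2 * of_real pi * \<i> * of_real (l * of_int n)) * (of_real u - complex_of_real t))"
      have q0: "q (of_real u) \<noteq> 0" using A(3) u unfolding A_def by blast
      have 1: "exp (- (2 * of_real pi * \<i> * of_real (l * of_int (n + 1))) * (of_real u - complex_of_real t)) = X * (q (of_real u) + 1)"
        unfolding X_def q_def by (simp add: exp_add[symmetric] algebra_simps)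
      have 2: "X = exp (- (2 * of_real pi * \<i> * of_real (l * of_int n)) * of_real u) * E n"
        unfolding X_def E_def by (simp add: exp_add[symmetric] algebra_simps)
      have "b u * h (of_real u) * (X * (q (of_real u) + 1)) - b u * h (of_real u) * X = b u * X"
        using q0 by (simp add: h_def field_simps)
      thus "b u * h (of_real u) * exp (- (2 * of_real pi * \<i> * of_real (l * of_int (n + 1))) * (of_real u - of_real t))
       - b u * h (of_real u) * exp (- (2 * of_real pi * \<i> * of_real (l * of_int n)) * (of_real u - of_real t))
        = (b u * exp (- (2 * of_real pi * \<i> * of_real (l * of_int n)) * of_real u)) * E n"
        unfolding 1 X_def[symmetric] by (simp add: 2 mult.assoc)
    qed
    also have "\<dots> = bump_ft e b (of_real (l * of_int n)) * E n"
      unfolding bump_ft_def by (rule integral_mult_left)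
    finally show ?thesis .
  qed
  have nB: "norm (B n) \<le> (C / l) / \<bar>real_of_int n\<bar>" if "n \<noteq> 0" for n
    using C[of "l * of_int n"] that l unfolding B_def norm_mult nE P_def by (simp add: abs_mult field_simps)
  have BN: "(\<lambda>N. B (int N) - B (- int N)) \<longlonglongrightarrow> 0"
  proof (rule Lim_null_comparison)
    show "\<forall>\<^sub>F N in sequentially. norm (B (int N) - B (- int N)) \<le> 2 * (C / l) / real N"
      using eventually_gt_at_top[of 0]
    proof eventually_elim
      case (elim N)
      thus ?case using nB[of "int N"] nB[of "- int N"] norm_triangle_ineq4[of "B (int N)" "B (- int N)"] by simp
    qed
    show "(\<lambda>N. 2 * (C / l) / real N) \<longlonglongrightarrow> 0" by real_asymp
  qed
  define a where "a = (\<lambda>j. bump_ft e b (of_real (l * of_int (int_decode j))) * E (int_decode j))"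
  have "summable (\<lambda>j. norm (a j))"
    using summable_bump_ft_samples[OF b e l, of 0] unfolding a_def norm_mult nE by simp
  hence "a sums (\<Sum>j. a j)" using summable_norm_cancel summable_sums by blast
  \<comment> \<open>Convergence of the series is already known, so its sum can be read off from the
    partial sums of even length, which are the ones that telescope.\<close>
  hence "(\<lambda>N. \<Sum>j<2 * N. a j) \<longlonglongrightarrow> (\<Sum>j. a j)"
    unfolding sums_def by (rule filterlim_compose) (rule filterlim_subseq, simp add: strict_mono_def)
  moreover have "(\<Sum>j<2 * N. a j) = B (int N) - B (- int N)" for N
    unfolding a_def step[symmetric] by (rule sum_int_decode_telescope)
  ultimately have "(\<Sum>j. a j) = 0" using BN LIMSEQ_unique by auto
  thus ?thesis using \<open>a sums (\<Sum>j. a j)\<close> unfolding a_def E_def by simp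
qed

section \<open>Convolution with discrete measures\<close>

lemma has_vector_derivative_suminf:
  fixes f :: "nat \<Rightarrow> real \<Rightarrow> complex"
  assumes d: "\<And>n x. (f n has_vector_derivative f' n x) (at x)"
    and s: "\<And>x. summable (\<lambda>n. f n x)"
    and M: "\<And>n x. norm (f' n x) \<le> M n" "summable M"
  shows "((\<lambda>x. \<Sum>n. f n x) has_vector_derivative (\<Sum>n. f' n x)) (at x)"
proof -
  define g' where "g' = (\<lambda>x. \<Sum>n. f' n x)"
  have ul: "uniform_limit UNIV (\<lambda>n x. \<Sum>i<n. f' i x) g' sequentially"
    unfolding g'_def by (rule Weierstrass_m_test[OF M(1) M(2)])
  have "\<exists>g. \<forall>x\<in>UNIV. (\<lambda>n. f n x) sums (g x) \<and> (g has_derivative (\<lambda>h. h *\<^sub>R g' x)) (at x within UNIV)"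
  proof (rule has_derivative_series[where f' = "\<lambda>n x h. h *\<^sub>R f' n x"])
    show "\<forall>\<^sub>F n in sequentially. \<forall>x\<in>UNIV. \<forall>h. norm ((\<Sum>i<n. h *\<^sub>R f' i x) - h *\<^sub>R g' x) \<le> e * norm h" if "e > 0" for e
    proof -
      have "\<forall>\<^sub>F n in sequentially. \<forall>x\<in>UNIV. dist (\<Sum>i<n. f' i x) (g' x) < e"
        using ul that unfolding uniform_limit_iff by blast
      thus ?thesis
      proof eventually_elim
        case (elim n)
        have "norm ((\<Sum>i<n. h *\<^sub>R f' i x) - h *\<^sub>R g' x) \<le> e * norm h" for x h
        proof -
          have "(\<Sum>i<n. h *\<^sub>R f' i x) - h *\<^sub>R g' x = h *\<^sub>R ((\<Sum>i<n. f' i x) - g' x)"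
            by (simp add: scaleR_sum_right scaleR_diff_right)
          thus ?thesis using mult_right_mono[of "norm ((\<Sum>i<n. f' i x) - g' x)" e "\<bar>h\<bar>"] elim[rule_format, of x]
            by (simp add: dist_norm mult.commute)
        qed
        thus ?case by blast
      qed
    qed
  qed (use d s in \<open>auto simp: has_vector_derivative_def summable_sums\<close>)
  then obtain g where g: "\<And>x. (\<lambda>n. f n x) sums (g x)" "\<And>x. (g has_derivative (\<lambda>h. h *\<^sub>R g' x)) (at x)" by auto
  have "g = (\<lambda>x. \<Sum>n. f n x)" using g(1) by (auto simp: sums_iff)
  thus ?thesis using g(2)[of x] unfolding has_vector_derivative_def g'_def by simp
qed

text \<open>The convolution of \<open>phi\<close> with the discrete measure that has mass
  \<open>c j\<close> at \<open>- r j\<close>. On the Fourier side it multiplies by the sum of c j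
  exp(2 pi i r j t); transposed to \<open>f\<close>, it becomes the sum of c j f(x - r j).\<close>

definition shift_series :: "(nat \<Rightarrow> complex) \<Rightarrow> (nat \<Rightarrow> real) \<Rightarrow> (real \<Rightarrow> complex) \<Rightarrow> real \<Rightarrow> complex" where
  "shift_series c r phi x = (\<Sum>j. c j * phi (x + r j))"

lemma rapidly_decreasing_shift_bound:
  assumes "rapidly_decreasing phi"
  obtains C where "C \<ge> 0" "\<And>x r. norm (phi (x + r)) * (1 + \<bar>x\<bar>) ^ k \<le> C * (1 + \<bar>r\<bar>) ^ k"
proof -
  obtain C where C: "\<And>x. norm (phi x) * (1 + \<bar>x\<bar>) ^ k \<le> C"
    using assms unfolding rapidly_decreasing_def by blast
  have "norm (phi (x + r)) * (1 + \<bar>x\<bar>) ^ k \<le> C * (1 + \<bar>r\<bar>) ^ k" for x r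
  proof -
    have "1 + \<bar>x\<bar> \<le> 1 + (\<bar>x + r\<bar> + \<bar>r\<bar>)" by linarith
    also have "\<dots> \<le> (1 + \<bar>x + r\<bar>) * (1 + \<bar>r\<bar>)" by (simp add: algebra_simps)
    finally have "(1 + \<bar>x\<bar>) ^ k \<le> ((1 + \<bar>x + r\<bar>) * (1 + \<bar>r\<bar>)) ^ k" by (rule power_mono) simp
    hence "norm (phi (x + r)) * (1 + \<bar>x\<bar>) ^ k \<le> (norm (phi (x + r)) * (1 + \<bar>x + r\<bar>) ^ k) * (1 + \<bar>r\<bar>) ^ k"
      unfolding power_mult_distrib mult.assoc by (rule mult_left_mono) simp
    also have "\<dots> \<le> C * (1 + \<bar>r\<bar>) ^ k" by (rule mult_right_mono[OF C]) simp
    finally show ?thesis .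
  qed
  moreover have "C \<ge> 0" using C[of 0] norm_ge_zero[of "phi 0"] by (simp del: norm_ge_zero)
  ultimately show thesis using that by blast
qed

text \<open>Weighted summability for every power is what the convolution needs in order to preserve
  Schwartz functions and to act on functions of arbitrary polynomial growth.\<close>

locale rapid_coefficients =
  fixes c :: "nat \<Rightarrow> complex" and r :: "nat \<Rightarrow> real"
  assumes sm: "\<And>k. summable (\<lambda>j. norm (c j) * (1 + \<bar>r j\<bar>) ^ k)"
begin

lemma schwartz_shift_series:
  assumes "schwartz phi"
  shows "schwartz (shift_series c r phi)"
proof (rule schwartz_coinduct[of _ "{shift_series c r phi | phi. schwartz phi}"])
  show "shift_series c r phi \<in> {shift_series c r phi | phi. schwartz phi}" using assms by blast
next
  fix h assume "h \<in> {shift_series c r phi | phi. schwartz phi}"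
  then obtain phi where h: "h = shift_series c r phi" and phi: "schwartz phi" by blast
  have bd: "\<exists>C\<ge>0. \<forall>x j. norm (c j * phi (x + r j)) * (1 + \<bar>x\<bar>) ^ k \<le> C * (norm (c j) * (1 + \<bar>r j\<bar>) ^ k)" if phi: "schwartz phi" for k phi
  proof -
    obtain C where C: "C \<ge> 0" "\<And>x r. norm (phi (x + r)) * (1 + \<bar>x\<bar>) ^ k \<le> C * (1 + \<bar>r\<bar>) ^ k"
      using rapidly_decreasing_shift_bound[OF schwartz_imp_rapidly_decreasing[OF phi]] by metis
    have "norm (c j * phi (x + r j)) * (1 + \<bar>x\<bar>) ^ k \<le> C * (norm (c j) * (1 + \<bar>r j\<bar>) ^ k)" for x j
      using mult_left_mono[OF C(2)[of x "r j"], of "norm (c j)"] by (simp add: norm_mult mult_ac)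
    thus ?thesis using C(1) by blast
  qed
  show "rapidly_decreasing h"
    unfolding rapidly_decreasing_def
  proof
    fix k :: nat
    obtain C where C: "\<And>x j. norm (c j * phi (x + r j)) * (1 + \<bar>x\<bar>) ^ k \<le> C * (norm (c j) * (1 + \<bar>r j\<bar>) ^ k)"
      using bd[OF phi] by blast
    define s where "s = (\<Sum>j. C * (norm (c j) * (1 + \<bar>r j\<bar>) ^ k))"
    have "norm (h x) * (1 + \<bar>x\<bar>) ^ k \<le> s" for x
    proof -
      have "(1 + \<bar>x\<bar>) ^ k *\<^sub>R h x = (\<Sum>j. (1 + \<bar>x\<bar>) ^ k *\<^sub>R (c j * phi (x + r j)))"
        unfolding h shift_series_def
      proof (rule suminf_scaleR_right)
        obtain C0 where C0: "\<And>x j. norm (c j * phi (x + r j)) * (1 + \<bar>x\<bar>) ^ 0 \<le> C0 * (norm (c j) * (1 + \<bar>r j\<bar>) ^ 0)"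
          using bd[OF phi] by blast
        show "summable (\<lambda>j. c j * phi (x + r j))"
          using C0[of _ x] by (intro summable_comparison_test'[OF summable_mult[OF sm[of 0], of C0]]) simp
      qed
      also have "norm \<dots> \<le> s" unfolding s_def
        using C by (intro norm_suminf_le summable_mult sm) (simp add: mult.commute)
      finally show ?thesis by (simp add: mult.commute)
    qed
    thus "\<exists>C. \<forall>x. norm (h x) * (1 + \<bar>x\<bar>) ^ k \<le> C" by blast
  qed
  obtain phi' where phi': "schwartz phi'" "\<And>x. (phi has_vector_derivative phi' x) (at x)"
    using schwartz_derivative[OF phi] by blast
  obtain C0 where C0: "\<And>x j. norm (c j * phi (x + r j)) * (1 + \<bar>x\<bar>) ^ 0 \<le> C0 * (norm (c j) * (1 + \<bar>r j\<bar>) ^ 0)"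
    using bd[OF phi] by blast
  obtain C1 where C1: "\<And>x j. norm (c j * phi' (x + r j)) * (1 + \<bar>x\<bar>) ^ 0 \<le> C1 * (norm (c j) * (1 + \<bar>r j\<bar>) ^ 0)"
    using bd[OF phi'(1)] by blast
  have "(h has_vector_derivative shift_series c r phi' x) (at x)" for x
    unfolding h shift_series_def
  proof (rule has_vector_derivative_suminf[where M = "\<lambda>j. C1 * (norm (c j) * (1 + \<bar>r j\<bar>) ^ 0)"])
    fix j x
    have "((\<lambda>x. x + r j) has_vector_derivative 1) (at x)"
      by (auto intro!: derivative_eq_intros)
    from vector_diff_chain_at[OF this phi'(2)] have "((\<lambda>x. phi (x + r j)) has_vector_derivative phi' (x + r j)) (at x)"
      by (simp add: o_def)
    thus "((\<lambda>x. c j * phi (x + r j)) has_vector_derivative c j * phi' (x + r j)) (at x)"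
      by (rule has_vector_derivative_mult_right)
    show "norm (c j * phi' (x + r j)) \<le> C1 * (norm (c j) * (1 + \<bar>r j\<bar>) ^ 0)" using C1[of j x] by simp
    show "summable (\<lambda>j. c j * phi (x + r j))"
      using C0[of _ x] by (intro summable_comparison_test'[OF summable_mult[OF sm[of 0], of C0]]) simp
  qed (intro summable_mult sm)
  thus "\<exists>h'\<in>{shift_series c r phi | phi. schwartz phi}. \<forall>x. (h has_vector_derivative h' x) (at x)"
    using phi'(1) by blast
qed

text \<open>The L1 norm of the j-th integrand is at most a constant times |c j| (1 + |r j|)^m, which
  is summable, so sum and integral can be exchanged. Absolute summability is recorded too, because
  the pairings later serve as Fourier coefficients.\<close>

lemma
  assumes f: "f \<in> poly_growth_space" and phi: "schwartz phi"
  shows pairing_shift_series: "(\<lambda>j. c j * (LINT x|lborel. f x * phi (x + r j))) sums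
        (LINT x|lborel. f x * shift_series c r phi x)"
    and summable_pairing: "summable (\<lambda>j. norm (c j * (LINT x|lborel. f x * phi (x + r j))))"
proof -
  obtain C m where C: "C \<ge> 0" "\<And>x r. norm (f x * phi (x + r)) \<le> C * (1 + \<bar>r\<bar>) ^ m / (1 + \<bar>x\<bar>)\<^sup>2"
    using poly_growth_shift_bound[OF f schwartz_imp_rapidly_decreasing[OF phi]] by metis
  define J where "J = (LINT x|lborel. 1 / (1 + \<bar>x::real\<bar>)\<^sup>2)"
  have intJ: "integrable lborel (\<lambda>x::real. 1 / (1 + \<bar>x\<bar>)\<^sup>2)"
  proof -
    have "integrable lborel (\<lambda>x::real. complex_of_real (1 / (1 + \<bar>x\<bar>)\<^sup>2))"
      by (rule integrable_lborel_inverse_square_bound[where C = 1])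
         (intro continuous_intros, auto simp: add_nonneg_eq_0_iff simp del: of_real_divide of_real_power of_real_add)
    from integrable_Re[OF this] show ?thesis by (simp only: Re_complex_of_real)
  qed
  define g where "g = (\<lambda>j x. c j * (f x * phi (x + r j)))"
  have intg: "integrable lborel (g j)" for j
    unfolding g_def by (intro integrable_mult_right integrable_poly_growth_schwartz f phi)
  have bdg: "norm (g j x) \<le> C * (norm (c j) * (1 + \<bar>r j\<bar>) ^ m) * (1 / (1 + \<bar>x\<bar>)\<^sup>2)" for j x
    unfolding g_def norm_mult[of "c j"] using mult_left_mono[OF C(2)[of x "r j"], of "norm (c j)"] by (simp add: mult_ac)
  have J: "(LINT x|lborel. norm (g j x)) \<le> C * (norm (c j) * (1 + \<bar>r j\<bar>) ^ m) * J" for j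
  proof -
    have "(LINT x|lborel. norm (g j x)) \<le> (LINT x|lborel. C * (norm (c j) * (1 + \<bar>r j\<bar>) ^ m) * (1 / (1 + \<bar>x\<bar>)\<^sup>2))"
      by (intro integral_mono integrable_norm intg integrable_mult_right intJ bdg)
    also have "\<dots> = C * (norm (c j) * (1 + \<bar>r j\<bar>) ^ m) * J"
      unfolding J_def by (rule integral_mult_right_zero)
    finally show ?thesis .
  qed
  have sumJ: "summable (\<lambda>j. C * (norm (c j) * (1 + \<bar>r j\<bar>) ^ m) * J)"
    by (intro summable_mult summable_mult2 sm)
  have s2: "summable (\<lambda>j. LINT x|lborel. norm (g j x))"
    by (rule summable_comparison_test'[OF sumJ]) (use J in \<open>simp add: abs_of_nonneg integral_nonneg_AE\<close>)
  have s1: "summable (\<lambda>j. norm (g j x))" for x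
    by (rule summable_comparison_test'[OF summable_mult2[OF summable_mult[OF sm[of m], of C], of "1 / (1 + \<bar>x\<bar>)\<^sup>2"]])
       (use bdg[of _ x] in simp)
  have "(\<lambda>j. LINT x|lborel. g j x) sums (LINT x|lborel. (\<Sum>j. g j x))"
    by (rule sums_integral[OF intg _ s2]) (use s1 in simp)
  moreover have "(\<Sum>j. g j x) = f x * shift_series c r phi x" for x
  proof -
    obtain C0 where C0: "\<And>x r. norm (phi (x + r)) * (1 + \<bar>x\<bar>) ^ 0 \<le> C0 * (1 + \<bar>r\<bar>) ^ 0"
      using rapidly_decreasing_shift_bound[OF schwartz_imp_rapidly_decreasing[OF phi]] by metis
    have "norm (c j * phi (x + r j)) \<le> C0 * (norm (c j) * (1 + \<bar>r j\<bar>) ^ 0)" for j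
      using mult_left_mono[OF C0[of x "r j"], of "norm (c j)"] by (simp add: norm_mult mult_ac)
    hence "summable (\<lambda>j. c j * phi (x + r j))"
      by (intro summable_comparison_test'[OF summable_mult[OF sm[of 0], of C0]]) simp
    from suminf_mult[OF this, of "f x"] show ?thesis unfolding shift_series_def g_def by (simp add: mult_ac)
  qed
  ultimately show "(\<lambda>j. c j * (LINT x|lborel. f x * phi (x + r j))) sums (LINT x|lborel. f x * shift_series c r phi x)"
    unfolding g_def by simp
  show "summable (\<lambda>j. norm (c j * (LINT x|lborel. f x * phi (x + r j))))"
  proof (rule summable_comparison_test'[OF s2])
    fix j
    have "c j * (LINT x|lborel. f x * phi (x + r j)) = (LINT x|lborel. g j x)" unfolding g_def by simp
    thus "norm (norm (c j * (LINT x|lborel. f x * phi (x + r j)))) \<le> (LINT x|lborel. norm (g j x))"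
      by (simp add: integral_norm_bound)
  qed
qed

text \<open>The termwise pairing is applied with a character in the place of \<open>f\<close>;
  translating \<open>phi\<close> by r j multiplies its transform by exp(2 pi i r j t).\<close>

lemma fourier_shift_series:
  assumes phi: "schwartz phi"
  shows "fourier (shift_series c r phi) t = (\<Sum>j. c j * exp (2 * of_real pi * \<i> * of_real (r j) * of_real t)) * fourier phi t"
proof -
  have "(LINT x|lborel. exp (- 2 * of_real pi * \<i> * complex_of_real (t * x)) * phi (x + r j))
      = exp (2 * of_real pi * \<i> * of_real (r j) * of_real t) * fourier phi t" for j
  proof -
    have "(LINT x|lborel. exp (- 2 * of_real pi * \<i> * complex_of_real (t * x)) * phi (x + r j))
      = (LINT x|lborel. exp (- 2 * of_real pi * \<i> * complex_of_real (t * (- r j + x))) * phi x)"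
      using lborel_integral_real_affine[of 1 "\<lambda>x. exp (- 2 * of_real pi * \<i> * complex_of_real (t * x)) * phi (x + r j)" "- r j"]
      by simp
    also have "\<dots> = (LINT x|lborel. exp (2 * of_real pi * \<i> * of_real (r j) * of_real t) * (exp (- 2 * of_real pi * \<i> * complex_of_real (t * x)) * phi x))"
    proof -
      have "exp (- 2 * of_real pi * \<i> * complex_of_real (t * (- r j + x)))
          = exp (2 * of_real pi * \<i> * of_real (r j) * of_real t) * exp (- 2 * of_real pi * \<i> * complex_of_real (t * x))" for x
        unfolding exp_add[symmetric] by (simp add: algebra_simps)
      thus ?thesis by (simp only: mult.assoc)
    qed
    finally show ?thesis unfolding fourier_eq_lborel[OF phi] by simp
  qed
  with pairing_shift_series[OF character_poly_growth phi, of t]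
  have s: "(\<lambda>j. (c j * exp (2 * of_real pi * \<i> * of_real (r j) * of_real t)) * fourier phi t) sums fourier (shift_series c r phi) t"
    unfolding fourier_eq_lborel[OF schwartz_shift_series[OF phi]] by (simp add: mult.assoc)
  have "summable (\<lambda>j. norm (c j * exp (2 * of_real pi * \<i> * of_real (r j) * of_real t)))"
    using sm[of 0] by (simp add: norm_mult norm_exp_eq_Re)
  hence "summable (\<lambda>j. c j * exp (2 * of_real pi * \<i> * of_real (r j) * of_real t))" by (rule summable_norm_cancel)
  from suminf_mult2[OF this, of "fourier phi t"] s show ?thesis by (simp add: sums_iff)
qed

end

lemma sums_interval_integral:
  fixes f :: "nat \<Rightarrow> real \<Rightarrow> complex"
  assumes c: "\<And>j. continuous_on {a..b} (f j)" and M: "\<And>j x. x \<in> {a..b} \<Longrightarrow> norm (f j x) \<le> M j" "summable M"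
  shows "(\<lambda>j. integral {a..b} (f j)) sums integral {a..b} (\<lambda>x. \<Sum>j. f j x)"
proof -
  have ul: "uniform_limit {a..b} (\<lambda>n x. \<Sum>j<n. f j x) (\<lambda>x. \<Sum>j. f j x) sequentially"
    by (rule Weierstrass_m_test[OF M])
  obtain I J where I: "\<And>n. ((\<lambda>x. \<Sum>j<n. f j x) has_integral I n) {a..b}"
    and J: "((\<lambda>x. \<Sum>j. f j x) has_integral J) {a..b}" "(I \<longlongrightarrow> J) sequentially"
    by (rule uniform_limit_integral[OF ul]) (auto intro!: continuous_intros c)
  have "I n = (\<Sum>j<n. integral {a..b} (f j))" for n
  proof -
    have "((\<lambda>x. \<Sum>j<n. f j x) has_integral (\<Sum>j<n. integral {a..b} (f j))) {a..b}"
      by (intro has_integral_sum integrable_integral integrable_continuous_interval c) auto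
    thus ?thesis using I has_integral_unique by blast
  qed
  hence "I = (\<lambda>n. \<Sum>j<n. integral {a..b} (f j))" by blast
  thus ?thesis using J unfolding sums_def by (simp add: integral_unique)
qed

section \<open>Localization of the spectrum\<close>

text \<open>The unnormalized bump is nonnegative and positive at 0, so its integral, which is the
  transform at 0, can be scaled to 1. Real values make the transform at -x the conjugate of the one
  at x.\<close>

lemma bump_exists:
  assumes e: "e > 0"
  obtains b where "bump e b" "\<And>u. b u \<in> \<real>" "bump_ft e b 0 = 1"
proof -
  define w where "w = (\<lambda>x. flat 0 (e + x) * flat 0 (e - x))"
  define s where "s = integral {-e..e} w"
  have b: "bump e (\<lambda>x. of_real (w x))" unfolding w_def by (rule bump_flat)
  have "continuous_on {-e..e} (\<lambda>x. Re (complex_of_real (w x)))"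
    by (intro continuous_intros bump_continuous[OF b])
  hence wc: "continuous_on {-e..e} w" by simp
  have w0: "w x \<ge> 0" for x by (simp add: w_def flat_def)
  have "s \<noteq> 0"
  proof
    assume "s = 0"
    hence "(w has_integral 0) {-e..e}"
      unfolding s_def using wc integrable_integral integrable_continuous_interval by metis
    hence "w 0 = 0" using has_integral_0_cbox_imp_0[of "-e" e w 0] wc w0 e by simp
    thus False using e by (simp add: w_def flat_def)
  qed
  moreover have "bump_ft e (\<lambda>x. of_real (w x)) 0 = of_real s"
  proof -
    have "(w has_integral s) {-e..e}"
      unfolding s_def using wc integrable_integral integrable_continuous_interval by metis
    from has_integral_of_real[OF this, where 'b = complex] show ?thesis
      unfolding bump_ft_def by (simp add: integral_unique)
  qed
  ultimately have "bump_ft e (\<lambda>x. of_real (1 / s) * of_real (w x)) 0 = 1"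
    unfolding bump_ft_def by (simp add: mult.assoc[symmetric])
  thus thesis using that[of "\<lambda>x. of_real (1 / s) * of_real (w x)"] bump_cmult[OF b, of "of_real (1 / s)"] by simp
qed

text \<open>Orthogonality of characters over a period. It serves both to extract a constant Fourier
  coefficient and to trade an interval for its complement in a period.\<close>

lemma integral_character:
  fixes n :: int
  assumes ab: "a < b"
  shows "integral {a..b} (\<lambda>x. exp (- (2 * of_real pi * \<i> * of_real (1 / (b - a) * of_int n)) * complex_of_real x))
      = (if n = 0 then of_real (b - a) else 0)"
proof (cases "n = 0")
  case True thus ?thesis using ab by (simp add: scaleR_conv_of_real)
next
  case False
  define w where "w = 2 * of_real pi * \<i> * complex_of_real (1 / (b - a) * of_int n)"
  have w0: "w \<noteq> 0" using False ab by (simp add: w_def)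
  have "((\<lambda>x. exp (- w * complex_of_real x)) has_integral
     (- exp (- w * of_real b) / w) - (- exp (- w * of_real a) / w)) {a..b}"
  proof (rule fundamental_theorem_of_calculus)
    fix x assume "x \<in> {a..b}"
    have "((\<lambda>x. - exp (- w * of_real x) / w) has_vector_derivative exp (- w * of_real x)) (at x)"
      by (rule has_vector_derivative_real_field) (use w0 in \<open>auto intro!: derivative_eq_intros\<close>)
    thus "((\<lambda>x. - exp (- w * of_real x) / w) has_vector_derivative exp (- w * of_real x)) (at x within {a..b})"
      by (rule has_vector_derivative_at_within)
  qed (use ab in simp)
  moreover have "exp (- w * of_real a) = exp (- w * of_real b)"
  proof -
    have "w * of_real (b - a) = 2 * of_int n * of_real pi * \<i>"
      using ab by (simp add: w_def mult_ac flip: of_real_diff)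
    hence "- w * of_real a = - w * of_real b + \<i> * (of_int n * (of_real pi * 2))"
      by (simp add: algebra_simps)
    thus ?thesis by (simp only: exp_plus_2pin)
  qed
  ultimately show ?thesis using False unfolding w_def by (simp add: integral_unique)
qed

text \<open>
  In place of a partition of unity on the Fourier side: multiplying the transform of \<open>phi\<close> by a periodized
  bump around \<open>\<tau>\<close> gives a test function whose pairing with \<open>f\<close> vanishes by local annihilation near \<open>\<tau>\<close>. As
  a function of \<open>\<tau>\<close> this pairing is an absolutely convergent Fourier series with constant term \<open>\<integral> f phi\<close>.
\<close>

lemma pairing_eq_0_of_local_spectrum:
  assumes f: "f \<in> poly_growth_space" and S: "spectrum_of f \<subseteq> S" "S \<noteq> UNIV"
    and phi: "schwartz phi" and T: "T \<ge> 0" "\<And>t. \<bar>t\<bar> \<ge> T \<Longrightarrow> fourier phi t = 0"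
    and U: "open U" "S \<subseteq> U" "\<And>t. t \<in> U \<Longrightarrow> fourier phi t = 0"
  shows "(LINT x|lborel. f x * phi x) = 0"
proof -
  \<comment> \<open>The series in \<tau> has period 2L = 1/l. With L = T + 1, copies of the bump
    translated by nonzero multiples of 2L stay more than 1 away from every t with |t| < T.\<close>
  define L where "L = T + 1"
  define l where "l = 1 / (2 * L)"
  have L: "L > 0" "L \<ge> 1" using T by (auto simp: L_def)
  have l: "l > 0" using L by (simp add: l_def)
  define G where "G = insert U {- S' | S'. closed S' \<and> annihilates S' f}"
  \<comment> \<open>An empty family would have intersection \<real>, which S \<noteq> UNIV excludes.
    One annihilating set suffices to show that \<open>f\<close> pairs to 0 with a Schwartz function
    whose transform vanishes everywhere; injectivity of the transform is not invoked.\<close>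
  have ne: "\<exists>S'. closed S' \<and> annihilates S' f"
    using S unfolding spectrum_of_def by blast
  obtain e0 where e0: "e0 > 0" "\<And>x. x \<in> {-L..L} \<Longrightarrow> \<exists>V\<in>G. ball x e0 \<subseteq> V"
  proof (rule Heine_Borel_lemma[of "{-L..L}" G])
    show "{-L..L} \<subseteq> \<Union>G"
    proof
      fix x assume "x \<in> {-L..L}"
      show "x \<in> \<Union>G"
      proof (cases "x \<in> U")
        case False
        hence "x \<notin> spectrum_of f" using U S by blast
        thus ?thesis unfolding spectrum_of_def G_def by auto
      qed (auto simp: G_def)
    qed
    show "\<And>V. V \<in> G \<Longrightarrow> open V" using U by (auto simp: G_def)
  qed (auto intro: that)
  \<comment> \<open>\<open>e0\<close> is a Lebesgue number of the cover, so a closed ball of radius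
    e < e0 around each \<tau> lies in a single member; e < 1 fits the margin between T and
    L.\<close>
  define e where "e = min (e0 / 2) (1 / 2)"
  have e: "e > 0" "e < e0" "e < 1" using e0 by (auto simp: e_def)
  obtain b where b: "bump e b" "bump_ft e b 0 = 1" using bump_exists[OF e(1)] by metis
  define n where "n = int_decode"
  define r where "r = (\<lambda>j. l * real_of_int (n j))"
  define B where "B = (\<lambda>j. bump_ft e b (of_real (r j)))"
  define a where "a = (\<lambda>j. B j * (LINT x|lborel. f x * phi (x + r j)))"
  define ch where "ch = (\<lambda>j (\<tau>::real). exp (- (2 * of_real pi * \<i> * of_real (r j)) * complex_of_real \<tau>))"
  have nch: "norm (ch j \<tau>) = 1" for j \<tau> unfolding ch_def norm_exp_eq_Re by simp
  have sB: "summable (\<lambda>j. norm (B j) * (1 + \<bar>r j\<bar>) ^ k)" for k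
    using summable_bump_ft_samples[OF b(1) e(1) l, of k] l unfolding B_def r_def n_def by (simp add: abs_mult)
  have zero: "(\<Sum>j. a j * ch j \<tau>) = 0" if \<tau>: "\<tau> \<in> {-L..L}" for \<tau>
  proof -
    define c where "c = (\<lambda>j. B j * ch j \<tau>)"
    interpret rapid_coefficients c r
      by unfold_locales (simp add: c_def norm_mult nch sB)
    define psi where "psi = shift_series c r phi"
    have spsi: "schwartz psi" unfolding psi_def by (rule schwartz_shift_series[OF phi])
    have far: "fourier psi t = 0" if t: "\<bar>t - \<tau>\<bar> > e" for t
    proof (cases "\<bar>t\<bar> \<ge> T")
      case True thus ?thesis unfolding psi_def fourier_shift_series[OF phi] using T by simp
    next
      case False
      have "(\<lambda>j. bump_ft e b (of_real (l * of_int (int_decode j))) *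
          exp (2 * of_real pi * \<i> * of_real (l * of_int (int_decode j)) * of_real (t - \<tau>))) sums 0"
      proof (rule poisson_vanishing[OF b(1) e(1) l])
        fix k :: int
        show "\<bar>t - \<tau> - of_int k / l\<bar> > e"
        proof (cases "k = 0")
          case k: False
          have "\<bar>real_of_int k\<bar> \<ge> 1" using k by linarith
          hence "\<bar>of_int k / l\<bar> \<ge> 2 * L" using L by (simp add: l_def abs_mult)
          moreover have "\<bar>t - \<tau>\<bar> < 2 * L - 1" using False \<tau> unfolding L_def by auto
          ultimately show ?thesis using e by linarith
        qed (use t in simp)
      qed
      moreover have "bump_ft e b (of_real (l * of_int (int_decode j))) *
          exp (2 * of_real pi * \<i> * of_real (l * of_int (int_decode j)) * of_real (t - \<tau>))
        = c j * exp (2 * of_real pi * \<i> * of_real (r j) * of_real t)" for j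
        unfolding c_def B_def ch_def r_def n_def mult.assoc exp_add[symmetric] by (simp add: algebra_simps)
      ultimately have "(\<Sum>j. c j * exp (2 * of_real pi * \<i> * of_real (r j) * of_real t)) = 0"
        by (simp add: sums_iff)
      thus ?thesis unfolding psi_def fourier_shift_series[OF phi] by simp
    qed
    obtain V where V: "V \<in> G" "ball \<tau> e0 \<subseteq> V" using e0(2)[OF \<tau>] by blast
    have "integral UNIV (\<lambda>x. f x * psi x) = 0"
    \<comment> \<open>If the ball lies in \<open>U\<close>, the transform of \<open>psi\<close>
      vanishes everywhere: within distance e because that of \<open>phi\<close> does, beyond it by
      \<open>far\<close>. Otherwise the ball misses an annihilating set, and the complement of the
      closed e-ball is the neighbourhood on which the transform vanishes.\<close>
    proof (cases "V = U")
      case True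
      have "fourier psi t = 0" for t
      proof (cases "\<bar>t - \<tau>\<bar> > e")
        case False
        hence "t \<in> U" using V True e by (auto simp: dist_real_def)
        thus ?thesis unfolding psi_def fourier_shift_series[OF phi] using U by simp
      qed (rule far)
      thus ?thesis using ne spsi unfolding annihilates_def by blast
    next
      case False
      then obtain S' where S': "V = - S'" "closed S'" "annihilates S' f" using V by (auto simp: G_def)
      have "open (- cball \<tau> e)" by auto
      moreover have "S' \<subseteq> - cball \<tau> e"
      using V(2) S'(1) cball_subset_ball_iff[of \<tau> e \<tau> e0] e by auto
      moreover have "\<forall>t\<in>- cball \<tau> e. fourier psi t = 0" using far by (auto simp: dist_real_def abs_minus_commute)
      ultimately show ?thesis using S'(3) spsi unfolding annihilates_def by blast
    qed
    hence "(LINT x|lborel. f x * psi x) = 0" by (simp add: integral_poly_growth_schwartz[OF f spsi])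
    with pairing_shift_series[OF f phi] have "(\<lambda>j. c j * (LINT x|lborel. f x * phi (x + r j))) sums 0"
      unfolding psi_def by simp
    moreover have "c j * (LINT x|lborel. f x * phi (x + r j)) = a j * ch j \<tau>" for j
      by (simp add: c_def a_def)
    ultimately show ?thesis by (simp add: sums_iff)
  qed
  have sa: "summable (\<lambda>j. norm (a j))"
  proof -
    interpret rapid_coefficients B r by unfold_locales (rule sB)
    show ?thesis unfolding a_def by (rule summable_pairing[OF f phi])
  qed
  have "(\<lambda>j. integral {-L..L} (\<lambda>\<tau>. a j * ch j \<tau>)) sums integral {-L..L} (\<lambda>\<tau>. \<Sum>j. a j * ch j \<tau>)"
  proof (rule sums_interval_integral[OF _ _ sa])
    show "continuous_on {-L..L} (\<lambda>\<tau>. a j * ch j \<tau>)" for j unfolding ch_def by (intro continuous_intros)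
    show "norm (a j * ch j \<tau>) \<le> norm (a j)" for j \<tau> by (simp add: norm_mult nch)
  qed
  moreover have "integral {-L..L} (\<lambda>\<tau>. \<Sum>j. a j * ch j \<tau>) = 0"
    using zero by (subst Henstock_Kurzweil_Integration.integral_cong[of _ _ "\<lambda>_. 0"]) auto
  moreover have "integral {-L..L} (\<lambda>\<tau>. a j * ch j \<tau>) = (if j = 0 then 2 * of_real L * a 0 else 0)" for j
  proof -
    have "n j = 0 \<longleftrightarrow> j = 0"
    proof
      assume "n j = 0"
      hence "int_decode j = int_decode 0" unfolding n_def by (simp add: int_decode_def sum_decode_def)
      thus "j = 0" by (metis int_decode_inverse)
    qed (simp add: n_def int_decode_def sum_decode_def)
    moreover have "integral {-L..L} (\<lambda>\<tau>. a j * ch j \<tau>) = a j * integral {-L..L} (ch j)" by simp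
    ultimately show ?thesis
      unfolding ch_def r_def l_def using integral_character[of "-L" L "n j"] L by auto
  qed
  ultimately have "(\<lambda>j. if j = 0 then 2 * of_real L * a 0 else 0) sums 0" by simp
  moreover have "(\<lambda>j::nat. if j = 0 then 2 * of_real L * a 0 else 0) sums (2 * of_real L * a 0)"
    by (rule sums_single)
  ultimately have "2 * of_real L * a 0 = 0" using sums_unique2 by blast
  hence "a 0 = 0" using L by simp
  moreover have "r 0 = 0" by (simp add: r_def n_def int_decode_def sum_decode_def)
  ultimately show ?thesis using b(2) unfolding a_def B_def by simp
qed

lemma fourier_affine:
  assumes phi: "schwartz phi" and a: "a > 0"
  shows "fourier (\<lambda>x. phi (a * x + b)) t = of_real (1 / a) * exp (2 * of_real pi * \<i> * of_real (t * b / a)) * fourier phi (t / a)"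
proof -
  have "fourier (\<lambda>x. phi (a * x + b)) t = (LINT x|lborel. exp (- 2 * of_real pi * \<i> * complex_of_real (t * x)) * phi (a * x + b))"
    by (rule fourier_eq_lborel) (use schwartz_affine[OF phi, of a b] a in simp)
  also have "\<dots> = (1 / a) *\<^sub>R (LINT x|lborel. exp (- 2 * of_real pi * \<i> * complex_of_real (t * (- b / a + 1 / a * x))) * phi (a * (- b / a + 1 / a * x) + b))"
    using a by (subst lborel_integral_real_affine[of "1 / a" _ "- b / a"]) auto
  also have "\<dots> = (1 / a) *\<^sub>R (LINT x|lborel. exp (2 * of_real pi * \<i> * of_real (t * b / a)) * (exp (- 2 * of_real pi * \<i> * complex_of_real (t / a * x)) * phi x))"
  proof -
    have "exp (- 2 * of_real pi * \<i> * complex_of_real (t * (- b / a + 1 / a * x)))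
        = exp (2 * of_real pi * \<i> * of_real (t * b / a)) * exp (- 2 * of_real pi * \<i> * complex_of_real (t / a * x))" for x
      unfolding exp_add[symmetric] by (simp add: algebra_simps)
    moreover have "a * (- b / a + 1 / a * x) + b = x" for x using a by (simp add: field_simps)
    ultimately show ?thesis by (simp only: mult.assoc)
  qed
  also have "\<dots> = (1 / a) *\<^sub>R (exp (2 * of_real pi * \<i> * of_real (t * b / a)) * fourier phi (t / a))"
    unfolding fourier_eq_lborel[OF phi] by simp
  finally show ?thesis by (simp only: scaleR_conv_of_real mult.assoc)
qed

text \<open>Writing the reflected factor as an integral over the support of \<open>b\<close>, Fubini
  turns the transform into an integral of b u times the transform of \<open>B\<close> at t - u. For
  |u| <= 1 and |t| >= 3 that argument has modulus greater than 1.\<close>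

lemma fourier_bump_ft_times_reflection:
  assumes b: "bump 1 b" and t: "\<bar>t\<bar> \<ge> 3"
  shows "fourier (\<lambda>x. bump_ft 1 b (of_real x) * bump_ft 1 b (- of_real x)) t = 0"
proof -
  define B where "B = (\<lambda>x::real. bump_ft 1 b (of_real x))"
  have sB: "schwartz B" unfolding B_def by (rule schwartz_bump_ft[OF b]) simp
  have sB': "schwartz (\<lambda>x. B (- x))" using schwartz_affine[OF sB, of "-1" 0] by simp
  have sBB: "schwartz (\<lambda>x. B x * B (- x))" by (rule schwartz_mult[OF sB sB'])
  have bc: "continuous_on UNIV b" by (rule bump_continuous[OF b])
  have b0: "b u = 0" if "u \<notin> {-1..1}" for u using bump_zero[OF b, of u] that by auto
  have intb: "integrable lborel b"
  proof -
    have "set_integrable lborel {-1..1} b"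
      by (rule borel_integrable_atLeastAtMost') (rule bump_continuous[OF b])
    moreover have "indicator {-1..1} u *\<^sub>R b u = b u" for u using b0[of u] by (cases "u \<in> {-1..1}") auto
    ultimately show ?thesis by (simp add: set_integrable_def)
  qed
  have Bm: "B (- x) = (LINT u|lborel. b u * exp (2 * of_real pi * \<i> * of_real x * of_real u))" for x
  proof -
    define g where "g = (\<lambda>u. b u * exp (- (2 * of_real pi * \<i> * of_real (- x)) * of_real u))"
    have "set_integrable lborel {-1..1} g"
      unfolding g_def by (rule borel_integrable_atLeastAtMost') (intro continuous_intros bump_continuous[OF b])
    from set_borel_integral_eq_integral(2)[OF this] have "B (- x) = (LINT u:{-1..1}|lborel. g u)"
      unfolding B_def bump_ft_def g_def by simp
    moreover have "indicator {-1..1} u *\<^sub>R g u = g u" for u using b0[of u] by (cases "u \<in> {-1..1}") (auto simp: g_def)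
    ultimately show ?thesis unfolding set_lebesgue_integral_def g_def by simp
  qed
  define h where "h = (\<lambda>(u::real, x::real). b u * exp (2 * of_real pi * \<i> * of_real x * of_real u) * (exp (- 2 * of_real pi * \<i> * complex_of_real (t * x)) * B x))"
  have nh: "norm (h (u, x)) = norm (b u) * norm (B x)" for u x
    by (simp add: h_def norm_mult norm_exp_eq_Re)
  have intB: "integrable lborel (\<lambda>x. exp (- 2 * of_real pi * \<i> * complex_of_real (s * x)) * B x)" for s
    using integrable_poly_growth_schwartz[OF character_poly_growth sB, of s 0] by simp
  have intnB: "integrable lborel (\<lambda>x. norm (B x))" using integrable_norm[OF intB[of 0]] by simp
  have hx: "h (u, x) = b u * (exp (- 2 * of_real pi * \<i> * complex_of_real ((t - u) * x)) * B x)" for u x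
  proof -
    have "exp (2 * of_real pi * \<i> * of_real x * of_real u) * exp (- 2 * of_real pi * \<i> * complex_of_real (t * x)) = exp (- 2 * of_real pi * \<i> * complex_of_real ((t - u) * x))"
      unfolding exp_add[symmetric] by (simp add: algebra_simps)
    thus ?thesis unfolding h_def by (simp add: mult.assoc[symmetric])
  qed
  have inth: "integrable (lborel \<Otimes>\<^sub>M lborel) h"
  proof (rule lborel_pair.Fubini_integrable)
    have "continuous_on UNIV h"
      unfolding h_def split_beta
      by (intro continuous_intros continuous_on_compose2[OF bc] continuous_on_compose2[OF schwartz_imp_continuous[OF sB]]) auto
    thus "h \<in> borel_measurable (lborel \<Otimes>\<^sub>M lborel)"
      unfolding lborel_prod using borel_measurable_continuous_onI by simp
    show "integrable lborel (\<lambda>u. LINT x|lborel. norm (h (u, x)))"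
      unfolding nh using integrable_norm[OF intb] by simp
    show "AE u in lborel. integrable lborel (\<lambda>x. h (u, x))"
      unfolding hx by (intro AE_I2 integrable_mult_right intB)
  qed
  have "fourier (\<lambda>x. B x * B (- x)) t = (LINT x|lborel. exp (- 2 * of_real pi * \<i> * complex_of_real (t * x)) * (B x * B (- x)))"
    by (rule fourier_eq_lborel[OF sBB])
  also have "\<dots> = (LINT x|lborel. (LINT u|lborel. h (u, x)))"
  proof (rule Bochner_Integration.integral_cong[OF refl])
    fix x :: real
    have "(LINT u|lborel. h (u, x)) = (LINT u|lborel. b u * exp (2 * of_real pi * \<i> * of_real x * of_real u)) * (exp (- 2 * of_real pi * \<i> * complex_of_real (t * x)) * B x)"
      unfolding h_def by (simp del: mult_cancel_right)
    thus "exp (- 2 * of_real pi * \<i> * complex_of_real (t * x)) * (B x * B (- x)) = (LINT u|lborel. h (u, x))"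
      unfolding Bm[symmetric] by (simp add: mult_ac)
  qed
  also have "\<dots> = (LINT u|lborel. (LINT x|lborel. h (u, x)))"
    using lborel_pair.Fubini_integral[of "\<lambda>u x. h (u, x)"] inth by simp
  also have "\<dots> = (LINT (u::real)|lborel. 0)"
  proof (rule Bochner_Integration.integral_cong[OF refl])
    fix u :: real
    have "(LINT x|lborel. h (u, x)) = b u * fourier B (t - u)"
      unfolding hx fourier_eq_lborel[OF sB] by simp
    also have "\<dots> = 0"
    proof (cases "u \<in> {-1..1}")
      case True
      hence "\<bar>t - u\<bar> > 1" using t by auto
      hence "fourier B (t - u) = 0" unfolding B_def by (intro fourier_bump_ft_eq_0[OF b]) auto
      thus ?thesis by simp
    qed (simp add: b0)
    finally show "(LINT x|lborel. h (u, x)) = 0" .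
  qed
  finally show ?thesis unfolding B_def by simp
qed

text \<open>For a real bump the product B x B(-x) equals |B x|^2, so its integral is positive
  without recourse to Fourier inversion, while the transform keeps bounded support. This is the
  profile of the approximate identity used next.\<close>

lemma band_limited_schwartz_exists:
  obtains phi where "schwartz phi" "\<And>t. \<bar>t\<bar> \<ge> 3 \<Longrightarrow> fourier phi t = 0" "(LINT x|lborel. phi x) \<noteq> 0"
proof -
  obtain b where b: "bump 1 b" "\<And>u. b u \<in> \<real>" "bump_ft 1 b 0 = 1"
    using bump_exists[of 1] by auto
  define B where "B = (\<lambda>x::real. bump_ft 1 b (of_real x))"
  define phi where "phi = (\<lambda>x. B x * B (- x))"
  have sB: "schwartz B" unfolding B_def by (rule schwartz_bump_ft[OF b(1)]) simp
  have "schwartz (\<lambda>x. B (- x))" using schwartz_affine[OF sB, of "-1" 0] by simp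
  hence sphi: "schwartz phi" unfolding phi_def by (rule schwartz_mult[OF sB])
  have "B (- x) = cnj (B x)" for x
  proof -
    have "cnj (B x) = integral {-1..1} (\<lambda>u. cnj (b u * exp (- (2 * of_real pi * \<i> * of_real x) * of_real u)))"
      unfolding B_def bump_ft_def by (simp add: integral_cnj)
    also have "(\<lambda>u. cnj (b u * exp (- (2 * of_real pi * \<i> * of_real x) * of_real u)))
        = (\<lambda>u. b u * exp (- (2 * of_real pi * \<i> * of_real (- x)) * of_real u))"
      using b(2) by (auto simp: fun_eq_iff exp_cnj Reals_cnj_iff)
    finally show ?thesis unfolding B_def bump_ft_def by simp
  qed
  hence pr: "phi x = of_real ((norm (B x))\<^sup>2)" for x
    unfolding phi_def complex_norm_square by simp
  have intphi: "integrable lborel phi"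
    using integrable_poly_growth_schwartz[OF character_poly_growth sphi, of 0 0] by simp
  have "(LINT x|lborel. phi x) \<noteq> 0"
  proof
    assume 0: "(LINT x|lborel. phi x) = 0"
    have cB: "continuous_on UNIV B" by (rule schwartz_imp_continuous[OF sB])
    have int2: "integrable lborel (\<lambda>x. (norm (B x))\<^sup>2)"
      using integrable_Re[OF intphi] unfolding pr by simp
    have "complex_of_real (LINT x|lborel. (norm (B x))\<^sup>2) = 0"
      using 0 unfolding pr integral_complex_of_real .
    hence "(LINT x|lborel. (norm (B x))\<^sup>2) = 0" by simp
    hence hi: "((\<lambda>x. (norm (B x))\<^sup>2) has_integral 0) UNIV"
      using has_integral_integral_lborel[OF int2] by simp
    have i1: "(\<lambda>x. (norm (B x))\<^sup>2) integrable_on cbox (-1) 1"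
      by (intro integrable_continuous continuous_intros continuous_on_subset[OF cB]) auto
    have "integral (cbox (-1) 1) (\<lambda>x. (norm (B x))\<^sup>2) \<le> integral UNIV (\<lambda>x. (norm (B x))\<^sup>2)"
      using hi by (intro integral_subset_le i1) auto
    hence "integral (cbox (-1) 1) (\<lambda>x. (norm (B x))\<^sup>2) \<le> 0" using hi by (simp add: integral_unique)
    moreover have "integral (cbox (-1) 1) (\<lambda>x. (norm (B x))\<^sup>2) \<ge> 0"
      by (intro Henstock_Kurzweil_Integration.integral_nonneg i1) auto
    ultimately have "((\<lambda>x. (norm (B x))\<^sup>2) has_integral 0) (cbox (-1) 1)"
      using integrable_integral[OF i1] by simp
    hence "(norm (B 0))\<^sup>2 = 0"
      by (rule has_integral_0_cbox_imp_0[rotated 2])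
         (auto intro!: continuous_intros continuous_on_subset[OF cB])
    thus False using b(3) by (simp add: B_def)
  qed
  moreover have "fourier phi t = 0" if "\<bar>t\<bar> \<ge> 3" for t
    using fourier_bump_ft_times_reflection[OF b(1) that] unfolding phi_def B_def by simp
  ultimately show thesis using that sphi by blast
qed

text \<open>Tested against ever narrower band-limited kernels around \<open>x\<close>, the
  convolution pairs to 0, because its multiplier vanishes near the spectrum. Dominated convergence
  handles the limit of each term, and Tannery's theorem the limit of the series.\<close>

lemma (in rapid_coefficients) convolution_equation:
  assumes f: "f \<in> poly_growth_space" and S: "spectrum_of f \<subseteq> S" "S \<noteq> UNIV"
    and U: "open U" "S \<subseteq> U"
    and van: "\<And>t. t \<in> U \<Longrightarrow> (\<Sum>j. c j * exp (2 * of_real pi * \<i> * of_real (r j) * of_real t)) = 0"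
  shows "(\<lambda>j. c j * f (x - r j)) sums 0"
proof -
  obtain phi where phi: "schwartz phi" "\<And>t. \<bar>t\<bar> \<ge> 3 \<Longrightarrow> fourier phi t = 0" "(LINT x|lborel. phi x) \<noteq> 0"
    using band_limited_schwartz_exists by blast
  obtain A N where A: "\<And>x. norm (f x) \<le> A * (1 + \<bar>x\<bar>) ^ N"
    using f unfolding poly_growth_space_def by blast
  have A0: "A \<ge> 0" using A[of 0] norm_ge_zero[of "f 0"] by (simp del: norm_ge_zero)
  have fc: "continuous_on UNIV f" using f by (simp add: poly_growth_space_def)
  define H where "H = (\<lambda>j n. LINT y|lborel. f (x - r j + y / real (Suc n)) * phi y)"
  have zero: "(\<lambda>j. c j * H j n) sums 0" for n
  proof -
    define \<mu> where "\<mu> = real (Suc n)"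
    have \<mu>: "\<mu> > 0" by (simp add: \<mu>_def)
    \<comment> \<open>This is phi(\<mu> (y - x)): it concentrates at \<open>x\<close> on the scale
      1/\<mu>, and its transform vanishes outside [-3\<mu>, 3\<mu>], as the localization
      requires.\<close>
    define ph where "ph = (\<lambda>y. phi (\<mu> * y + - \<mu> * x))"
    have sph: "schwartz ph" unfolding ph_def by (rule schwartz_affine[OF phi(1)]) (use \<mu> in simp)
    have "(LINT y|lborel. f y * shift_series c r ph y) = 0"
    proof (rule pairing_eq_0_of_local_spectrum[OF f S schwartz_shift_series[OF sph], of "3 * \<mu>" U])
      fix t assume "\<bar>t\<bar> \<ge> 3 * \<mu>"
      hence "\<bar>t / \<mu>\<bar> \<ge> 3" using \<mu> by (simp add: field_simps)
      hence "fourier ph t = 0" unfolding ph_def fourier_affine[OF phi(1) \<mu>] using phi(2) by simp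
      thus "fourier (shift_series c r ph) t = 0" unfolding fourier_shift_series[OF sph] by simp
    qed (use \<mu> U van in \<open>auto simp: fourier_shift_series[OF sph]\<close>)
    with pairing_shift_series[OF f sph] have "(\<lambda>j. c j * (LINT y|lborel. f y * ph (y + r j))) sums 0" by simp
    moreover have "(LINT y|lborel. f y * ph (y + r j)) = (1 / \<mu>) *\<^sub>R H j n" for j
    proof -
      have e: "ph ((x - r j) + 1 / \<mu> * y + r j) = phi y" for y
        using \<mu> by (simp add: ph_def field_simps)
      have "(LINT y|lborel. f y * ph (y + r j)) = (1 / \<mu>) *\<^sub>R (LINT y|lborel. f ((x - r j) + 1 / \<mu> * y) * ph ((x - r j) + 1 / \<mu> * y + r j))"
        using \<mu> by (subst lborel_integral_real_affine[of "1 / \<mu>" _ "x - r j"]) auto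
      from this[unfolded e] show ?thesis unfolding H_def \<mu>_def by simp
    qed
    ultimately have "(\<lambda>j. (1 / \<mu>) *\<^sub>R (c j * H j n)) sums 0" by simp
    from sums_scaleR_right[OF this, of \<mu>] show ?thesis using \<mu> by simp
  qed
  define J where "J = (LINT y|lborel. (1 + \<bar>y\<bar>) ^ N * norm (phi y))"
  have intJ: "integrable lborel (\<lambda>y. (1 + \<bar>y\<bar>) ^ N * norm (phi y))"
  proof -
    have "(\<lambda>y. complex_of_real ((1 + \<bar>y\<bar>) ^ N)) \<in> poly_growth_space"
      unfolding poly_growth_space_def
      by (intro CollectI conjI continuous_intros exI[of _ 1] exI[of _ N])
         (simp add: abs_of_nonneg del: of_real_power of_real_add)
    from integrable_norm[OF integrable_poly_growth_schwartz[OF this phi(1), of 0]] show ?thesis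
      by (simp add: norm_mult del: of_real_power of_real_add)
  qed
  have fb: "norm (f (x - r j + y / real (Suc n)) * phi y) \<le> (A * (1 + \<bar>x\<bar>) ^ N * (1 + \<bar>r j\<bar>) ^ N) * ((1 + \<bar>y\<bar>) ^ N * norm (phi y))" for j n y
  proof -
    have "\<bar>y / real (Suc n)\<bar> \<le> \<bar>y\<bar>" by (simp add: field_simps)
    hence "1 + \<bar>x - r j + y / real (Suc n)\<bar> \<le> 1 + \<bar>x\<bar> + \<bar>r j\<bar> + \<bar>y\<bar>" by linarith
    also have "\<dots> \<le> (1 + \<bar>x\<bar>) * (1 + \<bar>r j\<bar>) * (1 + \<bar>y\<bar>)"
      by (simp add: algebra_simps)
    finally have "(1 + \<bar>x - r j + y / real (Suc n)\<bar>) ^ N \<le> ((1 + \<bar>x\<bar>) * (1 + \<bar>r j\<bar>) * (1 + \<bar>y\<bar>)) ^ N"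
      by (rule power_mono) simp
    hence "norm (f (x - r j + y / real (Suc n))) \<le> A * ((1 + \<bar>x\<bar>) * (1 + \<bar>r j\<bar>) * (1 + \<bar>y\<bar>)) ^ N"
      using A A0 by (meson mult_left_mono order_trans)
    hence "norm (f (x - r j + y / real (Suc n))) * norm (phi y) \<le> A * ((1 + \<bar>x\<bar>) * (1 + \<bar>r j\<bar>) * (1 + \<bar>y\<bar>)) ^ N * norm (phi y)"
      by (rule mult_right_mono) simp
    thus ?thesis unfolding norm_mult power_mult_distrib by (simp only: mult_ac)
  qed
  have meas: "(\<lambda>y. f (x - r j + y / real (Suc n)) * phi y) \<in> borel_measurable lborel" for j n
  proof -
    have "continuous_on UNIV (\<lambda>y. f (x - r j + y / real (Suc n)) * phi y)"
      by (intro continuous_intros continuous_on_compose2[OF fc] schwartz_imp_continuous[OF phi(1)]) auto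
    thus ?thesis using borel_measurable_continuous_onI by simp
  qed
  have Hb: "norm (H j n) \<le> (A * (1 + \<bar>x\<bar>) ^ N * (1 + \<bar>r j\<bar>) ^ N) * J" for j n
  proof -
    have "norm (H j n) \<le> (LINT y|lborel. norm (f (x - r j + y / real (Suc n)) * phi y))"
      unfolding H_def by (rule integral_norm_bound)
    also have "\<dots> \<le> (LINT y|lborel. (A * (1 + \<bar>x\<bar>) ^ N * (1 + \<bar>r j\<bar>) ^ N) * ((1 + \<bar>y\<bar>) ^ N * norm (phi y)))"
    proof (rule integral_mono)
      show i: "integrable lborel (\<lambda>y. (A * (1 + \<bar>x\<bar>) ^ N * (1 + \<bar>r j\<bar>) ^ N) * ((1 + \<bar>y\<bar>) ^ N * norm (phi y)))"
        by (intro integrable_mult_right intJ)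
      show "integrable lborel (\<lambda>y. norm (f (x - r j + y / real (Suc n)) * phi y))"
      proof (rule integrable_norm, rule Bochner_Integration.integrable_bound[OF i meas], rule AE_I2)
        fix y
        show "norm (f (x - r j + y / real (Suc n)) * phi y) \<le> norm ((A * (1 + \<bar>x\<bar>) ^ N * (1 + \<bar>r j\<bar>) ^ N) * ((1 + \<bar>y\<bar>) ^ N * norm (phi y)))"
          using fb[of j y n] by (rule order_trans) simp
      qed
    qed (rule fb)
    also have "\<dots> = (A * (1 + \<bar>x\<bar>) ^ N * (1 + \<bar>r j\<bar>) ^ N) * J" unfolding J_def by (rule integral_mult_right_zero)
    finally show ?thesis .
  qed
  define I where "I = (LINT y|lborel. phi y)"
  have Hlim: "(\<lambda>n. H j n) \<longlonglongrightarrow> f (x - r j) * I" for j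
  proof -
    have "(\<lambda>n. H j n) \<longlonglongrightarrow> (LINT y|lborel. f (x - r j) * phi y)"
      unfolding H_def
    proof (rule integral_dominated_convergence[where w = "\<lambda>y. (A * (1 + \<bar>x\<bar>) ^ N * (1 + \<bar>r j\<bar>) ^ N) * ((1 + \<bar>y\<bar>) ^ N * norm (phi y))"])
      show "(\<lambda>y. f (x - r j) * phi y) \<in> borel_measurable lborel"
        using borel_measurable_continuous_onI[OF schwartz_imp_continuous[OF phi(1)]] by simp
      show "AE y in lborel. (\<lambda>n. f (x - r j + y / real (Suc n)) * phi y) \<longlonglongrightarrow> f (x - r j) * phi y"
      proof (rule AE_I2)
        fix y
        have "(\<lambda>n. x - r j + y / real (Suc n)) \<longlonglongrightarrow> x - r j" by real_asymp
        moreover have "isCont f (x - r j)" using fc by (simp add: continuous_on_eq_continuous_at)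
        ultimately have "(\<lambda>n. f (x - r j + y / real (Suc n))) \<longlonglongrightarrow> f (x - r j)" by (rule isCont_tendsto_compose[rotated])
        thus "(\<lambda>n. f (x - r j + y / real (Suc n)) * phi y) \<longlonglongrightarrow> f (x - r j) * phi y" by (intro tendsto_intros)
      qed
    qed (use meas fb in \<open>auto intro!: integrable_mult_right intJ\<close>)
    thus ?thesis unfolding I_def by simp
  qed
  have tan: "(\<lambda>n. \<Sum>j. c j * H j n) \<longlonglongrightarrow> (\<Sum>j. c j * (f (x - r j) * I))"
    and sn: "summable (\<lambda>j. norm (c j * (f (x - r j) * I)))"
  proof -
    have SM: "summable (\<lambda>j. (A * (1 + \<bar>x\<bar>) ^ N * J) * (norm (c j) * (1 + \<bar>r j\<bar>) ^ N))" by (intro summable_mult sm)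
    have BM: "norm (c j * H j n) \<le> (A * (1 + \<bar>x\<bar>) ^ N * J) * (norm (c j) * (1 + \<bar>r j\<bar>) ^ N)" for j n
      using mult_left_mono[OF Hb[of j n], of "norm (c j)"] by (simp add: norm_mult mult_ac)
    have "(\<forall>\<^sub>F n in sequentially. summable (\<lambda>j. norm (c j * H j n))) \<and> summable (\<lambda>j. norm (c j * (f (x - r j) * I)))
      \<and> (\<lambda>n. \<Sum>j. c j * H j n) \<longlonglongrightarrow> (\<Sum>j. c j * (f (x - r j) * I))"
      by (rule tannerys_theorem[OF _ _ SM])
         (use BM in \<open>auto intro!: tendsto_mult_left Hlim always_eventually simp del: norm_mult\<close>)
    thus "(\<lambda>n. \<Sum>j. c j * H j n) \<longlonglongrightarrow> (\<Sum>j. c j * (f (x - r j) * I))"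
      "summable (\<lambda>j. norm (c j * (f (x - r j) * I)))" by blast+
  qed
  have "(\<Sum>j. c j * H j n) = 0" for n using zero[of n] by (simp add: sums_iff)
  hence "(\<lambda>n::nat. 0) \<longlonglongrightarrow> (\<Sum>j. c j * (f (x - r j) * I))" using tan by simp
  hence "(\<Sum>j. c j * (f (x - r j) * I)) = 0" by (simp add: LIMSEQ_const_iff)
  hence "(\<lambda>j. c j * (f (x - r j) * I)) sums 0"
    using summable_sums[OF summable_norm_cancel[OF sn]] by simp
  from sums_mult2[OF this, of "1 / I"] show ?thesis using phi(3) by (simp add: I_def[symmetric])
qed

section \<open>Interpolation of the samples by an entire function\<close>

text \<open>
  With the pairing used to define the spectrum, \<open>x \<mapsto> exp (2 \<pi> i s x)\<close> has spectrum \<open>{- s}\<close>; hence the sign in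
  the exponential of the interpolation kernel \<open>K\<close>.
\<close>

lemma entire_interpolant:
  fixes \<delta> s :: real
  assumes \<delta>: "0 < \<delta>" "\<delta> < 1"
    and f: "f \<in> X_S {s + real_of_int k | s k. s \<in> {0..1 - \<delta>}}"
  obtains G C N where "G holomorphic_on UNIV"
    "\<And>z. norm (G z) \<le> C * (1 + norm z) ^ N * exp ((pi - pi * \<delta> / 4) * \<bar>Im z\<bar>)"
    "\<And>m::int. G (of_int m) = 0 \<longleftrightarrow> f (of_int m + s) = 0"
proof -
  define S where "S = {s + real_of_int k | s k. s \<in> {0..1 - \<delta>}}"
  have fp: "f \<in> poly_growth_space" and spec: "spectrum_of f \<subseteq> S" using f by (auto simp: X_S_def S_def)
  obtain A N where A: "\<And>x. norm (f x) \<le> A * (1 + \<bar>x\<bar>) ^ N"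
    using fp unfolding poly_growth_space_def by blast
  have A0: "A \<ge> 0" using A[of 0] norm_ge_zero[of "f 0"] by (simp del: norm_ge_zero)
  \<comment> \<open>The interval [p, q] exceeds [0, 1-\<delta>] by 2e on each side: one e is lost to
    smoothing, the other leaves a neighbourhood of the spectrum. The resulting type is pi (q - p) +
    2 pi e = pi (1 - \<delta>/4), because q - p = 1 - \<delta>/2.\<close>
  define e where "e = \<delta> / 8"
  have e: "e > 0" using \<delta> by (simp add: e_def)
  define p q cc where "p = - 2 * e" and "q = 1 - \<delta> + 2 * e" and "cc = (p + q) / 2"
  have pq: "p < q" "q < p + 1" using \<delta> by (auto simp: p_def q_def e_def)
  obtain b where b: "bump e b" "bump_ft e b 0 = 1" using bump_exists[OF e] by metis
  define B where "B = bump_ft e b"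
  \<comment> \<open>\<open>ker\<close> is the transform of the indicator of [p, q]. Multiplying by
    \<open>B\<close> convolves this indicator with the bump, which makes the kernel decrease rapidly
    on the line and widens its support by e on either side.\<close>
  define ker where "ker = (\<lambda>z. integral {p..q} (\<lambda>u. exp (- (2 * of_real pi * \<i> * z) * complex_of_real u)))"
  define K where "K = (\<lambda>z. B z * ker z)"
  define n where "n = int_decode"

  have "ker holomorphic_on UNIV"
  proof -
    have "(\<lambda>z. integral (cbox p q) (\<lambda>u. exp (- (2 * of_real pi * \<i> * z) * complex_of_real u))) holomorphic_on UNIV"
    proof (rule leibniz_rule_holomorphic[where fx = "\<lambda>z u. - (2 * of_real pi * \<i>) * complex_of_real u * exp (- (2 * of_real pi * \<i> * z) * complex_of_real u)"])
      show "continuous_on (UNIV \<times> cbox p q) (\<lambda>(z, u). - (2 * of_real pi * \<i>) * complex_of_real u * exp (- (2 * of_real pi * \<i> * z) * complex_of_real u))"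
        unfolding split_beta by (intro continuous_intros)
    qed (auto intro!: derivative_eq_intros integrable_continuous_real continuous_intros)
    thus ?thesis unfolding ker_def by simp
  qed
  hence Khol: "K holomorphic_on UNIV"
    unfolding K_def B_def by (intro holomorphic_intros bump_ft_holomorphic[OF b(1)])
  define Ex where "Ex = (\<lambda>y. exp (2 * pi * y * cc + (pi - pi * \<delta> / 4) * \<bar>y\<bar>))"
  have kerb: "norm (ker z) \<le> exp (2 * pi * Im z * cc + pi * (q - p) * \<bar>Im z\<bar>)" for z
  proof -
    have "norm (ker z) \<le> exp (2 * pi * Im z * cc + pi * (q - p) * \<bar>Im z\<bar>) * (q - p)"
      unfolding ker_def
    proof (rule integral_bound)
      fix u assume u: "u \<in> {p..q}"
      have "Im z * (u - cc) \<le> \<bar>Im z\<bar> * \<bar>u - cc\<bar>" by (metis abs_ge_self abs_mult)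
      also have "\<dots> \<le> \<bar>Im z\<bar> * ((q - p) / 2)"
        using u by (intro mult_left_mono) (auto simp: cc_def abs_le_iff field_simps)
      finally have "2 * pi * (Im z * (u - cc)) \<le> 2 * pi * (\<bar>Im z\<bar> * ((q - p) / 2))" by (intro mult_left_mono) auto
      hence "2 * pi * (Im z * u) \<le> 2 * pi * Im z * cc + pi * (q - p) * \<bar>Im z\<bar>" by (simp add: algebra_simps)
      thus "norm (exp (- (2 * of_real pi * \<i> * z) * complex_of_real u)) \<le> exp (2 * pi * Im z * cc + pi * (q - p) * \<bar>Im z\<bar>)"
        unfolding norm_exp_eq_Re by simp
    qed (use pq in \<open>auto intro!: continuous_intros\<close>)
    also have "\<dots> \<le> exp (2 * pi * Im z * cc + pi * (q - p) * \<bar>Im z\<bar>) * 1"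
      using pq by (intro mult_left_mono) auto
    finally show ?thesis by simp
  qed
  \<comment> \<open>N powers absorb the growth of \<open>f\<close> at the sample points, and two
    more make the series over the integers converge.\<close>
  obtain C where C: "C \<ge> 0" "\<And>z. norm (B z) * (1 + norm z) ^ (N + 2) \<le> C * exp (2 * pi * e * \<bar>Im z\<bar>)"
    using bump_ft_decay[OF b(1) e, of "N + 2"] unfolding B_def by blast
  have Kb: "norm (K z) * (1 + norm z) ^ (N + 2) \<le> C * Ex (Im z)" for z
  proof -
    have "norm (K z) * (1 + norm z) ^ (N + 2) = (norm (B z) * (1 + norm z) ^ (N + 2)) * norm (ker z)"
      unfolding K_def norm_mult by (simp only: mult_ac)
    also have "\<dots> \<le> (C * exp (2 * pi * e * \<bar>Im z\<bar>)) * exp (2 * pi * Im z * cc + pi * (q - p) * \<bar>Im z\<bar>)"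
      by (rule mult_mono[OF C(2) kerb]) (use C(1) in simp_all)
    also have "\<dots> = C * exp (2 * pi * e * \<bar>Im z\<bar> + (2 * pi * Im z * cc + pi * (q - p) * \<bar>Im z\<bar>))"
      by (simp add: exp_add)
    also have "2 * pi * e * \<bar>Im z\<bar> + (2 * pi * Im z * cc + pi * (q - p) * \<bar>Im z\<bar>) = 2 * pi * Im z * cc + (pi - pi * \<delta> / 4) * \<bar>Im z\<bar>"
      by (simp add: p_def q_def e_def field_simps)
    finally show ?thesis unfolding Ex_def .
  qed

  define trm where "trm = (\<lambda>j z. f (of_int (n j) + s) * K (z - of_int (n j)))"
  define D where "D = A * (1 + \<bar>s\<bar>) ^ N * C"
  have D0: "D \<ge> 0" using A0 C by (simp add: D_def)
  have tb: "norm (trm j z) \<le> (D * (1 + norm z) ^ (N + 2) * Ex (Im z)) * (1 / (1 + \<bar>real_of_int (n j)\<bar>)\<^sup>2)" for j z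
  proof -
    define a where "a = \<bar>real_of_int (n j)\<bar>"
    define w where "w = z - of_int (n j)"
    have "norm (of_int (n j) :: complex) \<le> norm z + norm w" unfolding w_def using norm_triangle_ineq4[of z "z - of_int (n j)"] by simp
    hence "1 + a \<le> 1 + norm z + norm w" by (simp add: a_def)
    also have "\<dots> \<le> (1 + norm z) * (1 + norm w)" by (simp add: algebra_simps)
    finally have "(1 + a) ^ (N + 2) \<le> ((1 + norm z) * (1 + norm w)) ^ (N + 2)" by (rule power_mono) (simp add: a_def)
    hence "norm (K w) * (1 + a) ^ (N + 2) \<le> norm (K w) * ((1 + norm z) * (1 + norm w)) ^ (N + 2)"
      by (rule mult_left_mono) simp
    also have "\<dots> = (1 + norm z) ^ (N + 2) * (norm (K w) * (1 + norm w) ^ (N + 2))"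
      unfolding power_mult_distrib by (simp only: mult_ac)
    also have "\<dots> \<le> (1 + norm z) ^ (N + 2) * (C * Ex (Im w))" by (intro mult_left_mono Kb) auto
    also have "Im w = Im z" by (simp add: w_def)
    finally have 1: "norm (K w) * (1 + a) ^ (N + 2) \<le> (1 + norm z) ^ (N + 2) * (C * Ex (Im z))" .
    have "1 + \<bar>of_int (n j) + s\<bar> \<le> 1 + a + \<bar>s\<bar>" unfolding a_def by linarith
    also have "\<dots> \<le> (1 + \<bar>s\<bar>) * (1 + a)" by (simp add: algebra_simps a_def)
    finally have "(1 + \<bar>of_int (n j) + s\<bar>) ^ N \<le> ((1 + \<bar>s\<bar>) * (1 + a)) ^ N" by (rule power_mono) simp
    hence "norm (f (of_int (n j) + s)) \<le> A * ((1 + \<bar>s\<bar>) ^ N * (1 + a) ^ N)"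
      unfolding power_mult_distrib using A A0 by (meson mult_left_mono order_trans)
    hence "norm (trm j z) * (1 + a)\<^sup>2 \<le> (A * ((1 + \<bar>s\<bar>) ^ N * (1 + a) ^ N) * norm (K w)) * (1 + a)\<^sup>2"
      unfolding trm_def norm_mult w_def by (intro mult_right_mono) auto
    also have "\<dots> = A * (1 + \<bar>s\<bar>) ^ N * (norm (K w) * (1 + a) ^ (N + 2))" by (simp only: power_add mult_ac)
    also have "\<dots> \<le> A * (1 + \<bar>s\<bar>) ^ N * ((1 + norm z) ^ (N + 2) * (C * Ex (Im z)))"
      using A0 by (intro mult_left_mono 1) auto
    also have "\<dots> = D * (1 + norm z) ^ (N + 2) * Ex (Im z)" unfolding D_def by (simp only: mult_ac)
    finally show ?thesis unfolding a_def by (simp add: pos_le_divide_eq)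
  qed
  have ss: "summable (\<lambda>j. 1 / (1 + \<bar>real_of_int (n j)\<bar>)\<^sup>2)"
    unfolding n_def by (rule summable_int_decode_inverse_square)
  have tsum: "summable (\<lambda>j. norm (trm j z))" for z
    by (rule summable_comparison_test'[OF summable_mult[OF ss, of "D * (1 + norm z) ^ (N + 2) * Ex (Im z)"]])
       (use tb[of _ z] in simp)
  define F where "F = (\<lambda>z. \<Sum>j. trm j z)"
  have Fhol: "F holomorphic_on UNIV"
  proof (rule holomorphic_uniform_sequence[where f = "\<lambda>k z. \<Sum>j<k. trm j z"])
    show "(\<lambda>z. \<Sum>j<k. trm j z) holomorphic_on UNIV" for k
    proof -
      have "(\<lambda>z. K (z - of_int (n j))) holomorphic_on UNIV" for j
        using holomorphic_on_compose_gen[OF _ Khol, of "\<lambda>z. z - of_int (n j)" UNIV]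
        by (simp add: o_def holomorphic_on_diff)
      thus ?thesis unfolding trm_def by (intro holomorphic_intros)
    qed
    fix z :: complex assume "z \<in> UNIV"
    define R where "R = norm z + 1"
    define M where "M = D * (1 + R) ^ (N + 2) * exp (2 * pi * \<bar>cc\<bar> * R + pi * R)"
    have R: "R \<ge> 0" by (simp add: R_def add_nonneg_nonneg)
    have "norm (trm j w) \<le> M * (1 / (1 + \<bar>real_of_int (n j)\<bar>)\<^sup>2)" if w: "w \<in> cball z 1" for j w
    proof -
      have wR: "norm w \<le> R" using w norm_triangle_ineq[of z "w - z"] unfolding R_def by (simp add: dist_norm norm_minus_commute)
      hence iR: "\<bar>Im w\<bar> \<le> R" using abs_Im_le_cmod[of w] by linarith
      have "Im w * cc \<le> \<bar>cc\<bar> * R"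
      proof -
        have "Im w * cc \<le> \<bar>cc\<bar> * \<bar>Im w\<bar>" by (metis abs_ge_self abs_mult mult.commute)
        also have "\<dots> \<le> \<bar>cc\<bar> * R" using iR by (intro mult_left_mono) auto
        finally show ?thesis .
      qed
      hence "2 * pi * (Im w * cc) \<le> 2 * pi * (\<bar>cc\<bar> * R)" by (intro mult_left_mono) auto
      hence "2 * pi * Im w * cc \<le> 2 * pi * \<bar>cc\<bar> * R" by (simp only: mult.assoc)
      moreover have "(pi - pi * \<delta> / 4) * \<bar>Im w\<bar> \<le> pi * R"
        using \<delta> iR by (intro mult_mono) auto
      ultimately have "Ex (Im w) \<le> exp (2 * pi * \<bar>cc\<bar> * R + pi * R)" 
        unfolding Ex_def exp_le_cancel_iff by (rule add_mono)
      hence "D * (1 + norm w) ^ (N + 2) * Ex (Im w) \<le> M"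
        unfolding M_def using D0 wR R by (intro mult_mono power_mono) (auto simp: Ex_def)
      hence "(D * (1 + norm w) ^ (N + 2) * Ex (Im w)) * (1 / (1 + \<bar>real_of_int (n j)\<bar>)\<^sup>2) \<le> M * (1 / (1 + \<bar>real_of_int (n j)\<bar>)\<^sup>2)"
        by (rule mult_right_mono) simp
      thus ?thesis using tb[of j w] by linarith
    qed
    hence "uniform_limit (cball z 1) (\<lambda>k z. \<Sum>j<k. trm j z) F sequentially"
      unfolding F_def by (rule Weierstrass_m_test[OF _ summable_mult[OF ss]])
    thus "\<exists>d>0. cball z d \<subseteq> UNIV \<and> uniform_limit (cball z d) (\<lambda>k z. \<Sum>j<k. trm j z) F sequentially"
      by (intro exI[of _ 1]) auto
  qed auto
  define Q where "Q = (\<Sum>j. 1 / (1 + \<bar>real_of_int (n j)\<bar>)\<^sup>2)"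
  have Fb: "norm (F z) \<le> (D * (1 + norm z) ^ (N + 2) * Ex (Im z)) * Q" for z
  proof -
    have "norm (F z) \<le> (\<Sum>j. (D * (1 + norm z) ^ (N + 2) * Ex (Im z)) * (1 / (1 + \<bar>real_of_int (n j)\<bar>)\<^sup>2))"
      unfolding F_def by (rule norm_suminf_le[OF tb summable_mult[OF ss]])
    thus ?thesis unfolding Q_def by (simp only: suminf_mult[OF ss])
  qed

  \<comment> \<open>[q, p + 1] completes [p, q] to a period. Since a character integrates over the
    period to 1 or 0 and B 0 = 1, the coefficients \<open>d\<close> are the unit mass at 0 minus the
    samples of \<open>K\<close>: the defect of the reproducing formula.\<close>
  define tail where "tail = (\<lambda>m::int. integral {q..p + 1} (\<lambda>u. exp (- (2 * of_real pi * \<i> * of_int m) * complex_of_real u)))"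
  define d where "d = (\<lambda>m::int. B (of_int m) * tail m)"
  have dK: "d m = (if m = 0 then 1 else 0) - K (of_int m)" for m
  proof -
    have "integral {p..q} (\<lambda>u. exp (- (2 * of_real pi * \<i> * of_int m) * complex_of_real u)) + integral {q..p + 1} (\<lambda>u. exp (- (2 * of_real pi * \<i> * of_int m) * complex_of_real u))
      = integral {p..p + 1} (\<lambda>u. exp (- (2 * of_real pi * \<i> * of_int m) * complex_of_real u))"
      using pq by (intro Henstock_Kurzweil_Integration.integral_combine integrable_continuous_interval continuous_intros) auto
    also have "\<dots> = (if m = 0 then 1 else 0)" using integral_character[of p "p + 1" m] by simp
    finally have "ker (of_int m) + tail m = (if m = 0 then 1 else 0)" unfolding ker_def tail_def .
    hence "tail m = (if m = 0 then 1 else 0) - ker (of_int m)" by (simp add: algebra_simps)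
    thus ?thesis unfolding d_def K_def using b(2) by (simp add: B_def right_diff_distrib)
  qed
  have ntail: "norm (tail m) \<le> 1" for m
  proof -
    have "norm (tail m) \<le> 1 * (p + 1 - q)"
      unfolding tail_def by (rule integral_bound) (use pq in \<open>auto intro!: continuous_intros simp: norm_exp_eq_Re\<close>)
    thus ?thesis by (rule order_trans) (use pq in simp)
  qed
  have sB: "summable (\<lambda>j. norm (B (of_int (n j))) * (1 + \<bar>real_of_int (n j)\<bar>) ^ k)" for k
    using summable_bump_ft_samples[OF b(1) e, of 1 k] unfolding B_def n_def by simp
  interpret rapid_coefficients "\<lambda>j. d (n j)" "\<lambda>j. real_of_int (n j)"
  proof
    fix k
    have "norm (d (n j)) * (1 + \<bar>real_of_int (n j)\<bar>) ^ k \<le> norm (B (of_int (n j))) * (1 + \<bar>real_of_int (n j)\<bar>) ^ k" for j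
      unfolding d_def norm_mult using ntail[of "n j"] by (intro mult_right_mono mult_left_le) auto
    thus "summable (\<lambda>j. norm (d (n j)) * (1 + \<bar>real_of_int (n j)\<bar>) ^ k)"
      by (intro summable_comparison_test'[OF sB[of k]]) simp
  qed
  define U where "U = (\<Union>k::int. {p + e + of_int k<..<q - e + of_int k})"
  \<comment> \<open>Exchanging series and integral exhibits the multiplier of \<open>d\<close> as
    the integral over u in [q, p + 1] of a periodized bump evaluated at t - u.\<close>
  have van: "(\<Sum>j. d (n j) * exp (2 * of_real pi * \<i> * of_real (real_of_int (n j)) * of_real t)) = 0" if t: "t \<in> U" for t
  proof -
    obtain k :: int where k: "p + e + of_int k < t" "t < q - e + of_int k" using t by (auto simp: U_def)
    define g where "g = (\<lambda>j u. B (of_int (n j)) * exp (2 * of_real pi * \<i> * of_int (n j) * complex_of_real (t - u)))"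
    have "(\<lambda>j. integral {q..p + 1} (g j)) sums integral {q..p + 1} (\<lambda>u. \<Sum>j. g j u)"
    proof (rule sums_interval_integral[where M = "\<lambda>j. norm (B (of_int (n j)))"])
      show "continuous_on {q..p + 1} (g j)" for j unfolding g_def by (intro continuous_intros)
      show "norm (g j u) \<le> norm (B (of_int (n j)))" for j u unfolding g_def by (simp add: norm_mult norm_exp_eq_Re)
      show "summable (\<lambda>j. norm (B (of_int (n j))))" using sB[of 0] by simp
    qed
    moreover have "(\<Sum>j. g j u) = 0" if u: "u \<in> {q..p + 1}" for u
    proof -
      have "(\<lambda>j. bump_ft e b (of_real (1 * of_int (int_decode j))) * exp (2 * of_real pi * \<i> * of_real (1 * of_int (int_decode j)) * of_real (t - u))) sums 0"
      proof (rule poisson_vanishing[OF b(1) e])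
        fix k' :: int
        \<comment> \<open>These bounds put t - u - k between e - 1 and -e, hence t - u at distance
          more than e from every integer.\<close>
        have a: "t - of_int k - u < - e" "t - of_int k - u > e - 1" using k u by auto
        show "\<bar>t - u - of_int k' / 1\<bar> > e"
        proof (cases "k - k' \<le> 0")
          case True
          hence "real_of_int k \<le> real_of_int k'" by simp
          thus ?thesis using a by linarith
        next
          case False
          hence "real_of_int k \<ge> real_of_int k' + 1" by linarith
          thus ?thesis using a by linarith
        qed
      qed simp
      thus ?thesis unfolding g_def B_def n_def by (simp add: sums_iff)
    qed
    hence "integral {q..p + 1} (\<lambda>u. \<Sum>j. g j u) = 0"
      by (subst Henstock_Kurzweil_Integration.integral_cong[of _ _ "\<lambda>_. 0"]) auto
    moreover have "integral {q..p + 1} (g j) = d (n j) * exp (2 * of_real pi * \<i> * of_real (real_of_int (n j)) * of_real t)" for j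
    proof -
      have "g j = (\<lambda>u. (B (of_int (n j)) * exp (2 * of_real pi * \<i> * of_real (real_of_int (n j)) * of_real t)) * exp (- (2 * of_real pi * \<i> * of_int (n j)) * complex_of_real u))"
        unfolding g_def mult.assoc exp_add[symmetric] by (simp add: algebra_simps)
      thus ?thesis unfolding d_def tail_def by (simp add: mult_ac)
    qed
    ultimately show ?thesis by (simp add: sums_iff)
  qed
  have Uo: "open U" unfolding U_def by auto
  have SU: "S \<subseteq> U"
  proof
    fix x assume "x \<in> S"
    then obtain y k where x: "x = y + real_of_int k" "y \<in> {0..1 - \<delta>}" unfolding S_def by blast
    hence "x \<in> {p + e + of_int k<..<q - e + of_int k}" using e by (auto simp: p_def q_def)
    thus "x \<in> U" unfolding U_def by blast
  qed
  have SnU: "S \<noteq> UNIV"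
  proof -
    \<comment> \<open>This is the midpoint of the spectral gap between 1 - \<delta> and 1.\<close>
    have "1 - \<delta> / 2 \<notin> S"
    proof
      assume "1 - \<delta> / 2 \<in> S"
      then obtain y k where x: "1 - \<delta> / 2 = y + real_of_int k" "y \<in> {0..1 - \<delta>}" unfolding S_def by blast
      hence "0 < real_of_int k" "real_of_int k < 1" using \<delta> by auto
      thus False by simp
    qed
    thus ?thesis by blast
  qed
  \<comment> \<open>Annihilation by \<open>d\<close> at x = m + s says that \<open>f x\<close> is
    the sum of K(n) f(x - n); the reflection n -> m - n turns this into the series that defines
    \<open>F\<close> at m.\<close>
  have Fm: "F (of_int m) = f (of_int m + s)" for m :: int
  proof -
    define x where "x = of_int m + s"
    have n0: "n 0 = 0" by (simp add: n_def int_decode_def sum_decode_def)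
    have nj: "n j = 0 \<longleftrightarrow> j = 0" for j
      by (metis n0 n_def int_decode_inverse)
    have "(\<lambda>j. d (n j) * f (x - of_int (n j))) sums 0"
      by (rule convolution_equation[OF fp spec SnU Uo SU van])
    moreover have "(\<lambda>j. if j = 0 then f x else 0) sums f x" by (rule sums_single)
    ultimately have "(\<lambda>j. (if j = 0 then f x else 0) - d (n j) * f (x - of_int (n j))) sums (f x - 0)"
      by (rule sums_diff[rotated])
    moreover have "(if j = 0 then f x else 0) - d (n j) * f (x - of_int (n j)) = K (of_int (n j)) * f (x - of_int (n j))" for j
      unfolding dK by (cases "j = 0") (auto simp: nj n0 algebra_simps)
    ultimately have 1: "(\<lambda>j. K (of_int (n j)) * f (x - of_int (n j))) sums f x" by simp
    define a where "a = (\<lambda>i::int. f (of_int i + s) * K (of_int m - of_int i))"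
    have "summable (\<lambda>j. norm (a (int_decode j)))" using tsum[of "of_int m"] unfolding trm_def a_def n_def .
    from sums_int_decode_reflect[OF this, of m] have "(\<lambda>j. a (m - int_decode j)) sums F (of_int m)"
      unfolding F_def trm_def a_def n_def .
    moreover have "a (m - int_decode j) = K (of_int (n j)) * f (x - of_int (n j))" for j
      unfolding a_def n_def x_def by (simp add: algebra_simps)
    ultimately have "(\<lambda>j. K (of_int (n j)) * f (x - of_int (n j))) sums F (of_int m)" by simp
    with 1 show ?thesis unfolding x_def using sums_unique2 by blast
  qed
  \<comment> \<open>The factor has no zeros and modulus exp(-2 pi cc Im z). It moves the frequency
    interval to be symmetric about 0 and so removes the term with \<open>cc\<close> from the growth
    bound.\<close>
  define G where "G = (\<lambda>z. exp (2 * of_real pi * \<i> * of_real cc * z) * F z)"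
  show thesis
  proof (rule that[of G "D * Q" "N + 2"])
    show "G holomorphic_on UNIV" unfolding G_def by (intro holomorphic_intros Fhol)
    show "norm (G z) \<le> D * Q * (1 + norm z) ^ (N + 2) * exp ((pi - pi * \<delta> / 4) * \<bar>Im z\<bar>)" for z
    proof -
      have "norm (G z) = exp (- (2 * pi * Im z * cc)) * norm (F z)"
        unfolding G_def norm_mult norm_exp_eq_Re by (simp add: mult_ac)
      also have "\<dots> \<le> exp (- (2 * pi * Im z * cc)) * ((D * (1 + norm z) ^ (N + 2) * Ex (Im z)) * Q)"
        by (intro mult_left_mono Fb) auto
      also have "\<dots> = D * Q * (1 + norm z) ^ (N + 2) * (exp (- (2 * pi * Im z * cc)) * Ex (Im z))"
        by (simp only: mult_ac)
      also have "exp (- (2 * pi * Im z * cc)) * Ex (Im z) = exp ((pi - pi * \<delta> / 4) * \<bar>Im z\<bar>)"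
        unfolding Ex_def exp_add[symmetric] by simp
      finally show ?thesis .
    qed
    show "G (of_int m) = 0 \<longleftrightarrow> f (of_int m + s) = 0" for m :: int
      unfolding G_def Fm by simp
  qed
qed

section \<open>The sampling set\<close>

definition rational_fractions :: "nat \<Rightarrow> real" where
  "rational_fractions = from_nat_into (\<rat> \<inter> {0..<1})"

text \<open>
  Inserting the shift \<open>1/2\<close> between any two others makes adjacent shifts differ by at most \<open>1/2\<close>, which keeps
  the shifted blocks separated.
\<close>

definition shift_of_block :: "nat \<Rightarrow> real" where
  "shift_of_block k = (if even k then rational_fractions (fst (prod_decode (k div 2))) else 1 / 2)"

text \<open>Doubling the inner exponent squares the endpoint, so block k runs from a = 2^(2^k) up to
  a^2, the shape that the uniqueness theorem asks for. The least k also places the integers with |n|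
  < 2 in block 0, so that every integer receives a shift.\<close>

definition block :: "int \<Rightarrow> nat" where
  "block n = (LEAST k. \<bar>n\<bar> < 2 ^ 2 ^ Suc k)"

definition sample_point :: "int \<Rightarrow> real" where
  "sample_point n = of_int n + shift_of_block (block n)"

lemma rational_fractions_range: "range rational_fractions = \<rat> \<inter> {0..<1}"
  unfolding rational_fractions_def
  by (rule range_from_nat_into) (auto intro: countable_subset[OF _ countable_rat] exI[of _ 0])

lemma shift_of_block_bounds: "0 \<le> shift_of_block k" "shift_of_block k < 1"
  using rational_fractions_range by (auto simp: shift_of_block_def set_eq_iff image_iff)

lemma shift_of_block_adjacent:
  assumes "i \<le> Suc j" "j \<le> Suc i"
  shows "\<bar>shift_of_block i - shift_of_block j\<bar> \<le> 1 / 2"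
proof (cases "i = j")
  case False
  hence "even i \<noteq> even j" using assms by (cases "i < j") (auto simp: le_Suc_eq)
  hence "shift_of_block i = 1 / 2 \<or> shift_of_block j = 1 / 2" by (auto simp: shift_of_block_def)
  thus ?thesis using shift_of_block_bounds[of i] shift_of_block_bounds[of j]
    by (elim disjE) (auto simp: abs_if)
qed simp

lemma block_less: "\<bar>n\<bar> < 2 ^ 2 ^ Suc (block n)"
proof -
  have "nat \<bar>n\<bar> < 2 ^ nat \<bar>n\<bar>" by (rule less_exp)
  also have "\<dots> \<le> 2 ^ 2 ^ Suc (nat \<bar>n\<bar>)"
    by (intro power_increasing) (auto intro: order_trans[OF less_imp_le[OF less_exp]])
  finally have "int (nat \<bar>n\<bar>) < int (2 ^ 2 ^ Suc (nat \<bar>n\<bar>))" by (simp only: of_nat_less_iff)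
  hence "\<bar>n\<bar> < 2 ^ 2 ^ Suc (nat \<bar>n\<bar>)" by simp
  thus ?thesis unfolding block_def by (rule LeastI)
qed

lemma block_le: "\<bar>n\<bar> < 2 ^ 2 ^ Suc k \<Longrightarrow> block n \<le> k"
  unfolding block_def by (rule Least_le)

lemma block_eqI:
  assumes "2 ^ 2 ^ k \<le> \<bar>n\<bar>" "\<bar>n\<bar> < 2 ^ 2 ^ Suc k"
  shows "block n = k"
proof (rule antisym)
  show "block n \<le> k" using assms(2) by (rule block_le)
  show "k \<le> block n"
  proof (rule ccontr)
    assume "\<not> k \<le> block n"
    hence "(2::int) ^ 2 ^ Suc (block n) \<le> 2 ^ 2 ^ k" by (intro power_increasing) auto
    thus False using assms(1) block_less[of n] by linarith
  qed
qed

lemma block_le_Suc: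
  assumes "\<bar>m\<bar> \<le> \<bar>n\<bar> + 1"
  shows "block m \<le> Suc (block n)"
proof (rule block_le)
  have "\<bar>m\<bar> \<le> 2 ^ 2 ^ Suc (block n)" using assms block_less[of n] by linarith
  also have "(2::int) ^ 2 ^ Suc (block n) < 2 ^ 2 ^ Suc (Suc (block n))"
    by (intro power_strict_increasing) auto
  finally show "\<bar>m\<bar> < 2 ^ 2 ^ Suc (Suc (block n))" .
qed

text \<open>Consecutive integers lie in the same or in adjacent blocks, whose shifts differ by at
  most 1/2. Integers at distance 2 or more keep a gap above 1, because all shifts lie in [0,
  1).\<close>

lemma sample_point_separated:
  assumes "m < n"
  shows "sample_point m + 1 / 2 \<le> sample_point n"
proof (cases "n = m + 1")
  case True
  have "\<bar>shift_of_block (block m) - shift_of_block (block n)\<bar> \<le> 1 / 2"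
    using True by (intro shift_of_block_adjacent block_le_Suc) auto
  thus ?thesis using True unfolding sample_point_def abs_le_iff by simp
next
  case False
  hence "m + 2 \<le> n" using assms by simp
  hence "real_of_int m + 2 \<le> real_of_int n" by linarith
  thus ?thesis using shift_of_block_bounds[of "block m"] shift_of_block_bounds[of "block n"]
    unfolding sample_point_def by linarith
qed

lemma inj_sample_point: "inj sample_point"
  using sample_point_separated by (intro linorder_injI) fastforce

lemma uniformly_discrete_samples: "uniformly_discrete (range sample_point)"
proof -
  have "1 / 2 \<le> \<bar>sample_point m - sample_point n\<bar>" if "sample_point m \<noteq> sample_point n" for m n
    using that sample_point_separated[of m n] sample_point_separated[of n m] by (cases m n rule: linorder_cases) auto
  thus ?thesis unfolding uniformly_discrete_def by (intro exI[of _ "1 / 2"]) auto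
qed

lemma uniform_density_samples: "has_uniform_density (range sample_point) 1"
  unfolding has_uniform_density_def
proof (intro allI impI)
  fix e :: real assume e: "e > 0"
  show "\<exists>R. \<forall>r\<ge>R. \<forall>x. finite (range sample_point \<inter> {x<..<x + r}) \<and>
      \<bar>real (card (range sample_point \<inter> {x<..<x + r})) - r * 1\<bar> \<le> e * r"
  \<comment> \<open>Each integer n contributes one point of [n, n + 1), so a window of length r
    holds r points up to an error of at most 2; this error is at most e r once r >= 2/e.\<close>
  proof (intro exI[of _ "2 / e"] allI impI)
    fix r x :: real assume r: "r \<ge> 2 / e"
    define I where "I = {n. sample_point n \<in> {x<..<x + r}}"
    have L: "range sample_point \<inter> {x<..<x + r} = sample_point ` I" by (auto simp: I_def)
    have sp: "of_int n \<le> sample_point n" "sample_point n < of_int n + 1" for n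
      using shift_of_block_bounds[of "block n"] by (auto simp: sample_point_def)
    have up: "I \<subseteq> {\<lfloor>x\<rfloor>..\<lceil>x + r\<rceil> - 1}"
    proof
      fix n assume "n \<in> I"
      hence "x < of_int n + 1" "of_int n < x + r" using sp[of n] by (auto simp: I_def)
      thus "n \<in> {\<lfloor>x\<rfloor>..\<lceil>x + r\<rceil> - 1}" by (simp, linarith)
    qed
    have lo: "{\<lfloor>x\<rfloor> + 1..\<lfloor>x + r\<rfloor> - 1} \<subseteq> I"
    proof
      fix n assume "n \<in> {\<lfloor>x\<rfloor> + 1..\<lfloor>x + r\<rfloor> - 1}"
      hence "\<lfloor>x\<rfloor> < n" "n + 1 \<le> \<lfloor>x + r\<rfloor>" by auto
      hence "x < of_int n" "of_int n + 1 \<le> x + r" by linarith+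
      thus "n \<in> I" using sp[of n] by (auto simp: I_def)
    qed
    have fin: "finite I" using up by (rule finite_subset) simp
    have "card I \<le> card {\<lfloor>x\<rfloor>..\<lceil>x + r\<rceil> - 1}" by (rule card_mono[OF _ up]) simp
    hence c1: "real (card I) \<le> real (nat (\<lceil>x + r\<rceil> - \<lfloor>x\<rfloor>))" by simp
    have "card {\<lfloor>x\<rfloor> + 1..\<lfloor>x + r\<rfloor> - 1} \<le> card I" by (rule card_mono[OF fin lo])
    hence c2: "real (nat (\<lfloor>x + r\<rfloor> - 1 - \<lfloor>x\<rfloor>)) \<le> real (card I)" by simp
    have r0: "r > 0" using r e by (meson divide_pos_pos less_le_trans zero_less_numeral)
    have "2 \<le> e * r" using r e by (simp add: field_simps)
    moreover have "real (card I) \<le> r + 2" "real (card I) \<ge> r - 2" using c1 c2 r0 by linarith+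
    ultimately have "\<bar>real (card I) - r\<bar> \<le> e * r" by linarith
    thus "finite (range sample_point \<inter> {x<..<x + r}) \<and>
      \<bar>real (card (range sample_point \<inter> {x<..<x + r})) - r * 1\<bar> \<le> e * r"
      unfolding L using fin card_image[OF inj_on_subset[OF inj_sample_point subset_UNIV], of I] by simp
  qed
qed

lemma uniqueness_set_samples:
  assumes \<delta>: "0 < \<delta>" "\<delta> < 1"
  shows "uniqueness_set (range sample_point) (X_S {s + real_of_int k | s k. s \<in> {0..1 - \<delta>}})"
  unfolding uniqueness_set_def
proof (intro ballI impI)
  fix f assume f: "f \<in> X_S {s + real_of_int k | s k. s \<in> {0..1 - \<delta>}}"
    and z: "\<forall>l\<in>range sample_point. f l = 0"
  have shifted: "f (of_int m + rational_fractions j) = 0" for m j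
  proof -
    obtain G C N where G: "G holomorphic_on UNIV"
      "\<And>z. norm (G z) \<le> C * (1 + norm z) ^ N * exp ((pi - pi * \<delta> / 4) * \<bar>Im z\<bar>)"
      "\<And>m::int. G (of_int m) = 0 \<longleftrightarrow> f (of_int m + rational_fractions j) = 0"
      using entire_interpolant[OF \<delta> f] by metis
    have "\<exists>\<^sub>\<infinity>a::nat. \<forall>n::int. int a \<le> \<bar>n\<bar> \<and> \<bar>n\<bar> < int (a\<^sup>2) \<longrightarrow> G (of_int n) = 0"
      unfolding INFM_nat_le
    proof
      fix i :: nat
      \<comment> \<open>The first component j of the code selects the shift, and the factor 2 makes
        k even, so that this shift is the one in force. The second component i is free and pushes
        the block beyond any given bound.\<close>
      define k where "k = 2 * prod_encode (j, i)"
      have "i \<le> prod_encode (j, i)" by (rule le_prod_encode_2)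
      also have "\<dots> \<le> k" by (simp add: k_def)
      also have "k \<le> 2 ^ k" by (simp add: less_imp_le)
      also have "(2::nat) ^ k \<le> 2 ^ 2 ^ k" by (simp add: less_imp_le)
      finally have "i \<le> 2 ^ 2 ^ k" .
      moreover have "G (of_int n) = 0" if n: "int (2 ^ 2 ^ k) \<le> \<bar>n\<bar>" "\<bar>n\<bar> < int ((2 ^ 2 ^ k)\<^sup>2)" for n
      proof -
        have "block n = k"
          using n by (intro block_eqI) (simp_all add: power_mult[symmetric] mult.commute)
        hence "sample_point n = of_int n + rational_fractions j"
          by (simp add: sample_point_def shift_of_block_def k_def)
        thus ?thesis using z G(3) by (metis rangeI)
      qed
      ultimately show "\<exists>a\<ge>i. \<forall>n::int. int a \<le> \<bar>n\<bar> \<and> \<bar>n\<bar> < int (a\<^sup>2) \<longrightarrow> G (of_int n) = 0" by blast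
    qed
    with G(1,2) have "G = (\<lambda>_. 0)"
      using \<delta> by (intro entire_zero_of_zeros_on_long_blocks[of G "pi * \<delta> / 4" C N]) auto
    thus ?thesis using G(3)[of m] by simp
  qed
  have rat: "f x = 0" if "x \<in> \<rat>" for x
  proof -
    have "frac x \<in> \<rat> \<inter> {0..<1}" using that by (auto simp: frac_def frac_lt_1[unfolded frac_def])
    then obtain j where "rational_fractions j = frac x" using rational_fractions_range by (metis imageE)
    thus ?thesis using shifted[of "\<lfloor>x\<rfloor>" j] by (simp add: frac_def)
  qed
  have "continuous_on UNIV f" using f by (simp add: X_S_def poly_growth_space_def)
  hence "f x = 0" for x
    using continuous_constant_on_closure[of "\<rat>" f 0 x] rat by (simp add: Rats_closure_real)
  thus "f = (\<lambda>_. 0)" by auto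
qed

theorem theorem5:
  shows "\<exists>L :: real set. uniformly_discrete L \<and> has_uniform_density L 1 \<and>
    (\<forall>\<delta>::real. 0 < \<delta> \<and> \<delta> < 1 \<longrightarrow>
       uniqueness_set L (X_S {s + real_of_int k | s k. s \<in> {0..1 - \<delta>}}))"
  using uniformly_discrete_samples uniform_density_samples uniqueness_set_samples by blast

end
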